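(* Let $E$, $E'$ be connected $f_s$-BCs and let $\phi:E\rightarrow E'$ be a covering (resp. regular covering). Then $\phi$ induces a covering (resp. Galois covering) $f:(Q_E,I_E)\rightarrow(Q_{E'},I_{E'})$ of the associated quivers with relations. Especially, $\phi$ induces a covering functor (resp. Galois covering functor) $F:\Lambda_E\rightarrow\Lambda_{E'}$.
   Context: $k$ is a fixed field; paths in quivers are written from right to left, with source $s$ and terminal $t$. Let $G=\langle g\rangle$ be a fixed infinite cyclic group. A fractional Brauer configuration (f-BC) is a quadruple $E=(E,P,L,d)$, where $E$ is a $G$-set, $P$ and $L$ are two partitions of $E$ (write $P(e)$, $L(e)$ for the classes containing $e\in E$), and $d:E\to\mathbb{Z}_{>0}$ is a function, such that: (f1) $L(e)\subseteq P(e)$ and $P(e)$ is a finite set for each $e\in E$; (f2) if $L(e_1)=L(e_2)$, then $P(g\cdot e_1)=P(g\cdot e_2)$; (f3) if $e_1,e_2$ belong to the same $G$-orbit, then $d(e_1)=d(e_2)$; (f4) $P(e_1)=P(e_2)$ if and only if $P(g^{d(e_1)}\cdot e_1)=P(g^{d(e_2)}\cdot e_2)$; (f5) $L(e_1)=L(e_2)$ if and only if $L(g^{d(e_1)}\cdot e_1)=L(g^{d(e_2)}\cdot e_2)$; (f6) the sequence $L(g^{d(e)-1}\cdot e)\cdots L(g\cdot e)L(e)$ is not a proper subsequence (block of consecutive terms) of $L(g^{d(h)-1}\cdot h)\cdots L(g\cdot h)L(h)$ for all $e,h\in E$. Type S. A standard sequence of $E$ is $p=(g^{n-1}\cdot e,\ldots,g\cdot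 e,e)$ with $e\in E$, $0\le n\le d(e)$ (for $n=0$ the trivial sequence $()_e$). Put ${}^{\wedge}p=(g^{d(e)-1}\cdot e,\ldots,g^{n+1}\cdot e,g^n\cdot e)$ and $p^{\wedge}=(g^{-1}\cdot e,g^{-2}\cdot e,\ldots,g^{n-d(e)}\cdot e)$ (so ${}^\wedge p$ is $()_{g^{d(e)}\cdot e}$ and $p^\wedge$ is $()_e$ when $n=d(e)$), and $L(p)=L(g^{n-1}\cdot e)\cdots L(g\cdot e)L(e)$ as a formal sequence ($L(()_e)=1_{P(e)}$). Write $p\equiv q$ if $L(p)=L(q)$; $[p]=\{q\mid q\equiv p\}$; for a set $\mathscr{X}$ of standard sequences, $[\mathscr{X}]=\bigcup_{p\in\mathscr{X}}[p]$, ${}^\wedge\mathscr{X}=\{{}^\wedge p\mid p\in\mathscr{X}\}$, $\mathscr{X}^\wedge=\{p^\wedge\mid p\in\mathscr{X}\}$. $E$ is of type S (an $f_s$-BC) if: (f7) for standard sequences $p\equiv q$, $[[{}^\wedge p]^\wedge]=[[{}^\wedge q]^\wedge]$ or $[{}^\wedge[p^\wedge]]=[{}^\wedge[q^\wedge]]$. A morphism of f-BCs $\phi:(E,P,L,d)\to(E',P',L',d')$ is a $G$-equivariant map with $\phi(P(e))\subseteq P'(\phi(e))$, $\phi(L(e))\subseteq L'(\phi(e))$, $d'(\phi(e))=d(e)$ for all $e$; it is a covering if it induces bijections $P(e)\to P'(\phi(e))$ and $L(e)\to L'(\phi(e))$ for all $e\in E$. Walks. A walk of $E$ is a sequence $w=(e_n|\delta_n|e_{n-1})\cdots(e_1|\delta_1|e_0)$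 with $e_i\in E$, $\delta_i\in\{g,g^{-1},\tau\}$, such that $e_i=g\cdot e_{i-1}$ if $\delta_i=g$, $e_i=g^{-1}\cdot e_{i-1}$ if $\delta_i=g^{-1}$, $P(e_i)=P(e_{i-1})$ if $\delta_i=\tau$; abbreviated $(e_n|\delta_n\cdots\delta_1|e_0)$; $(e||e)$ is the trivial walk. Composition $uv$ is concatenation when the terminal of $v$ is the source of $u$. $E$ is connected if any two elements can be connected by a walk. Homotopy $\sim$ is the smallest equivalence relation on walks with: (h1) $(e|g^{-1}g|e)\sim(e|gg^{-1}|e)\sim(e|\tau|e)\sim(e||e)$; (h2) $(e_2|\tau|e_1)(e_1|\tau|e_0)\sim(e_2|\tau|e_0)$; (h3) $(g^{d(h)}\cdot h|\tau|g^{d(e)}\cdot e)(g^{d(e)}\cdot e|g^{d(e)}|e)\sim(g^{d(h)}\cdot h|g^{d(h)}|h)(h|\tau|e)$ whenever $P(e)=P(h)$; (h4) $(g\cdot h|\tau|g\cdot e)(g\cdot e|g|e)\sim(g\cdot h|g|h)(h|\tau|e)$ whenever $L(e)=L(h)$; (h5) compatibility with composition on both sides. $\Pi(E,e)$ is the group of homotopy classes of closed walks at $e$; a morphism $\phi$ induces $\phi_*:\Pi(E,e)\to\Pi(E',\phi(e))$. A covering $\phi:E\to E'$ of connected f-BCs is regular if $\phi_*(\Pi(E,e))$ is normal in $\Pi(E',\phi(e))$ for some $e\in E$. The quiver with relations $(Q_E,I_E)$: $(Q_E)_0=\{P(e)\mid e\in E\}$, $(Q_E)_1=\{L(e)\mid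 e\in E\}$ with $s(L(e))=P(e)$, $t(L(e))=P(g\cdot e)$. $I_E$ is the ideal of the path category $kQ_E$ generated by: (fR1) $L(g^{d(e)-1-j}\cdot e)\cdots L(g\cdot e)L(e)-L(g^{d(h)-1-j}\cdot h)\cdots L(g\cdot h)L(h)$, where $j\ge 0$ (both expressions being paths), $P(e)=P(h)$ and $L(g^{d(e)-i}\cdot e)=L(g^{d(h)-i}\cdot h)$ for $1\le i\le j$; (fR2) paths $L(e_n)\cdots L(e_2)L(e_1)$ with $n>1$ and $\bigcap_{i=1}^n g^{n-i}\cdot L(e_i)=\emptyset$; (fR3) paths $L(g^{n-1}\cdot e)\cdots L(g\cdot e)L(e)$ with $n>d(e)$. The fractional Brauer configuration category is $\Lambda_E=kQ_E/I_E$ (a locally bounded $k$-category). The quiver morphism $f$ induced by $\phi$ maps $P(e)\mapsto P'(\phi(e))$ and $L(e)\mapsto L'(\phi(e))$, and $F$ is induced by $kf$. Coverings of quivers with relations. A quiver morphism $f:Q\to Q'$ is a covering if for each $x\in Q_0$ it induces bijections from the arrows starting (resp. ending) at $x$ to the arrows starting (resp. ending) at $f(x)$. Let $(Q,I)$, $(Q',I')$ be quivers with relations, where $I$, $I'$ are contained in the ideals generated by arrows. A minimal relation of $I$ is $\rho=\sum_{i=1}^n\lambda_iu_i\in I(x,y)$ with $n\ge2$, $\lambda_i\in k^*$, $u_i$ pairwise distinct paths from $x$ to $y$ and $\sum_{i\in K}\lambda_iu_i\notin I(x,y)$ for every non-empty proper subset $K$ of $\{1,\dots,n\}$; a zero relation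 of $I$ is a path lying in $I$. A morphism $f:(Q,I)\to(Q',I')$ is a quiver morphism such that the induced functor $kf:kQ\to kQ'$ maps $I$ into $I'$; it is a covering if moreover $f$ is a covering of quivers and for any minimal or zero relation $\rho'\in I'(a',b')$ and any $a\in f^{-1}(a')$ (resp. $b\in f^{-1}(b')$) there exist $b\in f^{-1}(b')$ (resp. $a\in f^{-1}(a')$) and $\rho\in I(a,b)$ with $(kf)(\rho)=\rho'$. A group $\Pi$ of automorphisms of $(Q,I)$ acts freely on $Q$ if $h\in\Pi$, $a\in Q_0$, $h(a)=a$ imply $h=\mathrm{id}_Q$; then $Q/\Pi$ is the orbit quiver and $\overline{I}$ is the image of $I$ in $k(Q/\Pi)$, i.e. $\overline{I}(\overline{x},\overline{y})$ is spanned by the images of all $\rho\in I(a,b)$, $a\in\overline{x}$, $b\in\overline{y}$. A morphism $f:(Q,I)\to(Q',I')$ is a Galois covering if there are such a group $\Pi$ and an isomorphism $\nu:(Q/\Pi,\overline{I})\to(Q',I')$ of quivers with relations with $f=\nu\pi$, where $\pi:(Q,I)\to(Q/\Pi,\overline{I})$ is the natural projection. Covering functors. A $k$-linear functor $F:M\to N$ of $k$-categories is a covering functor if for all objects $a,b$ of $N$ and $x,y$ of $M$ it induces isomorphisms $\bigoplus_{z:F(z)=a}M(z,y)\to N(a,F(y))$ and $\bigoplus_{z:F(z)=b}M(x,z)\to N(F(x),b)$. A covering functor $F:M\to N$ of locally bounded categories is a Galois covering if it is surjective on objects and there is a group $H$ of $k$-linear automorphisms of $M$ acting freely on (the objects of)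 $M$ such that $F\circ h=F$ for all $h\in H$ and $H$ acts transitively on $F^{-1}(a)$ for each object $a$ of $N$. *)

theory Defs
  imports
    "Graph_Theory.Arc_Walk"
    "HOL-Algebra.Group_Action"
    "HOL-Algebra.Elementary_Groups"
    "HOL-Algebra.Algebraic_Closure_Type"
    "HOL-Library.Disjoint_Sets"
    "HOL-Library.Poly_Mapping"
    "HOL-Library.Set_Algebras"
    "HOL-Library.Sublist"
begin

section \<open>Fractional Brauer configurations\<close>

text \<open>
  The infinite cyclic group \<open>G = \<langle>g\<rangle>\<close> is \<^const>\<open>integer_group\<close> with \<open>g = 1\<close>, so that
  \<open>g\<^sup>n \<cdot> e\<close> is \<open>act E n e\<close> for an integer \<open>n\<close>. The partitions \<open>P\<close> and \<open>L\<close> are given by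
  their sets of classes.
\<close>

record 'e fbc =
  elems :: "'e set"
  act :: "int \<Rightarrow> 'e \<Rightarrow> 'e"
  Pparts :: "'e set set"
  Lparts :: "'e set set"
  deg :: "'e \<Rightarrow> nat"

definition Pcls :: "'e fbc \<Rightarrow> 'e \<Rightarrow> 'e set" where
  "Pcls E e = (THE S. S \<in> Pparts E \<and> e \<in> S)"

definition Lcls :: "'e fbc \<Rightarrow> 'e \<Rightarrow> 'e set" where
  "Lcls E e = (THE S. S \<in> Lparts E \<and> e \<in> S)"

text \<open>
  The formal sequence \<open>L(g\<^bsup>n-1\<^esup>\<cdot>e) \<cdots> L(g\<cdot>e) L(e)\<close>. All sequences of arrows are lists in the
  order of traversal, i.e. the reverse of the right-to-left notation.
\<close>

definition Lseq :: "'e fbc \<Rightarrow> 'e \<Rightarrow> nat \<Rightarrow> 'e set list" where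
  "Lseq E e n = map (\<lambda>i. Lcls E (act E (int i) e)) [0..<n]"

locale fBC =
  fixes E :: "'e fbc"
  assumes G_set: "group_action integer_group (elems E) (act E)"
    and P_partition: "partition_on (elems E) (Pparts E)"
    and L_partition: "partition_on (elems E) (Lparts E)"
    and deg_pos: "e \<in> elems E \<Longrightarrow> 0 < deg E e"
    and f1: "e \<in> elems E \<Longrightarrow> Lcls E e \<subseteq> Pcls E e \<and> finite (Pcls E e)"
    and f2: "\<lbrakk>e1 \<in> elems E; e2 \<in> elems E; Lcls E e1 = Lcls E e2\<rbrakk>
      \<Longrightarrow> Pcls E (act E 1 e1) = Pcls E (act E 1 e2)"
    and f3: "e \<in> elems E \<Longrightarrow> deg E (act E n e) = deg E e"
    and f4: "\<lbrakk>e1 \<in> elems E; e2 \<in> elems E\<rbrakk> \<Longrightarrow> Pcls E e1 = Pcls E e2 \<longleftrightarrow>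
      Pcls E (act E (int (deg E e1)) e1) = Pcls E (act E (int (deg E e2)) e2)"
    and f5: "\<lbrakk>e1 \<in> elems E; e2 \<in> elems E\<rbrakk> \<Longrightarrow> Lcls E e1 = Lcls E e2 \<longleftrightarrow>
      Lcls E (act E (int (deg E e1)) e1) = Lcls E (act E (int (deg E e2)) e2)"
    and f6: "\<lbrakk>e \<in> elems E; h \<in> elems E\<rbrakk> \<Longrightarrow>
      \<not> strict_sublist (Lseq E e (deg E e)) (Lseq E h (deg E h))"

subsection \<open>Type S\<close>

text \<open>
  The pair \<open>(e, n)\<close> stands for the standard sequence \<open>(g\<^bsup>n-1\<^esup>\<cdot>e, \<dots>, g\<cdot>e, e)\<close>, and \<open>(e, 0)\<close> for
  \<open>()\<^sub>e\<close>.
\<close>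

definition std_seqs :: "'e fbc \<Rightarrow> ('e \<times> nat) set" where
  "std_seqs E = {(e, n). e \<in> elems E \<and> n \<le> deg E e}"

fun lcompl :: "'e fbc \<Rightarrow> 'e \<times> nat \<Rightarrow> 'e \<times> nat" where
  "lcompl E (e, n) = (act E (int n) e, deg E e - n)"

fun rcompl :: "'e fbc \<Rightarrow> 'e \<times> nat \<Rightarrow> 'e \<times> nat" where
  "rcompl E (e, n) = (act E (int n - int (deg E e)) e, deg E e - n)"

text \<open>
  \<open>L(p)\<close> as a formal sequence together with its starting point \<open>P(e)\<close>. The latter only matters
  for \<open>L(()\<^sub>e) = 1\<^bsub>P(e)\<^esub>\<close>; for \<open>n > 0\<close> it is determined by \<open>L(e)\<close>.
\<close>

fun Lpath :: "'e fbc \<Rightarrow> 'e \<times> nat \<Rightarrow> 'e set \<times> 'e set list" where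
  "Lpath E (e, n) = (Pcls E e, Lseq E e n)"

definition std_class :: "'e fbc \<Rightarrow> ('e \<times> nat) set \<Rightarrow> ('e \<times> nat) set" where
  "std_class E S = (\<Union>p\<in>S. {q \<in> std_seqs E. Lpath E q = Lpath E p})"

locale fsBC = fBC +
  assumes f7: "\<lbrakk>p \<in> std_seqs E; q \<in> std_seqs E; Lpath E p = Lpath E q\<rbrakk> \<Longrightarrow>
      std_class E (rcompl E ` std_class E {lcompl E p}) =
        std_class E (rcompl E ` std_class E {lcompl E q}) \<or>
      std_class E (lcompl E ` std_class E {rcompl E p}) =
        std_class E (lcompl E ` std_class E {rcompl E q})"

subsection \<open>Morphisms and coverings\<close>

definition fBC_morphism :: "'e fbc \<Rightarrow> 'f fbc \<Rightarrow> ('e \<Rightarrow> 'f) \<Rightarrow> bool" where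
  "fBC_morphism E E' \<phi> \<longleftrightarrow> fBC E \<and> fBC E' \<and>
     (\<forall>e \<in> elems E. \<phi> e \<in> elems E' \<and>
        (\<forall>n. \<phi> (act E n e) = act E' n (\<phi> e)) \<and>
        \<phi> ` Pcls E e \<subseteq> Pcls E' (\<phi> e) \<and>
        \<phi> ` Lcls E e \<subseteq> Lcls E' (\<phi> e) \<and>
        deg E' (\<phi> e) = deg E e)"

definition fBC_covering :: "'e fbc \<Rightarrow> 'f fbc \<Rightarrow> ('e \<Rightarrow> 'f) \<Rightarrow> bool" where
  "fBC_covering E E' \<phi> \<longleftrightarrow> fBC_morphism E E' \<phi> \<and>
     (\<forall>e \<in> elems E. bij_betw \<phi> (Pcls E e) (Pcls E' (\<phi> e)) \<and>
        bij_betw \<phi> (Lcls E e) (Lcls E' (\<phi> e)))"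

subsection \<open>Walks, homotopy, fundamental group\<close>

text \<open>
  A walk \<open>(e\<^sub>n|\<delta>\<^sub>n|e\<^bsub>n-1\<^esub>) \<cdots> (e\<^sub>1|\<delta>\<^sub>1|e\<^sub>0)\<close> is the pair of \<open>e\<^sub>0\<close> and the list
  \<open>[(\<delta>\<^sub>1, e\<^sub>1), \<dots>, (\<delta>\<^sub>n, e\<^sub>n)]\<close>.
\<close>

datatype dir = Fwd | Bwd | Tau

type_synonym 'e walk = "'e \<times> (dir \<times> 'e) list"

fun is_step :: "'e fbc \<Rightarrow> 'e \<Rightarrow> dir \<Rightarrow> 'e \<Rightarrow> bool" where
  "is_step E x Fwd y \<longleftrightarrow> y = act E 1 x"
| "is_step E x Bwd y \<longleftrightarrow> y = act E (-1) x"
| "is_step E x Tau y \<longleftrightarrow> Pcls E y = Pcls E x"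

fun is_walk :: "'e fbc \<Rightarrow> 'e walk \<Rightarrow> bool" where
  "is_walk E (x, []) \<longleftrightarrow> x \<in> elems E"
| "is_walk E (x, (\<delta>, y) # s) \<longleftrightarrow> x \<in> elems E \<and> is_step E x \<delta> y \<and> is_walk E (y, s)"

fun walk_end :: "'e walk \<Rightarrow> 'e" where
  "walk_end (x, s) = last (x # map snd s)"

text \<open>\<open>walk_comp u v\<close> is the composition \<open>uv\<close>: first \<open>v\<close>, then \<open>u\<close>.\<close>

definition walk_comp :: "'e walk \<Rightarrow> 'e walk \<Rightarrow> 'e walk" where
  "walk_comp u v = (fst v, snd v @ snd u)"

definition walk_map :: "('e \<Rightarrow> 'f) \<Rightarrow> 'e walk \<Rightarrow> 'f walk" where
  "walk_map \<phi> w = (\<phi> (fst w), map (\<lambda>(\<delta>, y). (\<delta>, \<phi> y)) (snd w))"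

definition fBC_connected :: "'e fbc \<Rightarrow> bool" where
  "fBC_connected E \<longleftrightarrow>
     (\<forall>x \<in> elems E. \<forall>y \<in> elems E. \<exists>w. is_walk E w \<and> fst w = x \<and> walk_end w = y)"

definition fwd_steps :: "'e fbc \<Rightarrow> 'e \<Rightarrow> nat \<Rightarrow> (dir \<times> 'e) list" where
  "fwd_steps E e n = map (\<lambda>i. (Fwd, act E (int (Suc i)) e)) [0..<n]"

inductive homotopic :: "'e fbc \<Rightarrow> 'e walk \<Rightarrow> 'e walk \<Rightarrow> bool" for E :: "'e fbc" where
  hrefl: "is_walk E w \<Longrightarrow> homotopic E w w"
| hsym: "homotopic E u v \<Longrightarrow> homotopic E v u"
| htrans: "\<lbrakk>homotopic E u v; homotopic E v w\<rbrakk> \<Longrightarrow> homotopic E u w"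
| h1a: "e \<in> elems E \<Longrightarrow> homotopic E (e, [(Fwd, act E 1 e), (Bwd, e)]) (e, [])"
| h1b: "e \<in> elems E \<Longrightarrow> homotopic E (e, [(Bwd, act E (-1) e), (Fwd, e)]) (e, [])"
| h1c: "e \<in> elems E \<Longrightarrow> homotopic E (e, [(Tau, e)]) (e, [])"
| h2: "is_walk E (e0, [(Tau, e1), (Tau, e2)]) \<Longrightarrow>
    homotopic E (e0, [(Tau, e1), (Tau, e2)]) (e0, [(Tau, e2)])"
| h3: "\<lbrakk>e \<in> elems E; h \<in> elems E; Pcls E e = Pcls E h\<rbrakk> \<Longrightarrow>
    homotopic E (e, fwd_steps E e (deg E e) @ [(Tau, act E (int (deg E h)) h)])
                (e, (Tau, h) # fwd_steps E h (deg E h))"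
| h4: "\<lbrakk>e \<in> elems E; h \<in> elems E; Lcls E e = Lcls E h\<rbrakk> \<Longrightarrow>
    homotopic E (e, [(Fwd, act E 1 e), (Tau, act E 1 h)])
                (e, [(Tau, h), (Fwd, act E 1 h)])"
| h5l: "\<lbrakk>homotopic E u v; is_walk E w; fst w = walk_end u; fst w = walk_end v\<rbrakk> \<Longrightarrow>
    homotopic E (walk_comp w u) (walk_comp w v)"
| h5r: "\<lbrakk>homotopic E u v; is_walk E w; walk_end w = fst u; walk_end w = fst v\<rbrakk> \<Longrightarrow>
    homotopic E (walk_comp u w) (walk_comp v w)"

definition hclass :: "'e fbc \<Rightarrow> 'e walk \<Rightarrow> 'e walk set" where
  "hclass E w = {v. homotopic E w v}"

definition fund_group :: "'e fbc \<Rightarrow> 'e \<Rightarrow> 'e walk set monoid" where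
  "fund_group E e = \<lparr>carrier = hclass E ` {w. is_walk E w \<and> fst w = e \<and> walk_end w = e},
     monoid.mult = (\<lambda>A B. \<Union>u\<in>A. \<Union>v\<in>B. hclass E (walk_comp u v)),
     one = hclass E (e, [])\<rparr>"

definition fund_map :: "'f fbc \<Rightarrow> ('e \<Rightarrow> 'f) \<Rightarrow> 'e walk set \<Rightarrow> 'f walk set" where
  "fund_map E' \<phi> A = (\<Union>w\<in>A. hclass E' (walk_map \<phi> w))"

definition fBC_regular_covering :: "'e fbc \<Rightarrow> 'f fbc \<Rightarrow> ('e \<Rightarrow> 'f) \<Rightarrow> bool" where
  "fBC_regular_covering E E' \<phi> \<longleftrightarrow> fBC_covering E E' \<phi> \<and>
     (\<exists>e \<in> elems E. fund_map E' \<phi> ` carrier (fund_group E e) \<lhd> fund_group E' (\<phi> e))"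

section \<open>Quivers with relations\<close>

text \<open>
  Quivers are the (multi-)digraphs of \<open>Graph_Theory\<close>. A path from \<open>x\<close> to \<open>y\<close> is a list of arrows
  \<open>p\<close> with \<open>awalk x p y\<close>. The trivial paths at all vertices are the same list \<open>[]\<close>,
  so all notions below keep track of the end points.
\<close>

type_synonym ('a, 'k) path_lc = "'a list \<Rightarrow>\<^sub>0 'k"

type_synonym ('v, 'a, 'k) path_rels = "'v \<Rightarrow> 'v \<Rightarrow> ('a, 'k) path_lc set"

type_synonym ('v, 'a, 'k) rquiver = "('v, 'a) pre_digraph \<times> ('v, 'a, 'k) path_rels"

type_synonym ('v, 'a, 'w, 'b) quiver_map = "('v \<Rightarrow> 'w) \<times> ('a \<Rightarrow> 'b)"

text \<open>\<open>paths_lc Q x y\<close> is the morphism space \<open>kQ(x, y)\<close>.\<close>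

definition paths_lc :: "('v, 'a) pre_digraph \<Rightarrow> 'v \<Rightarrow> 'v \<Rightarrow> ('a, 'k::field) path_lc set" where
  "paths_lc Q x y = {\<rho>. Poly_Mapping.keys \<rho> \<subseteq> {p. pre_digraph.awalk Q x p y}}"

definition lc_scale :: "'k::field \<Rightarrow> ('a, 'k) path_lc \<Rightarrow> ('a, 'k) path_lc" where
  "lc_scale c \<rho> = Poly_Mapping.map ((*) c) \<rho>"

text \<open>\<open>lc_comp \<sigma> \<rho>\<close> is \<open>\<sigma>\<rho>\<close>: first \<open>\<rho>\<close>, then \<open>\<sigma>\<close>.\<close>

definition lc_comp :: "('a, 'k::field) path_lc \<Rightarrow> ('a, 'k) path_lc \<Rightarrow> ('a, 'k) path_lc" where
  "lc_comp \<sigma> \<rho> = (\<Sum>p\<in>Poly_Mapping.keys \<rho>. \<Sum>q\<in>Poly_Mapping.keys \<sigma>.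
     Poly_Mapping.single (p @ q) (Poly_Mapping.lookup \<sigma> q * Poly_Mapping.lookup \<rho> p))"

definition is_ideal :: "('v, 'a) pre_digraph \<Rightarrow> ('v, 'a, 'k::field) path_rels \<Rightarrow> bool" where
  "is_ideal Q I \<longleftrightarrow>
     (\<forall>x \<in> verts Q. \<forall>y \<in> verts Q. I x y \<subseteq> paths_lc Q x y \<and> module.subspace lc_scale (I x y)) \<and>
     (\<forall>x \<in> verts Q. \<forall>y \<in> verts Q. \<forall>z \<in> verts Q.
        (\<forall>\<rho> \<in> I x y. \<forall>\<sigma> \<in> paths_lc Q y z. lc_comp \<sigma> \<rho> \<in> I x z) \<and>
        (\<forall>\<rho> \<in> paths_lc Q x y. \<forall>\<sigma> \<in> I y z. lc_comp \<sigma> \<rho> \<in> I x z))"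

definition gen_ideal ::
    "('v, 'a) pre_digraph \<Rightarrow> ('v, 'a, 'k::field) path_rels \<Rightarrow> ('v, 'a, 'k) path_rels" where
  "gen_ideal Q R x y = {\<rho> \<in> paths_lc Q x y.
     \<forall>I. is_ideal Q I \<and> (\<forall>a \<in> verts Q. \<forall>b \<in> verts Q. R a b \<subseteq> I a b) \<longrightarrow> \<rho> \<in> I x y}"

definition arrow_rels :: "('v, 'a) pre_digraph \<Rightarrow> ('v, 'a, 'k::field) path_rels" where
  "arrow_rels Q x y = {Poly_Mapping.single [a] 1 | a. a \<in> arcs Q \<and> tail Q a = x \<and> head Q a = y}"

definition is_rquiver :: "('v, 'a, 'k::field) rquiver \<Rightarrow> bool" where
  "is_rquiver R \<longleftrightarrow> wf_digraph (fst R) \<and> is_ideal (fst R) (snd R) \<and>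
     (\<forall>x \<in> verts (fst R). \<forall>y \<in> verts (fst R).
        snd R x y \<subseteq> gen_ideal (fst R) (arrow_rels (fst R)) x y)"

definition minimal_relation ::
    "('v, 'a, 'k::field) rquiver \<Rightarrow> 'v \<Rightarrow> 'v \<Rightarrow> ('a, 'k) path_lc \<Rightarrow> bool" where
  "minimal_relation R x y \<rho> \<longleftrightarrow> \<rho> \<in> snd R x y \<and> card (Poly_Mapping.keys \<rho>) \<ge> 2 \<and>
     (\<forall>K. K \<noteq> {} \<and> K \<subset> Poly_Mapping.keys \<rho> \<longrightarrow>
        (\<Sum>u\<in>K. Poly_Mapping.single u (Poly_Mapping.lookup \<rho> u)) \<notin> snd R x y)"

definition zero_relation ::
    "('v, 'a, 'k::field) rquiver \<Rightarrow> 'v \<Rightarrow> 'v \<Rightarrow> ('a, 'k) path_lc \<Rightarrow> bool" where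
  "zero_relation R x y \<rho> \<longleftrightarrow> \<rho> \<in> snd R x y \<and>
     (\<exists>u. pre_digraph.awalk (fst R) x u y \<and> \<rho> = Poly_Mapping.single u 1)"

subsection \<open>Morphisms and coverings\<close>

definition quiver_morphism ::
    "('v, 'a) pre_digraph \<Rightarrow> ('w, 'b) pre_digraph \<Rightarrow> ('v, 'a, 'w, 'b) quiver_map \<Rightarrow> bool" where
  "quiver_morphism Q Q' f \<longleftrightarrow>
     (\<forall>x \<in> verts Q. fst f x \<in> verts Q') \<and>
     (\<forall>a \<in> arcs Q. snd f a \<in> arcs Q' \<and> tail Q' (snd f a) = fst f (tail Q a) \<and>
        head Q' (snd f a) = fst f (head Q a))"

text \<open>The action of the induced functor \<open>kf : kQ \<rightarrow> kQ'\<close> on morphisms.\<close>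

definition lc_map ::
    "('v, 'a, 'w, 'b) quiver_map \<Rightarrow> ('a, 'k::field) path_lc \<Rightarrow> ('b, 'k) path_lc" where
  "lc_map f \<rho> = (\<Sum>p\<in>Poly_Mapping.keys \<rho>.
     Poly_Mapping.single (map (snd f) p) (Poly_Mapping.lookup \<rho> p))"

definition rquiver_morphism ::
    "('v, 'a, 'k::field) rquiver \<Rightarrow> ('w, 'b, 'k) rquiver \<Rightarrow> ('v, 'a, 'w, 'b) quiver_map \<Rightarrow> bool"
  where
  "rquiver_morphism R R' f \<longleftrightarrow> is_rquiver R \<and> is_rquiver R' \<and>
     quiver_morphism (fst R) (fst R') f \<and>
     (\<forall>x \<in> verts (fst R). \<forall>y \<in> verts (fst R).
        lc_map f ` snd R x y \<subseteq> snd R' (fst f x) (fst f y))"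

definition quiver_covering ::
    "('v, 'a) pre_digraph \<Rightarrow> ('w, 'b) pre_digraph \<Rightarrow> ('v, 'a, 'w, 'b) quiver_map \<Rightarrow> bool" where
  "quiver_covering Q Q' f \<longleftrightarrow> quiver_morphism Q Q' f \<and>
     (\<forall>x \<in> verts Q.
        bij_betw (snd f) {a \<in> arcs Q. tail Q a = x} {a \<in> arcs Q'. tail Q' a = fst f x} \<and>
        bij_betw (snd f) {a \<in> arcs Q. head Q a = x} {a \<in> arcs Q'. head Q' a = fst f x})"

definition rquiver_covering ::
    "('v, 'a, 'k::field) rquiver \<Rightarrow> ('w, 'b, 'k) rquiver \<Rightarrow> ('v, 'a, 'w, 'b) quiver_map \<Rightarrow> bool"
  where
  "rquiver_covering R R' f \<longleftrightarrow> rquiver_morphism R R' f \<and> quiver_covering (fst R) (fst R') f \<and>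
     (\<forall>a' \<in> verts (fst R'). \<forall>b' \<in> verts (fst R'). \<forall>\<rho>'.
        minimal_relation R' a' b' \<rho>' \<or> zero_relation R' a' b' \<rho>' \<longrightarrow>
        (\<forall>a \<in> verts (fst R). fst f a = a' \<longrightarrow>
           (\<exists>b \<in> verts (fst R). fst f b = b' \<and> (\<exists>\<rho> \<in> snd R a b. lc_map f \<rho> = \<rho>'))) \<and>
        (\<forall>b \<in> verts (fst R). fst f b = b' \<longrightarrow>
           (\<exists>a \<in> verts (fst R). fst f a = a' \<and> (\<exists>\<rho> \<in> snd R a b. lc_map f \<rho> = \<rho>'))))"

definition rquiver_iso ::
    "('v, 'a, 'k::field) rquiver \<Rightarrow> ('w, 'b, 'k) rquiver \<Rightarrow> ('v, 'a, 'w, 'b) quiver_map \<Rightarrow> bool"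
  where
  "rquiver_iso R R' \<nu> \<longleftrightarrow> rquiver_morphism R R' \<nu> \<and>
     bij_betw (fst \<nu>) (verts (fst R)) (verts (fst R')) \<and>
     bij_betw (snd \<nu>) (arcs (fst R)) (arcs (fst R')) \<and>
     (\<forall>x \<in> verts (fst R). \<forall>y \<in> verts (fst R).
        lc_map \<nu> ` snd R x y = snd R' (fst \<nu> x) (fst \<nu> y))"

subsection \<open>Galois coverings\<close>

text \<open>
  Since \<open>\<Gamma>\<close> is closed under inverses, the inverse of each of its elements is a morphism
  \<open>(Q, I) \<rightarrow> (Q, I)\<close> as well, so the elements of \<open>\<Gamma>\<close> are automorphisms of \<open>(Q, I)\<close>.
\<close>

definition rquiver_aut_group ::
    "('v, 'a, 'k::field) rquiver \<Rightarrow> ('v, 'a, 'v, 'a) quiver_map set \<Rightarrow> bool" where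
  "rquiver_aut_group R \<Gamma> \<longleftrightarrow>
     subgroup \<Gamma> (BijGroup (verts (fst R)) \<times>\<times> BijGroup (arcs (fst R))) \<and>
     (\<forall>h \<in> \<Gamma>. rquiver_morphism R R h)"

definition quiver_acts_freely ::
    "('v, 'a) pre_digraph \<Rightarrow> ('v, 'a, 'v, 'a) quiver_map set \<Rightarrow> bool" where
  "quiver_acts_freely Q \<Gamma> \<longleftrightarrow> (\<forall>h \<in> \<Gamma>. \<forall>x \<in> verts Q. fst h x = x \<longrightarrow>
     h = \<one>\<^bsub>BijGroup (verts Q) \<times>\<times> BijGroup (arcs Q)\<^esub>)"

text \<open>The natural projection onto the orbit quiver.\<close>

definition orbit_proj ::
    "('v, 'a, 'v, 'a) quiver_map set \<Rightarrow> ('v, 'a, 'v set, 'a set) quiver_map" where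
  "orbit_proj \<Gamma> = (\<lambda>x. {fst h x | h. h \<in> \<Gamma>}, \<lambda>a. {snd h a | h. h \<in> \<Gamma>})"

definition orbit_rquiver ::
    "('v, 'a, 'k::field) rquiver \<Rightarrow> ('v, 'a, 'v, 'a) quiver_map set \<Rightarrow>
     ('v set, 'a set, 'k) rquiver" where
  "orbit_rquiver R \<Gamma> =
     (\<lparr>verts = fst (orbit_proj \<Gamma>) ` verts (fst R),
       arcs = snd (orbit_proj \<Gamma>) ` arcs (fst R),
       tail = (\<lambda>A. the_elem ((\<lambda>a. fst (orbit_proj \<Gamma>) (tail (fst R) a)) ` A)),
       head = (\<lambda>A. the_elem ((\<lambda>a. fst (orbit_proj \<Gamma>) (head (fst R) a)) ` A))\<rparr>,
      \<lambda>S T. module.span lc_scale (\<Union>a\<in>S. \<Union>b\<in>T. lc_map (orbit_proj \<Gamma>) ` snd R a b))"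

definition rquiver_galois_covering ::
    "('v, 'a, 'k::field) rquiver \<Rightarrow> ('w, 'b, 'k) rquiver \<Rightarrow> ('v, 'a, 'w, 'b) quiver_map \<Rightarrow> bool"
  where
  "rquiver_galois_covering R R' f \<longleftrightarrow> rquiver_morphism R R' f \<and>
     (\<exists>\<Gamma>. rquiver_aut_group R \<Gamma> \<and> quiver_acts_freely (fst R) \<Gamma> \<and>
        (\<exists>\<nu>. rquiver_iso (orbit_rquiver R \<Gamma>) R' \<nu> \<and>
           (\<forall>x \<in> verts (fst R). fst f x = fst \<nu> (fst (orbit_proj \<Gamma>) x)) \<and>
           (\<forall>a \<in> arcs (fst R). snd f a = snd \<nu> (snd (orbit_proj \<Gamma>) a))))"

section \<open>Linear categories\<close>

text \<open>\<open>Cmp M x y z v u\<close> is the composition \<open>vu\<close> of \<open>u : x \<rightarrow> y\<close> and \<open>v : y \<rightarrow> z\<close>.\<close>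

record ('o, 'm, 'k) kcat =
  Ob :: "'o set"
  Hom :: "'o \<Rightarrow> 'o \<Rightarrow> ('k, 'm) module"
  Cmp :: "'o \<Rightarrow> 'o \<Rightarrow> 'o \<Rightarrow> 'm \<Rightarrow> 'm \<Rightarrow> 'm"
  Idn :: "'o \<Rightarrow> 'm"

locale kcategory =
  fixes M :: "('o, 'm, 'k::field) kcat"
  assumes Hom_module: "\<lbrakk>x \<in> Ob M; y \<in> Ob M\<rbrakk> \<Longrightarrow> Module.module ring_of_type_algebra (Hom M x y)"
    and Idn_closed: "x \<in> Ob M \<Longrightarrow> Idn M x \<in> carrier (Hom M x x)"
    and Cmp_closed: "\<lbrakk>x \<in> Ob M; y \<in> Ob M; z \<in> Ob M; u \<in> carrier (Hom M x y);
      v \<in> carrier (Hom M y z)\<rbrakk> \<Longrightarrow> Cmp M x y z v u \<in> carrier (Hom M x z)"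
    and Cmp_add_right: "\<lbrakk>x \<in> Ob M; y \<in> Ob M; z \<in> Ob M; u \<in> carrier (Hom M x y);
      u' \<in> carrier (Hom M x y); v \<in> carrier (Hom M y z)\<rbrakk> \<Longrightarrow>
      Cmp M x y z v (u \<oplus>\<^bsub>Hom M x y\<^esub> u') = Cmp M x y z v u \<oplus>\<^bsub>Hom M x z\<^esub> Cmp M x y z v u'"
    and Cmp_add_left: "\<lbrakk>x \<in> Ob M; y \<in> Ob M; z \<in> Ob M; u \<in> carrier (Hom M x y);
      v \<in> carrier (Hom M y z); v' \<in> carrier (Hom M y z)\<rbrakk> \<Longrightarrow>
      Cmp M x y z (v \<oplus>\<^bsub>Hom M y z\<^esub> v') u = Cmp M x y z v u \<oplus>\<^bsub>Hom M x z\<^esub> Cmp M x y z v' u"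
    and Cmp_smult_right: "\<lbrakk>x \<in> Ob M; y \<in> Ob M; z \<in> Ob M; u \<in> carrier (Hom M x y);
      v \<in> carrier (Hom M y z)\<rbrakk> \<Longrightarrow>
      Cmp M x y z v (c \<odot>\<^bsub>Hom M x y\<^esub> u) = c \<odot>\<^bsub>Hom M x z\<^esub> Cmp M x y z v u"
    and Cmp_smult_left: "\<lbrakk>x \<in> Ob M; y \<in> Ob M; z \<in> Ob M; u \<in> carrier (Hom M x y);
      v \<in> carrier (Hom M y z)\<rbrakk> \<Longrightarrow>
      Cmp M x y z (c \<odot>\<^bsub>Hom M y z\<^esub> v) u = c \<odot>\<^bsub>Hom M x z\<^esub> Cmp M x y z v u"
    and Cmp_Idn_right: "\<lbrakk>x \<in> Ob M; y \<in> Ob M; u \<in> carrier (Hom M x y)\<rbrakk> \<Longrightarrow>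
      Cmp M x x y u (Idn M x) = u"
    and Cmp_Idn_left: "\<lbrakk>x \<in> Ob M; y \<in> Ob M; u \<in> carrier (Hom M x y)\<rbrakk> \<Longrightarrow>
      Cmp M x y y (Idn M y) u = u"
    and Cmp_assoc: "\<lbrakk>w \<in> Ob M; x \<in> Ob M; y \<in> Ob M; z \<in> Ob M; t \<in> carrier (Hom M w x);
      u \<in> carrier (Hom M x y); v \<in> carrier (Hom M y z)\<rbrakk> \<Longrightarrow>
      Cmp M w y z v (Cmp M w x y u t) = Cmp M w x z (Cmp M x y z v u) t"

definition kinverse :: "('o, 'm, 'k::field) kcat \<Rightarrow> 'o \<Rightarrow> 'o \<Rightarrow> 'm \<Rightarrow> 'm \<Rightarrow> bool" where
  "kinverse M x y u v \<longleftrightarrow> u \<in> carrier (Hom M x y) \<and> v \<in> carrier (Hom M y x) \<and>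
     Cmp M x y x v u = Idn M x \<and> Cmp M y x y u v = Idn M y"

text \<open>
  Locally bounded categories in the sense of Bongartz and Gabriel: local endomorphism algebras
  (i.e. nonzero, with the non-invertible elements closed under addition), pairwise non-isomorphic
  objects, and \<open>\<Sum>\<^sub>y dim M(x, y) + dim M(y, x) < \<infinity>\<close> for each \<open>x\<close>.
\<close>

locale locally_bounded = kcategory +
  assumes End_nonzero: "x \<in> Ob M \<Longrightarrow> Idn M x \<noteq> \<zero>\<^bsub>Hom M x x\<^esub>"
    and End_local: "\<lbrakk>x \<in> Ob M; u \<in> carrier (Hom M x x); v \<in> carrier (Hom M x x);
      \<nexists>u'. kinverse M x x u u'; \<nexists>v'. kinverse M x x v v'\<rbrakk> \<Longrightarrow>
      \<nexists>w. kinverse M x x (u \<oplus>\<^bsub>Hom M x x\<^esub> v) w"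
    and non_isomorphic: "\<lbrakk>x \<in> Ob M; y \<in> Ob M; kinverse M x y u v\<rbrakk> \<Longrightarrow> x = y"
    and Hom_fin_dim: "\<lbrakk>x \<in> Ob M; y \<in> Ob M\<rbrakk> \<Longrightarrow>
      \<exists>B \<subseteq> carrier (Hom M x y). finite B \<and> (\<forall>u \<in> carrier (Hom M x y).
        \<exists>c. u = finsum (Hom M x y) (\<lambda>b. c b \<odot>\<^bsub>Hom M x y\<^esub> b) B)"
    and Hom_fin_supp: "x \<in> Ob M \<Longrightarrow>
      finite {y \<in> Ob M. carrier (Hom M x y) \<noteq> {\<zero>\<^bsub>Hom M x y\<^esub>} \<or>
        carrier (Hom M y x) \<noteq> {\<zero>\<^bsub>Hom M y x\<^esub>}}"

subsection \<open>Functors\<close>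

record ('o, 'm, 'p, 'n) kfun =
  FOb :: "'o \<Rightarrow> 'p"
  FHom :: "'o \<Rightarrow> 'o \<Rightarrow> 'm \<Rightarrow> 'n"

definition kfunctor ::
    "('o, 'm, 'k::field) kcat \<Rightarrow> ('p, 'n, 'k) kcat \<Rightarrow> ('o, 'm, 'p, 'n) kfun \<Rightarrow> bool" where
  "kfunctor M N F \<longleftrightarrow> kcategory M \<and> kcategory N \<and>
     (\<forall>x \<in> Ob M. FOb F x \<in> Ob N) \<and>
     (\<forall>x \<in> Ob M. FHom F x x (Idn M x) = Idn N (FOb F x)) \<and>
     (\<forall>x \<in> Ob M. \<forall>y \<in> Ob M. \<forall>u \<in> carrier (Hom M x y).
        FHom F x y u \<in> carrier (Hom N (FOb F x) (FOb F y)) \<and>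
        (\<forall>u' \<in> carrier (Hom M x y). FHom F x y (u \<oplus>\<^bsub>Hom M x y\<^esub> u') =
           FHom F x y u \<oplus>\<^bsub>Hom N (FOb F x) (FOb F y)\<^esub> FHom F x y u') \<and>
        (\<forall>c. FHom F x y (c \<odot>\<^bsub>Hom M x y\<^esub> u) = c \<odot>\<^bsub>Hom N (FOb F x) (FOb F y)\<^esub> FHom F x y u) \<and>
        (\<forall>z \<in> Ob M. \<forall>v \<in> carrier (Hom M y z). FHom F x z (Cmp M x y z v u) =
           Cmp N (FOb F x) (FOb F y) (FOb F z) (FHom F y z v) (FHom F x y u)))"

text \<open>The carrier of the direct sum \<open>\<Oplus>\<^bsub>z\<in>Z\<^esub> V\<^sub>z\<close>.\<close>

definition dsum :: "'o set \<Rightarrow> ('o \<Rightarrow> ('k, 'm) module) \<Rightarrow> ('o \<Rightarrow> 'm) set" where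
  "dsum Z V = {m \<in> (\<Pi>\<^sub>E z\<in>Z. carrier (V z)). finite {z \<in> Z. m z \<noteq> \<zero>\<^bsub>V z\<^esub>}}"

text \<open>
  The induced maps out of the direct sums are linear because \<open>F\<close> is, so they are isomorphisms
  precisely if they are bijective.
\<close>

definition covering_functor ::
    "('o, 'm, 'k::field) kcat \<Rightarrow> ('p, 'n, 'k) kcat \<Rightarrow> ('o, 'm, 'p, 'n) kfun \<Rightarrow> bool" where
  "covering_functor M N F \<longleftrightarrow> kfunctor M N F \<and>
     (\<forall>a \<in> Ob N. \<forall>y \<in> Ob M.
        let Z = {z \<in> Ob M. FOb F z = a} in
        bij_betw
          (\<lambda>m. finsum (Hom N a (FOb F y)) (\<lambda>z. FHom F z y (m z)) {z \<in> Z. m z \<noteq> \<zero>\<^bsub>Hom M z y\<^esub>})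
          (dsum Z (\<lambda>z. Hom M z y)) (carrier (Hom N a (FOb F y)))) \<and>
     (\<forall>b \<in> Ob N. \<forall>x \<in> Ob M.
        let Z = {z \<in> Ob M. FOb F z = b} in
        bij_betw
          (\<lambda>m. finsum (Hom N (FOb F x) b) (\<lambda>z. FHom F x z (m z)) {z \<in> Z. m z \<noteq> \<zero>\<^bsub>Hom M x z\<^esub>})
          (dsum Z (\<lambda>z. Hom M x z)) (carrier (Hom N (FOb F x) b)))"

text \<open>
  Functors on \<open>M\<close> are made extensional by \<open>kfun_restrict M\<close>; two functors on \<open>M\<close> are equal iff
  their restrictions are.
\<close>

definition kfun_restrict ::
    "('o, 'm, 'k::field) kcat \<Rightarrow> ('o, 'm, 'p, 'n) kfun \<Rightarrow> ('o, 'm, 'p, 'n) kfun" where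
  "kfun_restrict M F = \<lparr>FOb = restrict (FOb F) (Ob M),
     FHom = (\<lambda>x y u. if x \<in> Ob M \<and> y \<in> Ob M \<and> u \<in> carrier (Hom M x y)
       then FHom F x y u else undefined)\<rparr>"

definition kfun_comp ::
    "('p, 'n, 'q, 'l) kfun \<Rightarrow> ('o, 'm, 'p, 'n) kfun \<Rightarrow> ('o, 'm, 'q, 'l) kfun" where
  "kfun_comp F H = \<lparr>FOb = (\<lambda>x. FOb F (FOb H x)),
     FHom = (\<lambda>x y u. FHom F (FOb H x) (FOb H y) (FHom H x y u))\<rparr>"

definition kaut_group :: "('o, 'm, 'k::field) kcat \<Rightarrow> ('o, 'm, 'o, 'm) kfun monoid" where
  "kaut_group M = \<lparr>carrier = {h. kfunctor M M h \<and> kfun_restrict M h = h \<and>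
       bij_betw (FOb h) (Ob M) (Ob M) \<and>
       (\<forall>x \<in> Ob M. \<forall>y \<in> Ob M.
          bij_betw (FHom h x y) (carrier (Hom M x y)) (carrier (Hom M (FOb h x) (FOb h y))))},
     monoid.mult = (\<lambda>h h'. kfun_restrict M (kfun_comp h h')),
     one = kfun_restrict M \<lparr>FOb = (\<lambda>x. x), FHom = (\<lambda>x y u. u)\<rparr>\<rparr>"

definition galois_covering_functor ::
    "('o, 'm, 'k::field) kcat \<Rightarrow> ('p, 'n, 'k) kcat \<Rightarrow> ('o, 'm, 'p, 'n) kfun \<Rightarrow> bool" where
  "galois_covering_functor M N F \<longleftrightarrow> locally_bounded M \<and> locally_bounded N \<and>
     covering_functor M N F \<and> FOb F ` Ob M = Ob N \<and>
     (\<exists>H. subgroup H (kaut_group M) \<and>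
        (\<forall>h \<in> H. \<forall>x \<in> Ob M. FOb h x = x \<longrightarrow> h = \<one>\<^bsub>kaut_group M\<^esub>) \<and>
        (\<forall>h \<in> H. kfun_restrict M (kfun_comp F h) = kfun_restrict M F) \<and>
        (\<forall>x \<in> Ob M. \<forall>y \<in> Ob M. FOb F x = FOb F y \<longrightarrow> (\<exists>h \<in> H. FOb h x = y)))"

subsection \<open>The category of a quiver with relations\<close>

text \<open>
  The category \<open>kQ/I\<close>, whose morphisms from \<open>x\<close> to \<open>y\<close> are the cosets \<open>\<rho> + I(x, y)\<close>. The unions
  merely avoid a choice of representatives: all their members are the same coset. The fields
  \<open>mult\<close> and \<open>one\<close> of a module record are irrelevant.
\<close>

definition rquiver_cat ::
    "('v, 'a, 'k::field) rquiver \<Rightarrow> ('v, ('a, 'k) path_lc set, 'k) kcat" where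
  "rquiver_cat R = \<lparr>Ob = verts (fst R),
     Hom = (\<lambda>x y. \<lparr>carrier = (\<lambda>\<rho>. \<rho> +o snd R x y) ` paths_lc (fst R) x y,
       monoid.mult = undefined, one = undefined,
       ring.zero = snd R x y,
       ring.add = (\<lambda>A B. \<Union>\<rho>\<in>A. \<Union>\<sigma>\<in>B. (\<rho> + \<sigma>) +o snd R x y),
       module.smult = (\<lambda>c A. \<Union>\<rho>\<in>A. lc_scale c \<rho> +o snd R x y)\<rparr>),
     Cmp = (\<lambda>x y z B A. \<Union>\<rho>\<in>A. \<Union>\<sigma>\<in>B. lc_comp \<sigma> \<rho> +o snd R x z),
     Idn = (\<lambda>x. Poly_Mapping.single [] 1 +o snd R x x)\<rparr>"

definition rquiver_functor ::
    "('w, 'b, 'k::field) rquiver \<Rightarrow> ('v, 'a, 'w, 'b) quiver_map \<Rightarrow>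
     ('v, ('a, 'k) path_lc set, 'w, ('b, 'k) path_lc set) kfun" where
  "rquiver_functor R' f = \<lparr>FOb = fst f,
     FHom = (\<lambda>x y A. \<Union>\<rho>\<in>A. lc_map f \<rho> +o snd R' (fst f x) (fst f y))\<rparr>"

section \<open>The quiver with relations of a fractional Brauer configuration\<close>

text \<open>
  Source and target of an arrow and the values of the induced quiver morphism are read off from
  any representative; the images below are singletons by (f1), (f2) and the definition of a
  morphism.
\<close>

definition fBC_quiver :: "'e fbc \<Rightarrow> ('e set, 'e set) pre_digraph" where
  "fBC_quiver E = \<lparr>verts = Pcls E ` elems E, arcs = Lcls E ` elems E,
     tail = (\<lambda>A. the_elem (Pcls E ` A)),
     head = (\<lambda>A. the_elem ((\<lambda>e. Pcls E (act E 1 e)) ` A))\<rparr>"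

definition fR1 :: "'e fbc \<Rightarrow> ('e set, 'e set, 'k::field) path_rels" where
  "fR1 E x y = {Poly_Mapping.single (Lseq E e (deg E e - j)) 1
                - Poly_Mapping.single (Lseq E h (deg E h - j)) 1 | e h j.
     e \<in> elems E \<and> h \<in> elems E \<and> j \<le> deg E e \<and> j \<le> deg E h \<and>
     Pcls E e = Pcls E h \<and>
     (\<forall>i\<in>{1..j}. Lcls E (act E (int (deg E e) - int i) e) = Lcls E (act E (int (deg E h) - int i) h)) \<and>
     x = Pcls E e \<and> y = Pcls E (act E (int (deg E e - j)) e)}"

text \<open>With \<open>p ! i = L(e\<^bsub>i+1\<^esub>)\<close>, the exponent \<open>n - (i + 1)\<close> is that of \<open>g\<^bsup>n-i\<^esup>\<cdot>L(e\<^sub>i)\<close>.\<close>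

definition fR2 :: "'e fbc \<Rightarrow> ('e set, 'e set, 'k::field) path_rels" where
  "fR2 E x y = {Poly_Mapping.single p 1 | p.
     pre_digraph.awalk (fBC_quiver E) x p y \<and> length p > 1 \<and>
     (\<Inter>i\<in>{..<length p}. act E (int (length p) - int (i + 1)) ` (p ! i)) = {}}"

definition fR3 :: "'e fbc \<Rightarrow> ('e set, 'e set, 'k::field) path_rels" where
  "fR3 E x y = {Poly_Mapping.single (Lseq E e n) 1 | e n.
     e \<in> elems E \<and> n > deg E e \<and> x = Pcls E e \<and> y = Pcls E (act E (int n) e)}"

text \<open>\<open>(Q\<^sub>E, I\<^sub>E)\<close> over the field \<open>'k\<close>\<close>

definition fBC_rquiver :: "'k::field itself \<Rightarrow> 'e fbc \<Rightarrow> ('e set, 'e set, 'k) rquiver" where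
  "fBC_rquiver _ E = (fBC_quiver E,
     gen_ideal (fBC_quiver E) (\<lambda>x y. fR1 E x y \<union> fR2 E x y \<union> fR3 E x y))"

definition fBC_cat :: "'k::field itself \<Rightarrow> 'e fbc \<Rightarrow> ('e set, ('e set, 'k) path_lc set, 'k) kcat"
  where
  "fBC_cat k E = rquiver_cat (fBC_rquiver k E)"

definition fBC_quiver_map ::
    "'f fbc \<Rightarrow> ('e \<Rightarrow> 'f) \<Rightarrow> ('e set, 'e set, 'f set, 'f set) quiver_map" where
  "fBC_quiver_map E' \<phi> = (\<lambda>S. the_elem ((\<lambda>e. Pcls E' (\<phi> e)) ` S),
     \<lambda>A. the_elem ((\<lambda>e. Lcls E' (\<phi> e)) ` A))"

definition fBC_functor :: "'k::field itself \<Rightarrow> 'f fbc \<Rightarrow> ('e \<Rightarrow> 'f) \<Rightarrow>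
     ('e set, ('e set, 'k) path_lc set, 'f set, ('f set, 'k) path_lc set) kfun" where
  "fBC_functor k E' \<phi> = rquiver_functor (fBC_rquiver k E') (fBC_quiver_map E' \<phi>)"

end

theory Submission
  imports Defs
begin

text \<open>
  A covering \<open>\<phi>\<close> of f-BCs lifts every generator of \<open>I\<^bsub>E'\<^esub>\<close> from any preimage of either of its
  ends to a generator of \<open>I\<^sub>E\<close>; for (fR1) the common final segments of the two paths are compared
  arrow by arrow, using (f4) at their far end. As paths lift uniquely, the combinations of paths from \<open>x\<close> to the
  preimages of \<open>b\<close> form a copy of \<open>kQ\<^bsub>E'\<^esub>(f(x), b)\<close> graded by the fibre over \<open>b\<close>, and the lifts
  of the generators show that \<open>I\<^bsub>E'\<^esub>(f(x), b)\<close> is the sum of the images of its graded pieces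
  \<open>I\<^sub>E(x, y)\<close>. This gives the covering functor and, because a minimal relation cannot be split
  into two relations, the lifting of minimal relations.

  Walks lift uniquely as well, and homotopic walks have lifts with the same end point. If \<open>\<phi>\<close> is
  regular, whether a closed walk lifts to a closed walk does not depend on the starting point in the
  fibre, so for \<open>\<phi>(e\<^sub>1) = \<phi>(e\<^sub>2)\<close> transporting lifts from \<open>e\<^sub>1\<close> to \<open>e\<^sub>2\<close> is a well-defined
  automorphism of \<open>E\<close> over \<open>E'\<close>. Hence the deck group of \<open>f\<close> acts transitively on its fibres; it
  acts freely because arrows lift uniquely and \<open>Q\<^sub>E\<close> is connected.
\<close>

section \<open>Linear combinations of paths\<close>

text \<open>The generated ideal is defined as an intersection. That form suits maps out of it, while
  lifting needs the span of the multiples \<open>q r p\<close> of generators;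
  \<open>gen_ideal_eq_span\<close> joins the two. That kf respects the ideals is not formal for
  (fR2): a path that is not a sequence of successive translates might have an image that is. In a
  covering such an image lifts from the same vertex to a sequence of translates, and uniqueness
  makes this lift the given path. A second obstacle is that relations have to lie in the arrow
  ideal: an (fR1) generator in which \<open>j\<close> equals one degree involves a trivial path, and
  (f6) is what makes its other path trivial too, so that the difference vanishes. Relations have to
  be lifted both from their source and into their target, with the same grading argument, which is
  therefore carried out once for an abstract indexed family of path sets. In the Galois case the
  orbit ideal is not shown to be an ideal by hand: it is identified with the preimage of the ideal
  of \<open>E'\<close> under the comparison map out of the orbit quiver.\<close>

abbreviation coef :: "('a, 'k::field) path_lc \<Rightarrow> 'a list \<Rightarrow> 'k" where
  "coef \<equiv> Poly_Mapping.lookup"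

abbreviation supp :: "('a, 'k::field) path_lc \<Rightarrow> 'a list set" where
  "supp \<equiv> Poly_Mapping.keys"

abbreviation pmon :: "'a list \<Rightarrow> ('a, 'k::field) path_lc" where
  "pmon p \<equiv> Poly_Mapping.single p 1"

lemma coef_lc_scale [simp]: "coef (lc_scale c \<rho>) p = c * coef \<rho> p"
  unfolding lc_scale_def by (simp add: Poly_Mapping.map.rep_eq "when_def")

lemma lc_scale_single [simp]:
  "lc_scale c (Poly_Mapping.single p d) = Poly_Mapping.single p (c * d)"
  by (rule poly_mapping_eqI) (simp add: lookup_single "when_def")

interpretation lc: vector_space "lc_scale :: 'k::field \<Rightarrow> ('a, 'k) path_lc \<Rightarrow> _"
  by unfold_locales
    (auto intro!: poly_mapping_eqI simp: lookup_add algebra_simps)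

lemma supp_add: "supp (\<rho> + \<sigma>) \<subseteq> supp \<rho> \<union> supp \<sigma>"
  by (rule Poly_Mapping.keys_add)

lemma supp_lc_scale: "supp (lc_scale c \<rho>) \<subseteq> supp \<rho>"
  by (auto simp: in_keys_iff)

lemma subspace_supp_subset: "lc.subspace {\<rho>. supp \<rho> \<subseteq> A}"
  unfolding lc.subspace_def
  by (auto dest: subsetD[OF supp_add] subsetD[OF supp_lc_scale])

lemma lc_expand: "\<rho> = (\<Sum>p\<in>supp \<rho>. lc_scale (coef \<rho> p) (pmon p))"
proof (rule poly_mapping_eqI)
  fix q
  have "coef (\<Sum>p\<in>supp \<rho>. lc_scale (coef \<rho> p) (pmon p)) q
      = (\<Sum>p\<in>supp \<rho>. if p = q then coef \<rho> p else 0)"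
    by (simp add: lookup_sum lookup_single "when_def")
  then show "coef \<rho> q = coef (\<Sum>p\<in>supp \<rho>. lc_scale (coef \<rho> p) (pmon p)) q"
    by (simp add: in_keys_iff)
qed

lemma lc_in_subspace:
  assumes "lc.subspace S" "\<And>p. p \<in> supp \<rho> \<Longrightarrow> pmon p \<in> S"
  shows "\<rho> \<in> S"
proof -
  have "(\<Sum>p\<in>supp \<rho>. lc_scale (coef \<rho> p) (pmon p)) \<in> S"
    by (rule lc.subspace_sum[OF assms(1)]) (rule lc.subspace_scale[OF assms(1) assms(2)])
  then show ?thesis using lc_expand[of \<rho>] by metis
qed

text \<open>The closure hypotheses make \<open>P\<close> a subspace, so linear statements need
  checking on paths only. Keeping \<open>p \<in> supp \<rho>\<close> lets the ends of these paths be
  used.\<close>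

lemma lc_induct [case_names zero scale add mon]:
  assumes "P 0" "\<And>c \<rho>. P \<rho> \<Longrightarrow> P (lc_scale c \<rho>)" "\<And>\<rho> \<sigma>. P \<rho> \<Longrightarrow> P \<sigma> \<Longrightarrow> P (\<rho> + \<sigma>)"
    and "\<And>p. p \<in> supp \<rho> \<Longrightarrow> P (pmon p)"
  shows "P \<rho>"
proof -
  have "\<rho> \<in> {\<rho>. P \<rho>}"
    by (rule lc_in_subspace) (use assms in \<open>auto simp: lc.subspace_def\<close>)
  then show ?thesis by simp
qed

text \<open>Two combinations that are added have different supports; summing over a common finite
  index set, with zero coefficients elsewhere, reduces bilinearity to distributivity.\<close>

lemma lc_comp_superset:
  assumes "finite A" "finite B" "supp \<rho> \<subseteq> A" "supp \<sigma> \<subseteq> B"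
  shows "lc_comp \<sigma> \<rho> =
    (\<Sum>p\<in>A. \<Sum>q\<in>B. Poly_Mapping.single (p @ q) (coef \<sigma> q * coef \<rho> p))"
proof -
  have *: "(\<Sum>q\<in>supp \<sigma>. Poly_Mapping.single (p @ q) (coef \<sigma> q * coef \<rho> p)) =
      (\<Sum>q\<in>B. Poly_Mapping.single (p @ q) (coef \<sigma> q * coef \<rho> p))" for p
    using assms by (intro sum.mono_neutral_left) (auto simp: in_keys_iff)
  show ?thesis
    unfolding lc_comp_def *
    using assms by (intro sum.mono_neutral_left) (auto simp: in_keys_iff intro!: sum.neutral)
qed

lemma lc_comp_add_left: "lc_comp (\<sigma> + \<sigma>') \<rho> = lc_comp \<sigma> \<rho> + lc_comp \<sigma>' \<rho>"
proof -
  let ?B = "supp \<sigma> \<union> supp \<sigma>'"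
  have "supp (\<sigma> + \<sigma>') \<subseteq> ?B" by (rule supp_add)
  then show ?thesis
    by (subst (1 2 3) lc_comp_superset[of "supp \<rho>" ?B])
      (auto simp: lookup_add single_add distrib_right sum.distrib)
qed

lemma lc_comp_add_right: "lc_comp \<sigma> (\<rho> + \<rho>') = lc_comp \<sigma> \<rho> + lc_comp \<sigma> \<rho>'"
proof -
  let ?A = "supp \<rho> \<union> supp \<rho>'"
  have "supp (\<rho> + \<rho>') \<subseteq> ?A" by (rule supp_add)
  then show ?thesis
    by (subst (1 2 3) lc_comp_superset[of ?A "supp \<sigma>"])
      (auto simp: lookup_add single_add distrib_left sum.distrib)
qed

lemma lc_comp_scale_left: "lc_comp (lc_scale c \<sigma>) \<rho> = lc_scale c (lc_comp \<sigma> \<rho>)"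
  by (subst (1 2) lc_comp_superset[of "supp \<rho>" "supp \<sigma>"])
    (simp_all add: supp_lc_scale lc.scale_sum_right mult.assoc)

lemma lc_comp_scale_right: "lc_comp \<sigma> (lc_scale c \<rho>) = lc_scale c (lc_comp \<sigma> \<rho>)"
  by (subst (1 2) lc_comp_superset[of "supp \<rho>" "supp \<sigma>"])
    (simp_all add: supp_lc_scale lc.scale_sum_right mult.left_commute)

lemma lc_comp_zero [simp]: "lc_comp 0 \<rho> = 0" "lc_comp \<sigma> 0 = 0"
  by (simp_all add: lc_comp_def)

lemma lc_comp_mon [simp]: "lc_comp (pmon q) (pmon p) = pmon (p @ q)"
  by (simp add: lc_comp_def)

lemmas lc_comp_linear = lc_comp_add_left lc_comp_add_right lc_comp_scale_left lc_comp_scale_right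

lemma lc_comp_diff_left: "lc_comp (\<sigma> - \<sigma>') \<rho> = lc_comp \<sigma> \<rho> - lc_comp \<sigma>' \<rho>"
  by (metis add_diff_cancel_right' diff_add_cancel lc_comp_add_left)

lemma lc_comp_diff_right: "lc_comp \<sigma> (\<rho> - \<rho>') = lc_comp \<sigma> \<rho> - lc_comp \<sigma> \<rho>'"
  by (metis add_diff_cancel_right' diff_add_cancel lc_comp_add_right)

lemma lc_comp_Nil_left [simp]: "lc_comp (pmon []) \<rho> = \<rho>"
  by (induction \<rho> rule: lc_induct) (simp_all add: lc_comp_linear)

lemma lc_comp_Nil_right [simp]: "lc_comp \<sigma> (pmon []) = \<sigma>"
  by (induction \<sigma> rule: lc_induct) (simp_all add: lc_comp_linear)

lemma lc_comp_assoc: "lc_comp \<tau> (lc_comp \<sigma> \<rho>) = lc_comp (lc_comp \<tau> \<sigma>) \<rho>"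
proof (induction \<rho> rule: lc_induct)
  case (mon p)
  show ?case
  proof (induction \<sigma> rule: lc_induct)
    case (mon q)
    show ?case
      by (induction \<tau> rule: lc_induct) (simp_all add: lc_comp_linear)
  qed (simp_all add: lc_comp_linear)
qed (simp_all add: lc_comp_linear)

lemma supp_lc_comp: "supp (lc_comp \<sigma> \<rho>) \<subseteq> {p @ q | p q. p \<in> supp \<rho> \<and> q \<in> supp \<sigma>}"
proof -
  let ?A = "{p @ q | p q. p \<in> supp \<rho> \<and> q \<in> supp \<sigma>}"
  have "lc_comp \<sigma> \<rho> \<in> {\<rho>. supp \<rho> \<subseteq> ?A}"
    unfolding lc_comp_def
    by (intro lc.subspace_sum[OF subspace_supp_subset]) auto
  then show ?thesis by simp
qed

text \<open>A concatenation is empty only if both factors are. The resulting multiplicative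
  coefficient detects both the arrow ideal and the invertible morphisms.\<close>

lemma coef_lc_comp_Nil: "coef (lc_comp \<sigma> \<rho>) [] = coef \<sigma> [] * coef \<rho> []"
proof (induction \<rho> rule: lc_induct)
  case (mon p)
  show ?case
  proof (induction \<sigma> rule: lc_induct)
    case (mon q)
    show ?case by (simp add: lookup_single "when_def")
  qed (simp_all only: lc_comp_linear lookup_add coef_lc_scale lc_comp_zero lookup_zero
      distrib_right mult.assoc mult_zero_left)
qed (simp_all only: lc_comp_linear lookup_add coef_lc_scale lc_comp_zero lookup_zero
      distrib_left mult.left_commute mult_zero_right)

subsection \<open>The linear map induced by a map of quivers\<close>

lemma lc_map_superset:
  assumes "finite A" "supp \<rho> \<subseteq> A"
  shows "lc_map f \<rho> = (\<Sum>p\<in>A. Poly_Mapping.single (map (snd f) p) (coef \<rho> p))"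
  unfolding lc_map_def using assms by (intro sum.mono_neutral_left) (auto simp: in_keys_iff)

lemma lc_map_zero [simp]: "lc_map f 0 = 0"
  by (simp add: lc_map_def)

lemma lc_map_add: "lc_map f (\<rho> + \<sigma>) = lc_map f \<rho> + lc_map f \<sigma>"
  using supp_add[of \<rho> \<sigma>]
  by (subst (1 2 3) lc_map_superset[of "supp \<rho> \<union> supp \<sigma>"])
    (auto simp: lookup_add single_add sum.distrib)

lemma lc_map_scale: "lc_map f (lc_scale c \<rho>) = lc_scale c (lc_map f \<rho>)"
  using supp_lc_scale[of c \<rho>]
  by (subst (1 2) lc_map_superset[of "supp \<rho>"]) (auto simp: lc.scale_sum_right)

lemmas lc_map_linear = lc_map_add lc_map_scale

lemma lc_map_diff: "lc_map f (\<rho> - \<sigma>) = lc_map f \<rho> - lc_map f \<sigma>"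
  by (metis add_diff_cancel_right' diff_add_cancel lc_map_add)

lemma lc_map_sum: "lc_map f (sum g A) = (\<Sum>x\<in>A. lc_map f (g x))"
  by (induction A rule: infinite_finite_induct) (simp_all add: lc_map_add)

lemma lc_map_mon [simp]: "lc_map f (pmon p) = pmon (map (snd f) p)"
  by (simp add: lc_map_def)

lemma lc_map_lc_comp: "lc_map f (lc_comp \<sigma> \<rho>) = lc_comp (lc_map f \<sigma>) (lc_map f \<rho>)"
proof (induction \<rho> rule: lc_induct)
  case (mon p)
  show ?case
    by (induction \<sigma> rule: lc_induct) (simp_all add: lc_comp_linear lc_map_linear)
qed (simp_all add: lc_comp_linear lc_map_linear)

lemma supp_lc_map: "supp (lc_map f \<rho>) \<subseteq> map (snd f) ` supp \<rho>"
proof -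
  have "lc_map f \<rho> \<in> {\<sigma>. supp \<sigma> \<subseteq> map (snd f) ` supp \<rho>}"
    unfolding lc_map_def by (intro lc.subspace_sum[OF subspace_supp_subset]) auto
  then show ?thesis by simp
qed

lemma coef_lc_map_Nil: "coef (lc_map f \<rho>) [] = coef \<rho> []"
  by (induction \<rho> rule: lc_induct) (simp_all add: lc_map_linear lookup_add lookup_single "when_def")

lemma lc_map_cong:
  assumes "\<And>p a. p \<in> supp \<rho> \<Longrightarrow> a \<in> set p \<Longrightarrow> snd f a = snd g a"
  shows "lc_map f \<rho> = lc_map g \<rho>"
  unfolding lc_map_def
  by (intro sum.cong refl arg_cong[where f = "\<lambda>p. Poly_Mapping.single p _"] map_cong) (rule assms)

text \<open>\<open>lc_map\<close> looks only at the arrow component, so the vertex map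
  \<open>h\<close> of the composite is arbitrary.\<close>

lemma lc_map_lc_map: "lc_map g (lc_map f \<rho>) = lc_map (h, snd g \<circ> snd f) \<rho>"
  by (induction \<rho> rule: lc_induct) (simp_all add: lc_map_linear comp_def)

lemma lc_map_compose:
  assumes "\<And>p a. p \<in> supp \<rho> \<Longrightarrow> a \<in> set p \<Longrightarrow> snd g (snd f a) = snd h a"
  shows "lc_map g (lc_map f \<rho>) = lc_map h \<rho>"
  unfolding lc_map_lc_map[where h = "fst h"] using assms by (intro lc_map_cong) auto

lemma lc_map_ident:
  assumes "\<And>p a. p \<in> supp \<rho> \<Longrightarrow> a \<in> set p \<Longrightarrow> snd f a = a"
  shows "lc_map f \<rho> = \<rho>"
proof -
  \<comment> \<open>The vertex component is immaterial; the unit type merely fixes it.\<close>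
  have "lc_map f \<rho> = lc_map (\<lambda>x::unit. x, \<lambda>a. a) \<rho>"
    using assms by (intro lc_map_cong) auto
  also have "\<dots> = \<rho>" by (induction \<rho> rule: lc_induct) (simp_all add: lc_map_linear)
  finally show ?thesis .
qed

text \<open>Injectivity on \<open>A\<close> rules out that two paths of the support are identified
  and their coefficients add up or cancel.\<close>

lemma coef_lc_map:
  assumes "inj_on (map (snd f)) A" "supp \<rho> \<subseteq> A" "p \<in> A"
  shows "coef (lc_map f \<rho>) (map (snd f) p) = coef \<rho> p"
proof -
  have "coef (lc_map f \<rho>) (map (snd f) p) = (\<Sum>q\<in>supp \<rho>. if q = p then coef \<rho> q else 0)"
    unfolding lc_map_def lookup_sum
    by (intro sum.cong) (use assms in \<open>auto simp: lookup_single "when_def" dest: inj_onD\<close>)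
  also have "\<dots> = coef \<rho> p" by (simp add: in_keys_iff)
  finally show ?thesis .
qed

lemma lc_map_inj_on:
  assumes "inj_on (map (snd f)) A"
  shows "inj_on (lc_map f) {\<rho>. supp \<rho> \<subseteq> A}"
proof (rule inj_onI, rule poly_mapping_eqI)
  fix \<rho> \<sigma> :: "('a, 'k::field) path_lc" and p
  assume *: "\<rho> \<in> {\<rho>. supp \<rho> \<subseteq> A}" "\<sigma> \<in> {\<rho>. supp \<rho> \<subseteq> A}" "lc_map f \<rho> = lc_map f \<sigma>"
  show "coef \<rho> p = coef \<sigma> p"
  proof (cases "p \<in> A")
    case True
    then show ?thesis
      using * coef_lc_map[OF assms, of \<rho> p] coef_lc_map[OF assms, of \<sigma> p] by simp
  next
    case False
    then have "p \<notin> supp \<rho>" "p \<notin> supp \<sigma>" using * by auto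
    then show ?thesis by (simp add: in_keys_iff)
  qed
qed

subsection \<open>Parts of linear combinations\<close>

text \<open>The projection onto the span of the paths in \<open>A\<close>. Cutting down to the
  support keeps the sum finite even for infinite \<open>A\<close>.\<close>

definition lc_part :: "'a list set \<Rightarrow> ('a, 'k::field) path_lc \<Rightarrow> ('a, 'k) path_lc" where
  "lc_part A \<rho> = (\<Sum>p\<in>supp \<rho> \<inter> A. Poly_Mapping.single p (coef \<rho> p))"

lemma coef_lc_part [simp]: "coef (lc_part A \<rho>) p = (if p \<in> A then coef \<rho> p else 0)"
proof -
  have "coef (lc_part A \<rho>) p = (\<Sum>q\<in>supp \<rho> \<inter> A. if q = p then coef \<rho> q else 0)"
    unfolding lc_part_def lookup_sum by (intro sum.cong) (auto simp: lookup_single "when_def")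
  then show ?thesis by (simp add: in_keys_iff)
qed

lemma lc_part_add: "lc_part A (\<rho> + \<sigma>) = lc_part A \<rho> + lc_part A \<sigma>"
  by (rule poly_mapping_eqI) (simp add: lookup_add)

lemma lc_part_scale: "lc_part A (lc_scale c \<rho>) = lc_scale c (lc_part A \<rho>)"
  by (rule poly_mapping_eqI) simp

lemma lc_part_zero [simp]: "lc_part A 0 = 0"
  by (rule poly_mapping_eqI) simp

lemma lc_part_sum: "lc_part A (sum g B) = (\<Sum>x\<in>B. lc_part A (g x))"
  by (induction B rule: infinite_finite_induct) (simp_all add: lc_part_add)

lemma lc_part_superset: "supp \<rho> \<subseteq> A \<Longrightarrow> lc_part A \<rho> = \<rho>"
  by (rule poly_mapping_eqI) (auto simp: in_keys_iff)

lemma lc_part_disjoint: "supp \<rho> \<inter> A = {} \<Longrightarrow> lc_part A \<rho> = 0"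
  by (rule poly_mapping_eqI) (auto simp: in_keys_iff)

lemma supp_lc_part: "supp (lc_part A \<rho>) = supp \<rho> \<inter> A"
  by (auto simp: in_keys_iff split: if_splits)

lemma lc_part_supp_Int: "lc_part (supp \<rho> \<inter> A) \<rho> = lc_part A \<rho>"
  by (rule poly_mapping_eqI) (simp add: in_keys_iff)

text \<open>By injectivity on \<open>A\<close> no path of \<rho> outside \<open>B\<close> lands in
  the image of \<open>B\<close>; hence a graded piece upstairs becomes a partial sum
  downstairs.\<close>

lemma lc_map_lc_part:
  assumes "inj_on (map (snd f)) A" "supp \<rho> \<subseteq> A" "B \<subseteq> A"
  shows "lc_map f (lc_part B \<rho>) = lc_part (map (snd f) ` B) (lc_map f \<rho>)"
proof (rule poly_mapping_eqI)
  fix q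
  have supp_B: "supp (lc_part B \<rho>) \<subseteq> A" using assms by (auto simp: supp_lc_part)
  show "coef (lc_map f (lc_part B \<rho>)) q = coef (lc_part (map (snd f) ` B) (lc_map f \<rho>)) q"
  proof (cases "q \<in> map (snd f) ` B")
    case True
    then obtain p where p: "p \<in> B" "q = map (snd f) p" by blast
    then show ?thesis
      using coef_lc_map[OF assms(1,2), of p] coef_lc_map[OF assms(1) supp_B, of p] assms(3)
      by auto
  next
    case False
    then have "q \<notin> supp (lc_map f (lc_part B \<rho>))"
      using supp_lc_map[of f "lc_part B \<rho>"] by (auto simp: supp_lc_part)
    then show ?thesis using False by (simp add: in_keys_iff)
  qed
qed

section \<open>Ideals of path categories\<close>

lemma subspace_paths_lc: "lc.subspace (paths_lc Q x y)"
  unfolding paths_lc_def by (rule subspace_supp_subset)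

lemma pmon_in_paths_lc [simp]: "pmon p \<in> paths_lc Q x y \<longleftrightarrow> pre_digraph.awalk Q x p y"
  by (simp add: paths_lc_def)

lemma paths_lcD: "\<rho> \<in> paths_lc Q x y \<Longrightarrow> p \<in> supp \<rho> \<Longrightarrow> pre_digraph.awalk Q x p y"
  by (auto simp: paths_lc_def)

lemma awalk_Nil_iff': "pre_digraph.awalk Q x [] y \<longleftrightarrow> x = y \<and> x \<in> verts Q"
  by (auto simp: pre_digraph.awalk_def pre_digraph.cas.simps)

text \<open>Fixing the start makes this true for the empty list as well; it keeps the sets of paths
  from one vertex to different ends disjoint.\<close>

lemma awalk_end_unique:
  assumes "pre_digraph.awalk Q x p y" "pre_digraph.awalk Q x p z"
  shows "y = z"
proof -
  have "pre_digraph.cas Q x p y \<Longrightarrow> pre_digraph.cas Q x p z \<Longrightarrow> y = z"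
    by (induction p arbitrary: x) (auto simp: pre_digraph.cas.simps)
  then show ?thesis using assms by (auto simp: pre_digraph.awalk_def)
qed

lemma awalk_start_unique:
  assumes "pre_digraph.awalk Q x p z" "pre_digraph.awalk Q y p z"
  shows "x = y"
  using assms by (cases p) (auto simp: pre_digraph.awalk_def pre_digraph.cas.simps)

lemma lc_comp_paths_lc:
  assumes "wf_digraph Q" "\<rho> \<in> paths_lc Q x y" "\<sigma> \<in> paths_lc Q y z"
  shows "lc_comp \<sigma> \<rho> \<in> paths_lc Q x z"
proof -
  have "pre_digraph.awalk Q x r z" if "r \<in> supp (lc_comp \<sigma> \<rho>)" for r
  proof -
    have "r \<in> {p @ q | p q. p \<in> supp \<rho> \<and> q \<in> supp \<sigma>}"
      by (rule subsetD[OF supp_lc_comp that])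
    then obtain p q where "r = p @ q" "p \<in> supp \<rho>" "q \<in> supp \<sigma>" by auto
    then show ?thesis
      using wf_digraph.awalk_appendI[OF assms(1) paths_lcD[OF assms(2)] paths_lcD[OF assms(3)]]
      by simp
  qed
  then show ?thesis by (simp add: paths_lc_def subset_iff)
qed

lemma is_idealD:
  assumes "is_ideal Q I" "x \<in> verts Q" "y \<in> verts Q"
  shows "I x y \<subseteq> paths_lc Q x y" "lc.subspace (I x y)"
  using assms by (auto simp: is_ideal_def)

lemma is_ideal_comp:
  assumes "is_ideal Q I" "x \<in> verts Q" "y \<in> verts Q" "z \<in> verts Q"
  shows "\<rho> \<in> I x y \<Longrightarrow> \<sigma> \<in> paths_lc Q y z \<Longrightarrow> lc_comp \<sigma> \<rho> \<in> I x z"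
    and "\<rho> \<in> paths_lc Q x y \<Longrightarrow> \<sigma> \<in> I y z \<Longrightarrow> lc_comp \<sigma> \<rho> \<in> I x z"
  using assms by (auto simp: is_ideal_def)

text \<open>By bilinearity, stability under all of kQ follows from stability under single paths on
  either side.\<close>

lemma is_idealI:
  assumes "\<And>x y. x \<in> verts Q \<Longrightarrow> y \<in> verts Q \<Longrightarrow> I x y \<subseteq> paths_lc Q x y"
    and sub: "\<And>x y. x \<in> verts Q \<Longrightarrow> y \<in> verts Q \<Longrightarrow> lc.subspace (I x y)"
    and left: "\<And>x y z \<rho> q. x \<in> verts Q \<Longrightarrow> y \<in> verts Q \<Longrightarrow> z \<in> verts Q \<Longrightarrow> \<rho> \<in> I x y \<Longrightarrow>
      pre_digraph.awalk Q y q z \<Longrightarrow> lc_comp (pmon q) \<rho> \<in> I x z"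
    and right: "\<And>x y z \<sigma> p. x \<in> verts Q \<Longrightarrow> y \<in> verts Q \<Longrightarrow> z \<in> verts Q \<Longrightarrow> \<sigma> \<in> I y z \<Longrightarrow>
      pre_digraph.awalk Q x p y \<Longrightarrow> lc_comp \<sigma> (pmon p) \<in> I x z"
  shows "is_ideal Q I"
proof -
  have "lc_comp \<sigma> \<rho> \<in> I x z"
    if v: "x \<in> verts Q" "y \<in> verts Q" "z \<in> verts Q" and "\<rho> \<in> I x y" "\<sigma> \<in> paths_lc Q y z"
    for x y z \<rho> \<sigma>
  proof -
    note s = sub[OF v(1,3)]
    show ?thesis
    proof (induction \<sigma> rule: lc_induct)
      case (mon q)
      show ?case by (rule left[OF v that(4) paths_lcD[OF that(5) mon]])
    qed (use s in \<open>simp_all add: lc_comp_linear lc.subspace_0 lc.subspace_add lc.subspace_scale\<close>)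
  qed
  moreover have "lc_comp \<sigma> \<rho> \<in> I x z"
    if v: "x \<in> verts Q" "y \<in> verts Q" "z \<in> verts Q" and "\<rho> \<in> paths_lc Q x y" "\<sigma> \<in> I y z"
    for x y z \<rho> \<sigma>
  proof -
    note s = sub[OF v(1,3)]
    show ?thesis
    proof (induction \<rho> rule: lc_induct)
      case (mon q)
      show ?case by (rule right[OF v that(5) paths_lcD[OF that(4) mon]])
    qed (use s in \<open>simp_all add: lc_comp_linear lc.subspace_0 lc.subspace_add lc.subspace_scale\<close>)
  qed
  ultimately show ?thesis
    using assms(1) sub by (simp add: is_ideal_def)
qed

section \<open>The ideal generated by a set of relations\<close>

definition rel_multiples ::
    "('v, 'a) pre_digraph \<Rightarrow> ('v, 'a, 'k::field) path_rels \<Rightarrow> ('v, 'a, 'k) path_rels" where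
  "rel_multiples Q R x y = {lc_comp (pmon q) (lc_comp r (pmon p)) | p a r b q.
     pre_digraph.awalk Q x p a \<and> r \<in> R a b \<and> pre_digraph.awalk Q b q y}"

lemma gen_ideal_subset:
  assumes "is_ideal Q I" "\<And>a b. a \<in> verts Q \<Longrightarrow> b \<in> verts Q \<Longrightarrow> R a b \<subseteq> I a b"
  shows "gen_ideal Q R x y \<subseteq> I x y"
  using assms by (auto simp: gen_ideal_def)

context
  fixes Q :: "('v, 'a) pre_digraph" and R :: "('v, 'a, 'k::field) path_rels"
  assumes wf: "wf_digraph Q"
    and R: "\<And>a b. a \<in> verts Q \<Longrightarrow> b \<in> verts Q \<Longrightarrow> R a b \<subseteq> paths_lc Q a b"
begin

interpretation wf_digraph Q by (rule wf)

text \<open>Composing a multiple \<open>q r p\<close> with a path on either side only lengthens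
  \<open>p\<close> or \<open>q\<close>.\<close>

lemma is_ideal_span_rel_multiples: "is_ideal Q (\<lambda>x y. lc.span (rel_multiples Q R x y))"
proof (rule is_idealI)
  fix x y assume "x \<in> verts Q" "y \<in> verts Q"
  have "rel_multiples Q R x y \<subseteq> paths_lc Q x y"
  proof
    fix \<rho> assume "\<rho> \<in> rel_multiples Q R x y"
    then obtain p a r b q where *: "\<rho> = lc_comp (pmon q) (lc_comp r (pmon p))"
      "awalk x p a" "r \<in> R a b" "awalk b q y"
      by (auto simp: rel_multiples_def)
    then have "r \<in> paths_lc Q a b" using R awalk_last_in_verts awalk_hd_in_verts by blast
    then show "\<rho> \<in> paths_lc Q x y"
      unfolding *(1) using *(2,4) by (intro lc_comp_paths_lc[OF wf]) auto
  qed
  then show "lc.span (rel_multiples Q R x y) \<subseteq> paths_lc Q x y"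
    by (intro lc.span_minimal subspace_paths_lc)
next
  fix x y z \<rho> q
  assume q: "awalk y q z" and "\<rho> \<in> lc.span (rel_multiples Q R x y)"
  from this(2) show "lc_comp (pmon q) \<rho> \<in> lc.span (rel_multiples Q R x z)"
  proof (induction rule: lc.span_induct_alt)
    case (step c \<sigma> \<tau>)
    have "lc_comp (pmon q) \<sigma> \<in> rel_multiples Q R x z"
    proof -
      obtain p a r b s where *: "\<sigma> = lc_comp (pmon s) (lc_comp r (pmon p))"
        "awalk x p a" "r \<in> R a b" "awalk b s y"
        using step by (auto simp: rel_multiples_def)
      have "lc_comp (pmon q) \<sigma> = lc_comp (pmon (s @ q)) (lc_comp r (pmon p))"
        unfolding *(1) by (simp add: lc_comp_assoc)
      moreover have "awalk b (s @ q) z" using *(4) q by simp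
      ultimately show ?thesis using *(2,3) unfolding rel_multiples_def by blast
    qed
    then show ?case using step
      by (simp add: lc_comp_linear lc.span_add lc.span_base lc.span_scale)
  qed (simp add: lc.span_zero)
next
  fix x y z \<rho> p'
  assume p': "awalk x p' y" and "\<rho> \<in> lc.span (rel_multiples Q R y z)"
  from this(2) show "lc_comp \<rho> (pmon p') \<in> lc.span (rel_multiples Q R x z)"
  proof (induction rule: lc.span_induct_alt)
    case (step c \<sigma> \<tau>)
    have "lc_comp \<sigma> (pmon p') \<in> rel_multiples Q R x z"
    proof -
      obtain p a r b s where *: "\<sigma> = lc_comp (pmon s) (lc_comp r (pmon p))"
        "awalk y p a" "r \<in> R a b" "awalk b s z"
        using step by (auto simp: rel_multiples_def)
      have "lc_comp \<sigma> (pmon p') = lc_comp (pmon s) (lc_comp r (pmon (p' @ p)))"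
        unfolding *(1) lc_comp_assoc[symmetric] by simp
      moreover have "awalk x (p' @ p) a" using *(2) p' by simp
      ultimately show ?thesis using *(3,4) unfolding rel_multiples_def by blast
    qed
    then show ?case using step
      by (simp add: lc_comp_linear lc.span_add lc.span_base lc.span_scale)
  qed (simp add: lc.span_zero)
qed auto

text \<open>Trivial \<open>p\<close> and \<open>q\<close> put the generators into the span, which is
  therefore one of the ideals intersected on the left; conversely each of those ideals contains all
  multiples.\<close>

lemma gen_ideal_eq_span:
  assumes "x \<in> verts Q" "y \<in> verts Q"
  shows "gen_ideal Q R x y = lc.span (rel_multiples Q R x y)"
proof
  show "gen_ideal Q R x y \<subseteq> lc.span (rel_multiples Q R x y)"
  proof (rule gen_ideal_subset[OF is_ideal_span_rel_multiples])
    fix a b assume ab: "a \<in> verts Q" "b \<in> verts Q"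
    show "R a b \<subseteq> lc.span (rel_multiples Q R a b)"
    proof
      fix r assume r: "r \<in> R a b"
      have "lc_comp (pmon []) (lc_comp r (pmon [])) \<in> rel_multiples Q R a b"
        unfolding rel_multiples_def using r ab by (blast intro: awalk_Nil_iff[THEN iffD2])
      then show "r \<in> lc.span (rel_multiples Q R a b)" by (auto intro: lc.span_base)
    qed
  qed
next
  have "\<rho> \<in> I x y" if I: "is_ideal Q I" "\<forall>a\<in>verts Q. \<forall>b\<in>verts Q. R a b \<subseteq> I a b"
    and \<rho>: "\<rho> \<in> rel_multiples Q R x y" for I \<rho>
  proof -
    obtain p a r b q where *: "\<rho> = lc_comp (pmon q) (lc_comp r (pmon p))"
      "awalk x p a" "r \<in> R a b" "awalk b q y"
      using \<rho> by (auto simp: rel_multiples_def)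
    then have ab: "a \<in> verts Q" "b \<in> verts Q"
      using awalk_last_in_verts awalk_hd_in_verts by auto
    have "lc_comp r (pmon p) \<in> I x b"
      using I(2) ab *(2,3) by (intro is_ideal_comp(2)[OF I(1) assms(1) ab]) auto
    then show ?thesis
      unfolding *(1) using *(4) by (intro is_ideal_comp(1)[OF I(1) assms(1) ab(2) assms(2)]) auto
  qed
  then have "lc.span (rel_multiples Q R x y) \<subseteq> I x y"
    if "is_ideal Q I" "\<forall>a\<in>verts Q. \<forall>b\<in>verts Q. R a b \<subseteq> I a b" for I
    using that assms by (intro lc.span_minimal) (auto dest: is_idealD)
  moreover have "lc.span (rel_multiples Q R x y) \<subseteq> paths_lc Q x y"
    using is_idealD(1)[OF is_ideal_span_rel_multiples assms] .
  ultimately show "lc.span (rel_multiples Q R x y) \<subseteq> gen_ideal Q R x y"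
    unfolding gen_ideal_def by blast
qed

text \<open>\<open>is_ideal\<close> inspects only the spaces between vertices, and there the
  generated ideal is the span.\<close>

lemma is_ideal_gen_ideal: "is_ideal Q (gen_ideal Q R)"
proof -
  have "is_ideal Q (gen_ideal Q R) = is_ideal Q (\<lambda>x y. lc.span (rel_multiples Q R x y))"
    unfolding is_ideal_def by (simp add: gen_ideal_eq_span cong: ball_cong)
  then show ?thesis using is_ideal_span_rel_multiples by simp
qed

end

section \<open>The arrow ideal\<close>

lemma is_ideal_no_trivial_paths:
  assumes "wf_digraph Q"
  shows "is_ideal Q (\<lambda>x y. {\<rho> \<in> paths_lc Q x y. coef \<rho> [] = 0})"
proof (rule is_idealI)
  fix x y
  show "lc.subspace {\<rho> \<in> paths_lc Q x y. coef \<rho> [] = 0}"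
    using subspace_paths_lc[of Q x y] by (auto simp: lc.subspace_def lookup_add)
qed (auto simp: coef_lc_comp_Nil intro: lc_comp_paths_lc[OF assms])

text \<open>A nontrivial path is an arrow followed by a path, so it lies in every ideal containing
  the arrows. Membership in the arrow ideal thus becomes the vanishing of one coefficient.\<close>

lemma gen_ideal_arrow_rels:
  assumes "wf_digraph Q" "x \<in> verts Q" "y \<in> verts Q"
  shows "gen_ideal Q (arrow_rels Q) x y = {\<rho> \<in> paths_lc Q x y. coef \<rho> [] = 0}"
proof
  interpret wf_digraph Q by fact
  show "gen_ideal Q (arrow_rels Q) x y \<subseteq> {\<rho> \<in> paths_lc Q x y. coef \<rho> [] = 0}"
    by (rule gen_ideal_subset[OF is_ideal_no_trivial_paths[OF assms(1)]])
      (auto simp: arrow_rels_def lookup_single "when_def" arc_implies_awalk)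
  show "{\<rho> \<in> paths_lc Q x y. coef \<rho> [] = 0} \<subseteq> gen_ideal Q (arrow_rels Q) x y"
  proof
    fix \<rho>
    assume \<rho>: "\<rho> \<in> {\<rho> \<in> paths_lc Q x y. coef \<rho> [] = 0}"
    have "\<rho> \<in> I x y"
      if I: "is_ideal Q I" "\<forall>a\<in>verts Q. \<forall>b\<in>verts Q. arrow_rels Q a b \<subseteq> I a b" for I
    proof (rule lc_in_subspace[OF is_idealD(2)[OF I(1) assms(2,3)]])
      fix p assume p: "p \<in> supp \<rho>"
      then have "p \<noteq> []" using \<rho> by (auto simp: in_keys_iff)
      then obtain a q where pq: "p = a # q" by (cases p) auto
      have "awalk x p y" using \<rho> p paths_lcD[of \<rho> Q x y p] by simp
      then have a: "a \<in> arcs Q" "tail Q a = x" "awalk (head Q a) q y"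
        by (auto simp: pq awalk_Cons_iff)
      then have "pmon [a] \<in> I x (head Q a)"
        using I(2)[rule_format, OF assms(2), of "head Q a"] by (auto simp: arrow_rels_def)
      then have "lc_comp (pmon q) (pmon [a]) \<in> I x y"
        using a by (intro is_ideal_comp(1)[OF I(1) assms(2) _ assms(3)]) auto
      then show "pmon p \<in> I x y" by (simp add: pq)
    qed
    then show "\<rho> \<in> gen_ideal Q (arrow_rels Q) x y"
      using \<rho> unfolding gen_ideal_def by blast
  qed
qed

lemma is_rquiver_iff:
  "is_rquiver (Q, I) \<longleftrightarrow> wf_digraph Q \<and> is_ideal Q I \<and>
     (\<forall>x \<in> verts Q. \<forall>y \<in> verts Q. \<forall>\<rho> \<in> I x y. coef \<rho> [] = 0)"
proof (cases "wf_digraph Q \<and> is_ideal Q I")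
  case True
  then have "I x y \<subseteq> paths_lc Q x y" if "x \<in> verts Q" "y \<in> verts Q" for x y
    using that by (intro is_idealD(1)) auto
  then show ?thesis
    using True by (simp add: is_rquiver_def gen_ideal_arrow_rels subset_iff Ball_def)
qed (auto simp: is_rquiver_def)

lemma quiver_morphism_awalk:
  assumes "wf_digraph Q" "quiver_morphism Q Q' f" "pre_digraph.awalk Q x p y"
  shows "pre_digraph.awalk Q' (fst f x) (map (snd f) p) (fst f y)"
  using assms(3)
proof (induction p arbitrary: x)
  case Nil
  then show ?case using assms(2) by (auto simp: awalk_Nil_iff' quiver_morphism_def)
next
  case (Cons a p)
  have "a \<in> arcs Q" "tail Q a = x" "x \<in> verts Q" "pre_digraph.awalk Q (head Q a) p y"
    using Cons.prems wf_digraph.head_in_verts[OF assms(1)]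
    by (auto simp: pre_digraph.awalk_def pre_digraph.cas.simps)
  then show ?case
    using Cons.IH[of "head Q a"] assms(2)
    by (auto simp: pre_digraph.awalk_def pre_digraph.cas.simps quiver_morphism_def)
qed

lemma subspace_lc_map_image:
  assumes "lc.subspace S"
  shows "lc.subspace (lc_map f ` S)"
proof (rule lc.subspaceI)
  show "0 \<in> lc_map f ` S" using lc.subspace_0[OF assms] by (intro image_eqI[where x = 0]) auto
  show "x + y \<in> lc_map f ` S" if "x \<in> lc_map f ` S" "y \<in> lc_map f ` S" for x y
    using that lc.subspace_add[OF assms] by (auto simp: lc_map_add[symmetric])
  show "lc_scale c x \<in> lc_map f ` S" if "x \<in> lc_map f ` S" for x c
    using that lc.subspace_scale[OF assms] by (auto simp: lc_map_scale[symmetric])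
qed

lemma lc_map_paths_lc:
  assumes "wf_digraph Q" "quiver_morphism Q Q' f" "\<rho> \<in> paths_lc Q x y"
  shows "lc_map f \<rho> \<in> paths_lc Q' (fst f x) (fst f y)"
proof -
  have "map (snd f) ` supp \<rho> \<subseteq> {p. pre_digraph.awalk Q' (fst f x) p (fst f y)}"
    using quiver_morphism_awalk[OF assms(1,2) paths_lcD[OF assms(3)]] by auto
  then show ?thesis
    unfolding paths_lc_def using supp_lc_map[of f \<rho>] by simp
qed

section \<open>Preimages of ideals under a quiver morphism\<close>

definition pullback_rels :: "('v, 'a) pre_digraph \<Rightarrow> ('v, 'a, 'w, 'b) quiver_map \<Rightarrow>
    ('w, 'b, 'k::field) path_rels \<Rightarrow> ('v, 'a, 'k) path_rels" where
  "pullback_rels Q f I' x y = {\<rho> \<in> paths_lc Q x y. lc_map f \<rho> \<in> I' (fst f x) (fst f y)}"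

text \<open>kf is multiplicative and keeps the coefficient at \<open>[]\<close>, so both
  requirements pull back. The preimage serves as test ideal for maps out of a generated ideal and as
  a model of the orbit ideal.\<close>

lemma is_rquiver_pullback:
  assumes Q: "wf_digraph Q" and f: "quiver_morphism Q Q' f" and I': "is_rquiver (Q', I')"
  shows "is_rquiver (Q, pullback_rels Q f I')"
proof -
  have ideal: "is_ideal Q' I'" using I' by (simp add: is_rquiver_iff)
  have vf: "fst f x \<in> verts Q'" if "x \<in> verts Q" for x
    using f that by (auto simp: quiver_morphism_def)
  note awf = quiver_morphism_awalk[OF Q f]
  have "is_ideal Q (pullback_rels Q f I')"
  proof (rule is_idealI)
    fix x y assume "x \<in> verts Q" "y \<in> verts Q"
    then have "lc.subspace (I' (fst f x) (fst f y))" using is_idealD[OF ideal] vf by blast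
    then show "lc.subspace (pullback_rels Q f I' x y)"
      using subspace_paths_lc[of Q x y]
      by (auto simp: lc.subspace_def pullback_rels_def lc_map_linear)
  next
    fix x y z \<rho> q
    assume v: "x \<in> verts Q" "y \<in> verts Q" "z \<in> verts Q"
      and *: "\<rho> \<in> pullback_rels Q f I' x y" "pre_digraph.awalk Q y q z"
    have "lc_comp (pmon (map (snd f) q)) (lc_map f \<rho>) \<in> I' (fst f x) (fst f z)"
      using * awf by (intro is_ideal_comp(1)[OF ideal vf[OF v(1)] vf[OF v(2)] vf[OF v(3)]])
        (auto simp: pullback_rels_def)
    then show "lc_comp (pmon q) \<rho> \<in> pullback_rels Q f I' x z"
      using * by (auto simp: pullback_rels_def lc_map_lc_comp intro: lc_comp_paths_lc[OF Q])
  next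
    fix x y z \<sigma> p
    assume v: "x \<in> verts Q" "y \<in> verts Q" "z \<in> verts Q"
      and *: "\<sigma> \<in> pullback_rels Q f I' y z" "pre_digraph.awalk Q x p y"
    have "lc_comp (lc_map f \<sigma>) (pmon (map (snd f) p)) \<in> I' (fst f x) (fst f z)"
      using * awf by (intro is_ideal_comp(2)[OF ideal vf[OF v(1)] vf[OF v(2)] vf[OF v(3)]])
        (auto simp: pullback_rels_def)
    then show "lc_comp \<sigma> (pmon p) \<in> pullback_rels Q f I' x z"
      using * by (auto simp: pullback_rels_def lc_map_lc_comp intro: lc_comp_paths_lc[OF Q])
  qed (auto simp: pullback_rels_def)
  moreover have "coef \<rho> [] = 0"
    if "x \<in> verts Q" "y \<in> verts Q" "\<rho> \<in> pullback_rels Q f I' x y" for x y \<rho>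
  proof -
    have "lc_map f \<rho> \<in> I' (fst f x) (fst f y)" using that by (simp add: pullback_rels_def)
    then have "coef (lc_map f \<rho>) [] = 0"
      using I'[unfolded is_rquiver_iff] vf[OF that(1)] vf[OF that(2)] by blast
    then show ?thesis by (simp add: coef_lc_map_Nil)
  qed
  ultimately show ?thesis using Q by (simp add: is_rquiver_iff)
qed

section \<open>Lifting ideals along families of paths\<close>

text \<open>In the applications \<open>P b\<close> consists of the paths from a fixed vertex to \<open>b\<close>, or of the paths
  from \<open>b\<close> to a fixed vertex.\<close>

locale graded_lift =
  fixes f :: "('v, 'a, 'w, 'b) quiver_map"
    and B :: "'c set" and P :: "'c \<Rightarrow> 'a list set"
    and I :: "'c \<Rightarrow> ('a, 'k::field) path_lc set" and I' :: "('b, 'k) path_lc set"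
  assumes disj: "\<lbrakk>b \<in> B; c \<in> B; p \<in> P b; p \<in> P c\<rbrakk> \<Longrightarrow> b = c"
    and inj: "inj_on (map (snd f)) (\<Union>b\<in>B. P b)"
    and I_supp: "\<lbrakk>b \<in> B; \<rho> \<in> I b\<rbrakk> \<Longrightarrow> supp \<rho> \<subseteq> P b"
    and I_subspace: "b \<in> B \<Longrightarrow> lc.subspace (I b)"
    and I'_subspace: "lc.subspace I'"
    and I_map: "\<lbrakk>b \<in> B; \<rho> \<in> I b\<rbrakk> \<Longrightarrow> lc_map f \<rho> \<in> I'"
    and I'_lift: "\<rho>' \<in> I' \<Longrightarrow> \<exists>\<rho> \<in> lc.span (\<Union>b\<in>B. I b). lc_map f \<rho> = \<rho>'"
begin

lemma lc_part_P:
  assumes "b \<in> B" "c \<in> B" "supp \<rho> \<subseteq> P c"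
  shows "lc_part (P b) \<rho> = (if b = c then \<rho> else 0)"
  using assms disj by (auto intro!: lc_part_superset lc_part_disjoint)

text \<open>The path sets are disjoint, so projecting to \<open>P b\<close> kills every
  \<open>I d\<close> with \<open>d \<noteq> b\<close>: the sum of the pieces is direct, with
  components cut out by path sets.\<close>

lemma lc_part_span:
  assumes "\<rho> \<in> lc.span (\<Union>b\<in>B. I b)" "b \<in> B"
  shows "lc_part (P b) \<rho> \<in> I b"
  using assms(1)
proof (induction rule: lc.span_induct_alt)
  case (step c \<sigma> \<tau>)
  then obtain d where d: "d \<in> B" "\<sigma> \<in> I d" by blast
  have "lc_part (P b) \<sigma> \<in> I b"
    using d lc_part_P[OF assms(2) d(1) I_supp[OF d]] lc.subspace_0[OF I_subspace[OF assms(2)]]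
    by auto
  then show ?case
    using step I_subspace[OF assms(2)]
    by (simp add: lc_part_add lc_part_scale lc.subspace_add lc.subspace_scale)
qed (use I_subspace[OF assms(2)] in \<open>simp add: lc.subspace_0\<close>)

lemma supp_span: "\<rho> \<in> lc.span (\<Union>b\<in>B. I b) \<Longrightarrow> supp \<rho> \<subseteq> (\<Union>b\<in>B. P b)"
  using lc.span_minimal[OF _ subspace_supp_subset[of "\<Union>b\<in>B. P b"], of "\<Union>b\<in>B. I b"] I_supp
  by blast

text \<open>kf is injective on combinations of paths in the union of the \<open>P b\<close>, so the
  lift provided by \<open>I'_lift\<close> can only be the given sum; its component at
  \<open>c\<close> is \<open>m c\<close>. This becomes the injectivity of the covering
  functor.\<close>

lemma sum_lc_map_in_I':
  assumes "finite Z" "Z \<subseteq> B" "\<And>b. b \<in> Z \<Longrightarrow> supp (m b) \<subseteq> P b"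
    and "(\<Sum>b\<in>Z. lc_map f (m b)) \<in> I'" "c \<in> Z"
  shows "m c \<in> I c"
proof -
  obtain \<sigma> where \<sigma>: "\<sigma> \<in> lc.span (\<Union>b\<in>B. I b)" "lc_map f \<sigma> = lc_map f (sum m Z)"
    using I'_lift[OF assms(4)] by (auto simp: lc_map_sum)
  have "supp (m b) \<subseteq> (\<Union>b\<in>B. P b)" if "b \<in> Z" for b using assms(2,3) that by blast
  then have "sum m Z \<in> {\<rho>. supp \<rho> \<subseteq> (\<Union>b\<in>B. P b)}"
    by (intro lc.subspace_sum[OF subspace_supp_subset]) auto
  then have "\<sigma> = sum m Z"
    using inj_onD[OF lc_map_inj_on[OF inj] \<sigma>(2)] supp_span[OF \<sigma>(1)] by blast
  moreover have "lc_part (P c) (sum m Z) = (\<Sum>b\<in>Z. if c = b then m b else 0)"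
    unfolding lc_part_sum using assms by (intro sum.cong refl lc_part_P) auto
  ultimately have "lc_part (P c) \<sigma> = m c" using assms(1,5) by simp
  then show ?thesis using lc_part_span[OF \<sigma>(1), of c] assms(2,5) by auto
qed

text \<open>Reflection of relations is the one-term case of \<open>sum_lc_map_in_I'\<close>.\<close>

lemma lc_map_in_I':
  assumes "b \<in> B" "supp \<rho> \<subseteq> P b"
  shows "lc_map f \<rho> \<in> I' \<longleftrightarrow> \<rho> \<in> I b"
  using sum_lc_map_in_I'[of "{b}" "\<lambda>_. \<rho>" b] assms I_map[OF assms(1)] by auto

text \<open>Each graded component of a lift maps to a partial sum of \<open>\<rho>'\<close> that
  again lies in \<open>I'\<close>; minimality leaves only the empty and the full partial
  sum.\<close>

lemma lift_minimal:
  assumes \<rho>': "\<rho>' \<in> I'" "\<rho>' \<noteq> 0"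
    and min: "\<And>K. K \<noteq> {} \<Longrightarrow> K \<subset> supp \<rho>' \<Longrightarrow> lc_part K \<rho>' \<notin> I'"
  shows "\<exists>b\<in>B. \<exists>\<rho>\<in>I b. lc_map f \<rho> = \<rho>'"
proof -
  obtain \<sigma> where \<sigma>: "\<sigma> \<in> lc.span (\<Union>b\<in>B. I b)" "lc_map f \<sigma> = \<rho>'"
    using I'_lift[OF \<rho>'(1)] by blast
  then have "supp \<sigma> \<noteq> {}" using \<rho>'(2) by auto
  then obtain p where p: "p \<in> supp \<sigma>" by blast
  then obtain b where b: "b \<in> B" "p \<in> P b" using supp_span[OF \<sigma>(1)] by blast
  let ?K = "map (snd f) ` P b"
  have part: "lc_map f (lc_part (P b) \<sigma>) = lc_part ?K \<rho>'"
    unfolding \<sigma>(2)[symmetric] using b(1) by (intro lc_map_lc_part[OF inj supp_span[OF \<sigma>(1)]]) auto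
  \<comment> \<open>No cancellation occurs under kf, so the image of \<open>p\<close> survives and
    the partial sum is not the empty one.\<close>
  have "coef \<rho>' (map (snd f) p) = coef \<sigma> p"
    unfolding \<sigma>(2)[symmetric] using b by (intro coef_lc_map[OF inj supp_span[OF \<sigma>(1)]]) auto
  then have "map (snd f) p \<in> supp \<rho>' \<inter> ?K" using p b by (auto simp: in_keys_iff)
  moreover have "lc_part (supp \<rho>' \<inter> ?K) \<rho>' \<in> I'"
    unfolding lc_part_supp_Int part[symmetric] using lc_part_span[OF \<sigma>(1) b(1)] I_map[OF b(1)] by blast
  ultimately have "supp \<rho>' \<inter> ?K = supp \<rho>'" using min[of "supp \<rho>' \<inter> ?K"] by blast
  then have "lc_part ?K \<rho>' = \<rho>'" by (intro lc_part_superset) blast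
  then show ?thesis using part lc_part_span[OF \<sigma>(1) b(1)] b(1) by auto
qed

text \<open>Lifting all paths and sorting the lifts by their index gives the surjectivity of the
  covering functor.\<close>

lemma lift_lc:
  assumes "supp \<rho>' \<subseteq> map (snd f) ` (\<Union>b\<in>B. P b)"
  shows "\<exists>Z m. finite Z \<and> Z \<subseteq> B \<and> (\<forall>b\<in>Z. supp (m b) \<subseteq> P b) \<and> \<rho>' = (\<Sum>b\<in>Z. lc_map f (m b))"
proof -
  have "\<exists>\<rho>. supp \<rho> \<subseteq> (\<Union>b\<in>B. P b) \<and> lc_map f \<rho> = \<rho>'"
  proof -
    have "\<rho>' \<in> lc_map f ` {\<rho>. supp \<rho> \<subseteq> (\<Union>b\<in>B. P b)}"
    proof (rule lc_in_subspace)
      show "lc.subspace (lc_map f ` {\<rho>. supp \<rho> \<subseteq> (\<Union>b\<in>B. P b)})"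
        by (rule subspace_lc_map_image[OF subspace_supp_subset])
      fix q assume "q \<in> supp \<rho>'"
      then obtain p where "p \<in> (\<Union>b\<in>B. P b)" "q = map (snd f) p" using assms by blast
      then show "pmon q \<in> lc_map f ` {\<rho>. supp \<rho> \<subseteq> (\<Union>b\<in>B. P b)}"
        by (intro image_eqI[where x = "pmon p"]) auto
    qed
    then show ?thesis by auto
  qed
  then obtain \<rho> where \<rho>: "supp \<rho> \<subseteq> (\<Union>b\<in>B. P b)" "lc_map f \<rho> = \<rho>'" by blast
  then have "\<forall>p\<in>supp \<rho>. \<exists>b. b \<in> B \<and> p \<in> P b" by blast
  then obtain g where g: "\<And>p. p \<in> supp \<rho> \<Longrightarrow> g p \<in> B \<and> p \<in> P (g p)" by metis
  \<comment> \<open>The sum runs over the image of \<open>g\<close>, so an index is counted once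
    however many paths of the support belong to it.\<close>
  have "(\<Sum>b\<in>g ` supp \<rho>. lc_part (P b) \<rho>) = \<rho>"
  proof (rule poly_mapping_eqI)
    fix p
    show "coef (\<Sum>b\<in>g ` supp \<rho>. lc_part (P b) \<rho>) p = coef \<rho> p"
    proof (cases "p \<in> supp \<rho>")
      case True
      then have "coef (\<Sum>b\<in>g ` supp \<rho>. lc_part (P b) \<rho>) p
          = (\<Sum>b\<in>g ` supp \<rho>. if b = g p then coef \<rho> p else 0)"
        unfolding lookup_sum coef_lc_part using g disj True by (intro sum.cong) auto
      then show ?thesis using True by simp
    next
      case False
      then show ?thesis by (auto simp: lookup_sum in_keys_iff intro: sum.neutral)
    qed
  qed
  then have "\<rho>' = (\<Sum>b\<in>g ` supp \<rho>. lc_map f (lc_part (P b) \<rho>))"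
    using \<rho>(2) by (simp add: lc_map_sum[symmetric])
  then show ?thesis
    using g by (intro exI[of _ "g ` supp \<rho>"] exI[of _ "\<lambda>b. lc_part (P b) \<rho>"])
      (auto simp: supp_lc_part)
qed

end

section \<open>Coverings of quivers\<close>

locale quiver_cover =
  fixes Q :: "('v, 'a) pre_digraph" and Q' :: "('w, 'b) pre_digraph"
    and f :: "('v, 'a, 'w, 'b) quiver_map"
  assumes wf: "wf_digraph Q" and wf': "wf_digraph Q'" and covering: "quiver_covering Q Q' f"
begin

sublocale Q: wf_digraph Q by (rule wf)
sublocale Q': wf_digraph Q' by (rule wf')

lemma morphism: "quiver_morphism Q Q' f"
  using covering by (simp add: quiver_covering_def)

lemma vert_map: "x \<in> verts Q \<Longrightarrow> fst f x \<in> verts Q'"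
  using morphism by (simp add: quiver_morphism_def)

lemma arc_map:
  assumes "a \<in> arcs Q"
  shows "snd f a \<in> arcs Q'" "tail Q' (snd f a) = fst f (tail Q a)"
    "head Q' (snd f a) = fst f (head Q a)"
  using morphism assms by (auto simp: quiver_morphism_def)

lemma out_arc_lift:
  assumes "x \<in> verts Q" "a' \<in> arcs Q'" "tail Q' a' = fst f x"
  obtains a where "a \<in> arcs Q" "tail Q a = x" "snd f a = a'"
proof -
  have "a' \<in> snd f ` {a \<in> arcs Q. tail Q a = x}"
    using covering assms by (auto simp: quiver_covering_def bij_betw_def)
  then show ?thesis using that by auto
qed

lemma in_arc_lift:
  assumes "x \<in> verts Q" "a' \<in> arcs Q'" "head Q' a' = fst f x"
  obtains a where "a \<in> arcs Q" "head Q a = x" "snd f a = a'"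
proof -
  have "a' \<in> snd f ` {a \<in> arcs Q. head Q a = x}"
    using covering assms by (auto simp: quiver_covering_def bij_betw_def)
  then show ?thesis using that by auto
qed

lemma out_arc_unique:
  assumes "a \<in> arcs Q" "b \<in> arcs Q" "tail Q a = tail Q b" "snd f a = snd f b"
  shows "a = b"
proof -
  have "inj_on (snd f) {c \<in> arcs Q. tail Q c = tail Q a}"
    using covering assms(1) by (auto simp: quiver_covering_def bij_betw_def)
  then show ?thesis using assms by (auto dest: inj_onD)
qed

lemma in_arc_unique:
  assumes "a \<in> arcs Q" "b \<in> arcs Q" "head Q a = head Q b" "snd f a = snd f b"
  shows "a = b"
proof -
  have "inj_on (snd f) {c \<in> arcs Q. head Q c = head Q a}"
    using covering assms(1) by (auto simp: quiver_covering_def bij_betw_def)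
  then show ?thesis using assms by (auto dest: inj_onD)
qed

lemmas awalk_map = quiver_morphism_awalk[OF wf morphism]

section \<open>Unique lifting of paths\<close>

lemma awalk_lift_from:
  assumes "x \<in> verts Q" "Q'.awalk (fst f x) p' b'"
  shows "\<exists>p b. Q.awalk x p b \<and> map (snd f) p = p' \<and> fst f b = b'"
  using assms
proof (induction p' arbitrary: x)
  case Nil
  then show ?case
    by (intro exI[of _ "[]"] exI[of _ x]) (auto simp: Q.awalk_Nil_iff Q'.awalk_Nil_iff)
next
  case (Cons a' p')
  then have "a' \<in> arcs Q'" "tail Q' a' = fst f x" "Q'.awalk (head Q' a') p' b'"
    by (auto simp: Q'.awalk_Cons_iff)
  moreover from this obtain a where a: "a \<in> arcs Q" "tail Q a = x" "snd f a = a'"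
    using out_arc_lift[OF Cons.prems(1)] by blast
  ultimately have "Q'.awalk (fst f (head Q a)) p' b'" using arc_map(3)[OF a(1)] by simp
  from Cons.IH[OF Q.head_in_verts[OF a(1)] this] obtain p b
    where "Q.awalk (head Q a) p b" "map (snd f) p = p'" "fst f b = b'" by blast
  then show ?case using a
    by (intro exI[of _ "a # p"] exI[of _ b]) (auto simp: Q.awalk_Cons_iff)
qed

text \<open>Bijectivity on incoming arrows lets the lift be built from its last arrow, hence the
  reversed induction.\<close>

lemma awalk_lift_to:
  assumes "y \<in> verts Q" "Q'.awalk a' p' (fst f y)"
  shows "\<exists>p a. Q.awalk a p y \<and> map (snd f) p = p' \<and> fst f a = a'"
  using assms
proof (induction p' arbitrary: y rule: rev_induct)
  case Nil
  then show ?case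
    by (intro exI[of _ "[]"] exI[of _ y]) (auto simp: Q.awalk_Nil_iff Q'.awalk_Nil_iff)
next
  case (snoc b' p')
  then have "b' \<in> arcs Q'" "head Q' b' = fst f y" "Q'.awalk a' p' (tail Q' b')"
    by (auto simp: Q'.awalk_Cons_iff Q'.awalk_Nil_iff)
  moreover from this obtain b where b: "b \<in> arcs Q" "head Q b = y" "snd f b = b'"
    using in_arc_lift[OF snoc.prems(1)] by blast
  ultimately have "Q'.awalk a' p' (fst f (tail Q b))" using arc_map(2)[OF b(1)] by simp
  from snoc.IH[OF Q.tail_in_verts[OF b(1)] this] obtain p a
    where "Q.awalk a p (tail Q b)" "map (snd f) p = p'" "fst f a = a'" by blast
  then show ?case using b snoc.prems(1)
    by (intro exI[of _ "p @ [b]"] exI[of _ a])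
      (auto simp: Q.awalk_Cons_iff Q.awalk_Nil_iff)
qed

text \<open>The ends \<open>b\<close> and \<open>c\<close> are left free, as needed for injectivity
  over a whole fibre: the arrows are compared one by one from the common start.\<close>

lemma awalk_unique_from:
  assumes "Q.awalk x p b" "Q.awalk x q c" "map (snd f) p = map (snd f) q"
  shows "p = q"
  using assms
proof (induction p arbitrary: x q)
  case (Cons a p)
  then obtain a2 q2 where q: "q = a2 # q2" by auto
  have "a \<in> arcs Q" "a2 \<in> arcs Q" "tail Q a = tail Q a2" "snd f a = snd f a2"
    using Cons.prems by (auto simp: q Q.awalk_Cons_iff)
  then have "a = a2" by (rule out_arc_unique)
  then show ?case
    using Cons.prems Cons.IH[of "head Q a" q2] by (auto simp: q Q.awalk_Cons_iff)
qed auto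

lemma awalk_unique_to:
  assumes "Q.awalk b p y" "Q.awalk c q y" "map (snd f) p = map (snd f) q"
  shows "p = q"
  using assms
proof (induction p arbitrary: y q rule: rev_induct)
  case (snoc a p)
  have "q \<noteq> []" using snoc.prems(3) by auto
  then obtain a2 q2 where q: "q = q2 @ [a2]" by (cases q rule: rev_cases) auto
  have "a \<in> arcs Q" "a2 \<in> arcs Q" "head Q a = head Q a2" "snd f a = snd f a2"
    using snoc.prems by (auto simp: q Q.awalk_Cons_iff Q.awalk_Nil_iff)
  then have "a = a2" by (rule in_arc_unique)
  then show ?case
    using snoc.prems snoc.IH[of "tail Q a" q2]
    by (auto simp: q Q.awalk_Cons_iff Q.awalk_Nil_iff)
qed auto

end

lemma lc_part_subset:
  assumes "K \<subseteq> supp \<rho>"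
  shows "(\<Sum>u\<in>K. Poly_Mapping.single u (coef \<rho> u)) = lc_part K \<rho>"
  using assms by (simp add: lc_part_def Int_absorb1)

text \<open>Lifts of generators only have to lie in \<open>I\<close>. Lifting from the source and
  lifting into the target are separate hypotheses, since prescribing the start of a lift gives no
  control over its end.\<close>

locale rquiver_cover = quiver_cover Q Q' f
  for Q :: "('v, 'a) pre_digraph" and Q' :: "('w, 'b) pre_digraph"
    and f :: "('v, 'a, 'w, 'b) quiver_map" +
  fixes I :: "('v, 'a, 'k::field) path_rels" and R' I' :: "('w, 'b, 'k) path_rels"
  assumes rquiver: "is_rquiver (Q, I)" and rquiver': "is_rquiver (Q', I')"
    and gens: "\<lbrakk>x' \<in> verts Q'; y' \<in> verts Q'\<rbrakk> \<Longrightarrow> R' x' y' \<subseteq> paths_lc Q' x' y'"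
    and I'_def: "I' = gen_ideal Q' R'"
    and map_I: "\<lbrakk>x \<in> verts Q; y \<in> verts Q; \<rho> \<in> I x y\<rbrakk> \<Longrightarrow> lc_map f \<rho> \<in> I' (fst f x) (fst f y)"
    and gens_from: "\<lbrakk>x \<in> verts Q; r' \<in> R' (fst f x) y'\<rbrakk> \<Longrightarrow>
      \<exists>y \<in> verts Q. fst f y = y' \<and> (\<exists>r \<in> I x y. lc_map f r = r')"
    and gens_to: "\<lbrakk>y \<in> verts Q; r' \<in> R' x' (fst f y)\<rbrakk> \<Longrightarrow>
      \<exists>x \<in> verts Q. fst f x = x' \<and> (\<exists>r \<in> I x y. lc_map f r = r')"
begin

lemma ideal: "is_ideal Q I" and ideal': "is_ideal Q' I'"
  using rquiver rquiver' by (auto simp: is_rquiver_iff)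

lemma I'_span:
  assumes "x' \<in> verts Q'" "y' \<in> verts Q'"
  shows "I' x' y' = lc.span (rel_multiples Q' R' x' y')"
  unfolding I'_def by (rule gen_ideal_eq_span[OF wf' gens assms])

lemma multiple_in_I:
  assumes "Q.awalk x p a" "r \<in> I a c" "Q.awalk c q y"
  shows "lc_comp (pmon q) (lc_comp r (pmon p)) \<in> I x y"
proof -
  have v: "x \<in> verts Q" "a \<in> verts Q" "c \<in> verts Q" "y \<in> verts Q"
    using assms(1,3) by auto
  have "lc_comp r (pmon p) \<in> I x c"
    by (rule is_ideal_comp(2)[OF ideal v(1,2,3)]) (use assms in auto)
  then show ?thesis
    by (rule is_ideal_comp(1)[OF ideal v(1,3,4)]) (use assms in auto)
qed

text \<open>Each multiple \<open>q' r' p'\<close> is lifted in the order of traversal, every piece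
  starting at the end found for the previous one. The final end is not known in advance, hence the
  union over the fibre.\<close>

lemma I'_lift_from:
  assumes x: "x \<in> verts Q" and y': "y' \<in> verts Q'" and \<rho>': "\<rho>' \<in> I' (fst f x) y'"
  shows "\<exists>\<rho> \<in> lc.span (\<Union>y\<in>{y \<in> verts Q. fst f y = y'}. I x y). lc_map f \<rho> = \<rho>'"
proof -
  let ?S = "\<Union>y\<in>{y \<in> verts Q. fst f y = y'}. I x y"
  have "\<rho>' \<in> lc.span (rel_multiples Q' R' (fst f x) y')"
    using \<rho>' I'_span[OF vert_map[OF x] y'] by simp
  moreover have "rel_multiples Q' R' (fst f x) y' \<subseteq> lc_map f ` lc.span ?S"
  proof
    fix \<sigma>' assume "\<sigma>' \<in> rel_multiples Q' R' (fst f x) y'"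
    then obtain p' a' r' c' q' where *: "\<sigma>' = lc_comp (pmon q') (lc_comp r' (pmon p'))"
      "Q'.awalk (fst f x) p' a'" "r' \<in> R' a' c'" "Q'.awalk c' q' y'"
      unfolding rel_multiples_def by auto
    obtain p a where p: "Q.awalk x p a" "map (snd f) p = p'" "fst f a = a'"
      using awalk_lift_from[OF x *(2)] by auto
    have "a \<in> verts Q" using p(1) by auto
    then obtain c r where r: "c \<in> verts Q" "fst f c = c'" "r \<in> I a c" "lc_map f r = r'"
      using gens_from[of a r' c'] *(3) p(3) by auto
    obtain q y where q: "Q.awalk c q y" "map (snd f) q = q'" "fst f y = y'"
      using awalk_lift_from[OF r(1), of q' y'] *(4) r(2) by auto
    let ?\<sigma> = "lc_comp (pmon q) (lc_comp r (pmon p))"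
    have "?\<sigma> \<in> I x y" by (rule multiple_in_I[OF p(1) r(3) q(1)])
    moreover have "y \<in> verts Q" using q(1) by auto
    ultimately have "?\<sigma> \<in> lc.span ?S" using q(3) by (intro lc.span_base) auto
    moreover have "lc_map f ?\<sigma> = \<sigma>'"
      by (simp add: *(1) lc_map_lc_comp p(2) q(2) r(4))
    ultimately show "\<sigma>' \<in> lc_map f ` lc.span ?S" by (intro image_eqI[where x = ?\<sigma>]) simp_all
  qed
  then have "lc.span (rel_multiples Q' R' (fst f x) y') \<subseteq> lc_map f ` lc.span ?S"
    by (intro lc.span_minimal subspace_lc_map_image lc.subspace_span)
  ultimately show ?thesis by auto
qed

text \<open>The pieces are lifted in the opposite order \<open>q'\<close>, \<open>r'\<close>,
  \<open>p'\<close>, backwards from the prescribed end.\<close>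

lemma I'_lift_to:
  assumes y: "y \<in> verts Q" and x': "x' \<in> verts Q'" and \<rho>': "\<rho>' \<in> I' x' (fst f y)"
  shows "\<exists>\<rho> \<in> lc.span (\<Union>x\<in>{x \<in> verts Q. fst f x = x'}. I x y). lc_map f \<rho> = \<rho>'"
proof -
  let ?S = "\<Union>x\<in>{x \<in> verts Q. fst f x = x'}. I x y"
  have "\<rho>' \<in> lc.span (rel_multiples Q' R' x' (fst f y))"
    using \<rho>' I'_span[OF x' vert_map[OF y]] by simp
  moreover have "rel_multiples Q' R' x' (fst f y) \<subseteq> lc_map f ` lc.span ?S"
  proof
    fix \<sigma>' assume "\<sigma>' \<in> rel_multiples Q' R' x' (fst f y)"
    then obtain p' a' r' c' q' where *: "\<sigma>' = lc_comp (pmon q') (lc_comp r' (pmon p'))"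
      "Q'.awalk x' p' a'" "r' \<in> R' a' c'" "Q'.awalk c' q' (fst f y)"
      unfolding rel_multiples_def by auto
    obtain q c where q: "Q.awalk c q y" "map (snd f) q = q'" "fst f c = c'"
      using awalk_lift_to[OF y *(4)] by auto
    have "c \<in> verts Q" using q(1) by auto
    then obtain a r where r: "a \<in> verts Q" "fst f a = a'" "r \<in> I a c" "lc_map f r = r'"
      using gens_to[of c r' a'] *(3) q(3) by auto
    obtain p x where p: "Q.awalk x p a" "map (snd f) p = p'" "fst f x = x'"
      using awalk_lift_to[OF r(1), of x' p'] *(2) r(2) by auto
    let ?\<sigma> = "lc_comp (pmon q) (lc_comp r (pmon p))"
    have "?\<sigma> \<in> I x y" by (rule multiple_in_I[OF p(1) r(3) q(1)])
    moreover have "x \<in> verts Q" using p(1) by auto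
    ultimately have "?\<sigma> \<in> lc.span ?S" using p(3) by (intro lc.span_base) auto
    moreover have "lc_map f ?\<sigma> = \<sigma>'"
      by (simp add: *(1) lc_map_lc_comp p(2) q(2) r(4))
    ultimately show "\<sigma>' \<in> lc_map f ` lc.span ?S" by (intro image_eqI[where x = ?\<sigma>]) simp_all
  qed
  then have "lc.span (rel_multiples Q' R' x' (fst f y)) \<subseteq> lc_map f ` lc.span ?S"
    by (intro lc.span_minimal subspace_lc_map_image lc.subspace_span)
  ultimately show ?thesis by auto
qed

lemma I_supp:
  assumes "x \<in> verts Q" "y \<in> verts Q" "\<rho> \<in> I x y"
  shows "supp \<rho> \<subseteq> {p. Q.awalk x p y}"
  using subsetD[OF is_idealD(1)[OF ideal assms(1,2)] assms(3)] by (simp add: paths_lc_def)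

lemma graded_lift_from:
  assumes x: "x \<in> verts Q" and y': "y' \<in> verts Q'"
  shows "graded_lift f {y \<in> verts Q. fst f y = y'} (\<lambda>y. {p. Q.awalk x p y}) (I x)
    (I' (fst f x) y')"
proof
  show "inj_on (map (snd f)) (\<Union>y\<in>{y \<in> verts Q. fst f y = y'}. {p. Q.awalk x p y})"
    by (rule inj_onI) (auto dest: awalk_unique_from)
  show "lc.subspace (I' (fst f x) y')" by (rule is_idealD(2)[OF ideal' vert_map[OF x] y'])
qed (use x y' I'_lift_from[OF x y'] in
  \<open>auto dest: awalk_end_unique subsetD[OF I_supp] map_I[OF x] is_idealD(2)[OF ideal x]\<close>)

lemma graded_lift_to:
  assumes y: "y \<in> verts Q" and x': "x' \<in> verts Q'"
  shows "graded_lift f {x \<in> verts Q. fst f x = x'} (\<lambda>x. {p. Q.awalk x p y}) (\<lambda>x. I x y)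
    (I' x' (fst f y))"
proof
  show "inj_on (map (snd f)) (\<Union>x\<in>{x \<in> verts Q. fst f x = x'}. {p. Q.awalk x p y})"
    by (rule inj_onI) (auto dest: awalk_unique_to)
  show "lc.subspace (I' x' (fst f y))" by (rule is_idealD(2)[OF ideal' x' vert_map[OF y]])
qed (use y x' I'_lift_to[OF y x'] in
  \<open>auto dest: awalk_start_unique subsetD[OF I_supp] map_I[OF _ y] is_idealD(2)[OF ideal _ y]\<close>)

text \<open>The paths out of \<open>x\<close> form the graded family. This reflection of relations
  later shows that deck transformations preserve \<open>I\<close>.\<close>

lemma lc_map_in_I'_iff:
  assumes "x \<in> verts Q" "y \<in> verts Q" "\<rho> \<in> paths_lc Q x y"
  shows "lc_map f \<rho> \<in> I' (fst f x) (fst f y) \<longleftrightarrow> \<rho> \<in> I x y"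
  using assms
  by (intro graded_lift.lc_map_in_I'[OF graded_lift_from[OF assms(1) vert_map[OF assms(2)]]])
    (auto simp: paths_lc_def)

lemma rquiver_morphism: "rquiver_morphism (Q, I) (Q', I') f"
  using rquiver rquiver' morphism map_I by (auto simp: rquiver_morphism_def)

lemma rquiver_covering: "rquiver_covering (Q, I) (Q', I') f"
proof -
  \<comment> \<open>Minimal and zero relations enter only through this common property; for a single
    path the condition on \<open>K\<close> is vacuous.\<close>
  have parts: "\<rho>' \<in> I' a' b' \<and> \<rho>' \<noteq> 0 \<and> (\<forall>K. K \<noteq> {} \<longrightarrow> K \<subset> supp \<rho>' \<longrightarrow> lc_part K \<rho>' \<notin> I' a' b')"
    if "minimal_relation (Q', I') a' b' \<rho>' \<or> zero_relation (Q', I') a' b' \<rho>'" for a' b' \<rho>'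
    using that
  proof
    assume "minimal_relation (Q', I') a' b' \<rho>'"
    then show ?thesis
      by (auto simp: minimal_relation_def lc_part_subset psubset_imp_subset)
  next
    assume "zero_relation (Q', I') a' b' \<rho>'"
    then obtain u where u: "\<rho>' \<in> I' a' b'" "\<rho>' = pmon u" by (auto simp: zero_relation_def)
    have supp: "supp \<rho>' = {u}" unfolding u(2) by (simp only: keys_single) simp
    have "\<rho>' \<noteq> 0" using supp by force
    show ?thesis
    proof (intro conjI allI impI)
      fix K assume "K \<noteq> {}" "K \<subset> supp \<rho>'"
      then have False unfolding supp psubset_eq subset_singleton_iff by simp
      then show "lc_part K \<rho>' \<notin> I' a' b'" ..
    qed fact+
  qed
  show ?thesis
    unfolding rquiver_covering_def
  proof (intro conjI ballI allI impI)
    fix a' b' \<rho>' a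
    assume *: "a' \<in> verts (fst (Q', I'))" "b' \<in> verts (fst (Q', I'))"
      "minimal_relation (Q', I') a' b' \<rho>' \<or> zero_relation (Q', I') a' b' \<rho>'"
      "a \<in> verts (fst (Q, I))" "fst f a = a'"
    then have "\<exists>b\<in>{y \<in> verts Q. fst f y = b'}. \<exists>\<rho>\<in>I a b. lc_map f \<rho> = \<rho>'"
      using parts[OF *(3)]
      by (intro graded_lift.lift_minimal[OF graded_lift_from[of a b']]) auto
    then show "\<exists>b\<in>verts (fst (Q, I)). fst f b = b' \<and> (\<exists>\<rho>\<in>snd (Q, I) a b. lc_map f \<rho> = \<rho>')"
      by auto
  next
    fix a' b' \<rho>' b
    assume *: "a' \<in> verts (fst (Q', I'))" "b' \<in> verts (fst (Q', I'))"
      "minimal_relation (Q', I') a' b' \<rho>' \<or> zero_relation (Q', I') a' b' \<rho>'"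
      "b \<in> verts (fst (Q, I))" "fst f b = b'"
    then have "\<exists>a\<in>{x \<in> verts Q. fst f x = a'}. \<exists>\<rho>\<in>I a b. lc_map f \<rho> = \<rho>'"
      using parts[OF *(3)]
      by (intro graded_lift.lift_minimal[OF graded_lift_to[of b a']]) auto
    then show "\<exists>a\<in>verts (fst (Q, I)). fst f a = a' \<and> (\<exists>\<rho>\<in>snd (Q, I) a b. lc_map f \<rho> = \<rho>')"
      by auto
  qed (use rquiver_morphism covering in auto)
qed

end

section \<open>The category of a quiver with relations\<close>

lemma coset_mem_iff: "\<sigma> \<in> \<rho> +o S \<longleftrightarrow> \<sigma> - \<rho> \<in> S"
  for \<sigma> :: "('a, 'k::field) path_lc"
proof
  assume "\<sigma> \<in> \<rho> +o S"
  then show "\<sigma> - \<rho> \<in> S" by (auto simp: elt_set_plus_def)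
next
  assume "\<sigma> - \<rho> \<in> S"
  then have "\<rho> + (\<sigma> - \<rho>) \<in> \<rho> +o S" by (rule set_plus_intro2)
  then show "\<sigma> \<in> \<rho> +o S" by simp
qed

lemma coset_eq_iff:
  assumes "lc.subspace S"
  shows "\<rho> +o S = \<sigma> +o S \<longleftrightarrow> \<rho> - \<sigma> \<in> S"
proof
  assume *: "\<rho> +o S = \<sigma> +o S"
  have "\<rho> \<in> \<rho> +o S" by (simp add: coset_mem_iff lc.subspace_0[OF assms])
  then show "\<rho> - \<sigma> \<in> S" by (simp only: * coset_mem_iff)
next
  assume *: "\<rho> - \<sigma> \<in> S"
  show "\<rho> +o S = \<sigma> +o S"
  proof (rule Set.set_eqI)
    fix \<tau>
    have "\<tau> - \<sigma> = (\<tau> - \<rho>) + (\<rho> - \<sigma>)" "\<tau> - \<rho> = (\<tau> - \<sigma>) - (\<rho> - \<sigma>)" by simp_all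
    then show "\<tau> \<in> \<rho> +o S \<longleftrightarrow> \<tau> \<in> \<sigma> +o S"
      unfolding coset_mem_iff
      using lc.subspace_add[OF assms _ *] lc.subspace_diff[OF assms _ *] by metis
  qed
qed

lemma coset_self: "lc.subspace S \<Longrightarrow> \<rho> \<in> \<rho> +o S"
  by (simp add: coset_mem_iff lc.subspace_0)

lemma coset_zero [simp]: "0 +o S = S"
  for S :: "('a, 'k::field) path_lc set"
  by (auto simp: elt_set_plus_def)

lemma coset_eq_self_iff: "lc.subspace S \<Longrightarrow> \<rho> +o S = S \<longleftrightarrow> \<rho> \<in> S"
  using coset_eq_iff[of S \<rho> 0] by simp

text \<open>The operations of \<open>rquiver_cat\<close> are unions over representatives. If
  changing the representative by \<open>S\<close> changes the value by \<open>T\<close>, all members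
  coincide, and \<rho> itself shows that there is one.\<close>

lemma UN_coset:
  assumes "lc.subspace S" "lc.subspace T" "\<And>\<sigma>. \<sigma> - \<rho> \<in> S \<Longrightarrow> g \<sigma> - g \<rho> \<in> T"
  shows "(\<Union>\<sigma>\<in>\<rho> +o S. g \<sigma> +o T) = g \<rho> +o T"
proof -
  have "g \<sigma> +o T = g \<rho> +o T" if "\<sigma> \<in> \<rho> +o S" for \<sigma>
    using that assms(2,3) by (simp add: coset_mem_iff coset_eq_iff)
  then show ?thesis using coset_self[OF assms(1)] by blast
qed

locale rquiver =
  fixes Q :: "('v, 'a) pre_digraph" and I :: "('v, 'a, 'k::field) path_rels"
  assumes is_rquiver: "is_rquiver (Q, I)"
begin

sublocale wf_digraph Q
  using is_rquiver by (simp add: is_rquiver_iff)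

lemma wf: "wf_digraph Q" ..

lemma ideal: "is_ideal Q I"
  using is_rquiver by (simp add: is_rquiver_iff)

lemmas I_paths = is_idealD(1)[OF ideal, THEN subsetD]
lemmas I_subspace = is_idealD(2)[OF ideal]

lemma coef_Nil: "\<lbrakk>x \<in> verts Q; y \<in> verts Q; \<rho> \<in> I x y\<rbrakk> \<Longrightarrow> coef \<rho> [] = 0"
  using is_rquiver by (simp add: is_rquiver_iff)

abbreviation "M \<equiv> rquiver_cat (Q, I)"

lemma Ob_M [simp]: "Ob M = verts Q"
  by (simp add: rquiver_cat_def)

lemma carrier_Hom: "carrier (Hom M x y) = (\<lambda>\<rho>. \<rho> +o I x y) ` paths_lc Q x y"
  by (simp add: rquiver_cat_def)

lemma zero_Hom [simp]: "\<zero>\<^bsub>Hom M x y\<^esub> = I x y"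
  by (simp add: rquiver_cat_def)

lemma Idn_M: "Idn M x = pmon [] +o I x x"
  by (simp add: rquiver_cat_def)

lemma coset_in_Hom: "\<rho> \<in> paths_lc Q x y \<Longrightarrow> \<rho> +o I x y \<in> carrier (Hom M x y)"
  by (simp add: carrier_Hom)

lemma HomE:
  assumes "A \<in> carrier (Hom M x y)"
  obtains \<rho> where "\<rho> \<in> paths_lc Q x y" "A = \<rho> +o I x y"
  using assms by (auto simp: carrier_Hom)

lemma add_Hom:
  assumes "x \<in> verts Q" "y \<in> verts Q"
  shows "(\<rho> +o I x y) \<oplus>\<^bsub>Hom M x y\<^esub> (\<sigma> +o I x y) = (\<rho> + \<sigma>) +o I x y"
proof -
  note S = I_subspace[OF assms]
  have "(\<Union>\<sigma>'\<in>\<sigma> +o I x y. (\<rho>' + \<sigma>') +o I x y) = (\<rho>' + \<sigma>) +o I x y" for \<rho>'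
    by (rule UN_coset[OF S S]) simp
  moreover have "(\<Union>\<rho>'\<in>\<rho> +o I x y. (\<rho>' + \<sigma>) +o I x y) = (\<rho> + \<sigma>) +o I x y"
    by (rule UN_coset[OF S S]) simp
  ultimately show ?thesis by (simp add: rquiver_cat_def)
qed

lemma smult_Hom:
  assumes "x \<in> verts Q" "y \<in> verts Q"
  shows "c \<odot>\<^bsub>Hom M x y\<^esub> (\<rho> +o I x y) = lc_scale c \<rho> +o I x y"
proof -
  note S = I_subspace[OF assms]
  have "(\<Union>\<rho>'\<in>\<rho> +o I x y. lc_scale c \<rho>' +o I x y) = lc_scale c \<rho> +o I x y"
    by (rule UN_coset[OF S S])
      (simp add: lc.scale_right_diff_distrib[symmetric] lc.subspace_scale[OF S])
  then show ?thesis by (simp add: rquiver_cat_def)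
qed

lemma Cmp_M:
  assumes "x \<in> verts Q" "y \<in> verts Q" "z \<in> verts Q"
    and "\<rho> \<in> paths_lc Q x y" "\<sigma> \<in> paths_lc Q y z"
  shows "Cmp M x y z (\<sigma> +o I y z) (\<rho> +o I x y) = lc_comp \<sigma> \<rho> +o I x z"
proof -
  have "(\<Union>\<sigma>'\<in>\<sigma> +o I y z. lc_comp \<sigma>' \<rho>' +o I x z) = lc_comp \<sigma> \<rho>' +o I x z"
    if "\<rho>' \<in> paths_lc Q x y" for \<rho>'
    by (rule UN_coset) (use assms that in
      \<open>auto simp: I_subspace lc_comp_diff_left[symmetric] intro: is_ideal_comp(2)[OF ideal]\<close>)
  \<comment> \<open>Every representative is a combination of paths from \<open>x\<close> to
    \<open>y\<close> because the ideal consists of such; only then can it be multiplied into the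
    ideal.\<close>
  moreover have "\<rho>' \<in> paths_lc Q x y" if "\<rho>' \<in> \<rho> +o I x y" for \<rho>'
  proof -
    have "\<rho>' - \<rho> \<in> paths_lc Q x y"
      using that by (intro I_paths[OF assms(1,2)]) (simp add: coset_mem_iff)
    then have "\<rho> + (\<rho>' - \<rho>) \<in> paths_lc Q x y"
      by (intro lc.subspace_add[OF subspace_paths_lc] assms(4))
    then show ?thesis by simp
  qed
  moreover have "(\<Union>\<rho>'\<in>\<rho> +o I x y. lc_comp \<sigma> \<rho>' +o I x z) = lc_comp \<sigma> \<rho> +o I x z"
    by (rule UN_coset) (use assms in
      \<open>auto simp: I_subspace lc_comp_diff_right[symmetric] intro: is_ideal_comp(1)[OF ideal]\<close>)
  ultimately show ?thesis by (simp add: rquiver_cat_def)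
qed

lemma paths_lc_add: "\<rho> \<in> paths_lc Q x y \<Longrightarrow> \<sigma> \<in> paths_lc Q x y \<Longrightarrow> \<rho> + \<sigma> \<in> paths_lc Q x y"
  and paths_lc_scale: "\<rho> \<in> paths_lc Q x y \<Longrightarrow> lc_scale c \<rho> \<in> paths_lc Q x y"
  and paths_lc_diff: "\<rho> \<in> paths_lc Q x y \<Longrightarrow> \<sigma> \<in> paths_lc Q x y \<Longrightarrow> \<rho> - \<sigma> \<in> paths_lc Q x y"
  and paths_lc_zero: "0 \<in> paths_lc Q x y"
  using subspace_paths_lc[of Q x y]
  by (auto intro: lc.subspace_add lc.subspace_scale lc.subspace_0 lc.subspace_diff)

lemma paths_lc_sum: "(\<And>z. z \<in> Z \<Longrightarrow> m z \<in> paths_lc Q x y) \<Longrightarrow> sum m Z \<in> paths_lc Q x y"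
  by (rule lc.subspace_sum[OF subspace_paths_lc])

lemma abelian_group_Hom:
  assumes v: "x \<in> verts Q" "y \<in> verts Q"
  shows "abelian_group (Hom M x y)"
proof (rule abelian_groupI)
  show "\<zero>\<^bsub>Hom M x y\<^esub> \<in> carrier (Hom M x y)"
    using coset_in_Hom[OF paths_lc_zero] by simp
next
  fix A assume "A \<in> carrier (Hom M x y)"
  then obtain \<rho> where \<rho>: "\<rho> \<in> paths_lc Q x y" "A = \<rho> +o I x y" by (rule HomE)
  show "\<zero>\<^bsub>Hom M x y\<^esub> \<oplus>\<^bsub>Hom M x y\<^esub> A = A"
    using add_Hom[OF v, of 0 \<rho>] by (simp add: \<rho>(2))
  have "lc_scale (-1) \<rho> +o I x y \<in> carrier (Hom M x y)"
    using \<rho>(1) by (intro coset_in_Hom paths_lc_scale)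
  moreover have "(lc_scale (-1) \<rho> +o I x y) \<oplus>\<^bsub>Hom M x y\<^esub> A = \<zero>\<^bsub>Hom M x y\<^esub>"
    by (simp add: \<rho>(2) add_Hom[OF v])
  ultimately show "\<exists>B\<in>carrier (Hom M x y). B \<oplus>\<^bsub>Hom M x y\<^esub> A = \<zero>\<^bsub>Hom M x y\<^esub>" by blast
qed (auto elim!: HomE simp: add_Hom[OF v] ac_simps intro!: coset_in_Hom paths_lc_add)

lemma module_Hom:
  assumes v: "x \<in> verts Q" "y \<in> verts Q"
  shows "Module.module ring_of_type_algebra (Hom M x y)"
proof (rule moduleI)
  show "abelian_group (Hom M x y)" by (rule abelian_group_Hom[OF v])
qed (auto simp: cring_from_type_algebra ring_of_type_algebra_def add_Hom[OF v] smult_Hom[OF v]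
    lc.scale_left_distrib lc.scale_right_distrib elim!: HomE intro!: coset_in_Hom paths_lc_scale
    cring_from_type_algebra[unfolded ring_of_type_algebra_def])

lemma kcategory: "kcategory M"
proof (rule kcategory.intro)
  fix x y z and u v :: "('a, 'k) path_lc set" and c
  assume o: "x \<in> Ob M" "y \<in> Ob M" "z \<in> Ob M"
    and u: "u \<in> carrier (Hom M x y)" and v: "v \<in> carrier (Hom M y z)"
  obtain \<rho> \<sigma> where *: "\<rho> \<in> paths_lc Q x y" "u = \<rho> +o I x y" "\<sigma> \<in> paths_lc Q y z" "v = \<sigma> +o I y z"
    using u v by (metis HomE)
  show "Cmp M x y z v u \<in> carrier (Hom M x z)"
    using o * by (auto simp: Cmp_M intro!: coset_in_Hom lc_comp_paths_lc[OF wf])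
  show "Cmp M x y z v (c \<odot>\<^bsub>Hom M x y\<^esub> u) = c \<odot>\<^bsub>Hom M x z\<^esub> Cmp M x y z v u"
    using o * by (simp add: Cmp_M smult_Hom paths_lc_scale lc_comp_scale_right)
  show "Cmp M x y z (c \<odot>\<^bsub>Hom M y z\<^esub> v) u = c \<odot>\<^bsub>Hom M x z\<^esub> Cmp M x y z v u"
    using o * by (simp add: Cmp_M smult_Hom paths_lc_scale lc_comp_scale_left)
  fix u' assume "u' \<in> carrier (Hom M x y)"
  then obtain \<rho>' where "\<rho>' \<in> paths_lc Q x y" "u' = \<rho>' +o I x y" by (rule HomE)
  then show "Cmp M x y z v (u \<oplus>\<^bsub>Hom M x y\<^esub> u') = Cmp M x y z v u \<oplus>\<^bsub>Hom M x z\<^esub> Cmp M x y z v u'"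
    using o * by (simp add: Cmp_M add_Hom paths_lc_add lc_comp_add_right)
next
  fix x y z and u v v' :: "('a, 'k) path_lc set"
  assume o: "x \<in> Ob M" "y \<in> Ob M" "z \<in> Ob M"
    and u: "u \<in> carrier (Hom M x y)" and v: "v \<in> carrier (Hom M y z)" "v' \<in> carrier (Hom M y z)"
  obtain \<rho> where \<rho>: "\<rho> \<in> paths_lc Q x y" "u = \<rho> +o I x y" using u by (rule HomE)
  obtain \<sigma> where \<sigma>: "\<sigma> \<in> paths_lc Q y z" "v = \<sigma> +o I y z" using v(1) by (rule HomE)
  obtain \<sigma>' where \<sigma>': "\<sigma>' \<in> paths_lc Q y z" "v' = \<sigma>' +o I y z" using v(2) by (rule HomE)
  show "Cmp M x y z (v \<oplus>\<^bsub>Hom M y z\<^esub> v') u = Cmp M x y z v u \<oplus>\<^bsub>Hom M x z\<^esub> Cmp M x y z v' u"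
    using o \<rho> \<sigma> \<sigma>' by (simp add: Cmp_M add_Hom paths_lc_add lc_comp_add_left)
next
  fix x y and u :: "('a, 'k) path_lc set"
  assume o: "x \<in> Ob M" "y \<in> Ob M" and u: "u \<in> carrier (Hom M x y)"
  obtain \<rho> where \<rho>: "\<rho> \<in> paths_lc Q x y" "u = \<rho> +o I x y" using u by (rule HomE)
  show "Cmp M x x y u (Idn M x) = u" "Cmp M x y y (Idn M y) u = u"
    using o \<rho> by (simp_all add: Idn_M Cmp_M awalk_Nil_iff)
next
  fix w x y z and t u v :: "('a, 'k) path_lc set"
  assume o: "w \<in> Ob M" "x \<in> Ob M" "y \<in> Ob M" "z \<in> Ob M"
    and tuv: "t \<in> carrier (Hom M w x)" "u \<in> carrier (Hom M x y)" "v \<in> carrier (Hom M y z)"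
  obtain \<rho> where \<rho>: "\<rho> \<in> paths_lc Q w x" "t = \<rho> +o I w x" using tuv(1) by (rule HomE)
  obtain \<sigma> where \<sigma>: "\<sigma> \<in> paths_lc Q x y" "u = \<sigma> +o I x y" using tuv(2) by (rule HomE)
  obtain \<tau> where \<tau>: "\<tau> \<in> paths_lc Q y z" "v = \<tau> +o I y z" using tuv(3) by (rule HomE)
  show "Cmp M w y z v (Cmp M w x y u t) = Cmp M w x z (Cmp M x y z v u) t"
    using o \<rho> \<sigma> \<tau> by (simp add: Cmp_M lc_comp_paths_lc[OF wf] lc_comp_assoc)
qed (auto simp: module_Hom Idn_M awalk_Nil_iff intro!: coset_in_Hom)

lemma finsum_Hom:
  assumes v: "x \<in> verts Q" "y \<in> verts Q"
    and "finite Z" "\<And>z. z \<in> Z \<Longrightarrow> m z \<in> paths_lc Q x y"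
  shows "finsum (Hom M x y) (\<lambda>z. m z +o I x y) Z = sum m Z +o I x y"
proof -
  interpret abelian_group "Hom M x y" by (rule abelian_group_Hom[OF v])
  show ?thesis using assms(3,4)
  proof (induction Z rule: finite_induct)
    case empty
    then show ?case by (simp only: finsum_empty zero_Hom sum.empty coset_zero)
  next
    case (insert z Z)
    then have "finsum (Hom M x y) (\<lambda>z. m z +o I x y) (insert z Z) =
        (m z +o I x y) \<oplus>\<^bsub>Hom M x y\<^esub> finsum (Hom M x y) (\<lambda>z. m z +o I x y) Z"
      by (intro finsum_insert) (auto intro!: coset_in_Hom)
    then show ?case using insert by (simp add: add_Hom[OF v])
  qed
qed

end

lemma FHom_rquiver_functor:
  assumes "rquiver_morphism (Q, I) (Q', I') f" "x \<in> verts Q" "y \<in> verts Q"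
  shows "FHom (rquiver_functor (Q', I') f) x y (\<rho> +o I x y)
    = lc_map f \<rho> +o I' (fst f x) (fst f y)"
proof -
  have "rquiver Q I" "rquiver Q' I'" "fst f x \<in> verts Q'" "fst f y \<in> verts Q'"
    and map: "lc_map f ` I x y \<subseteq> I' (fst f x) (fst f y)"
    using assms by (auto simp: rquiver_morphism_def rquiver_def quiver_morphism_def)
  then have S: "lc.subspace (I x y)" "lc.subspace (I' (fst f x) (fst f y))"
    using assms(2,3) rquiver.I_subspace by auto
  show ?thesis
    unfolding rquiver_functor_def kfun.simps snd_conv
    by (rule UN_coset[OF S]) (use map in \<open>auto simp: lc_map_diff[symmetric]\<close>)
qed

lemma kfunctor_rquiver_functor:
  assumes f: "rquiver_morphism (Q, I) (Q', I') f"
  shows "kfunctor (rquiver_cat (Q, I)) (rquiver_cat (Q', I')) (rquiver_functor (Q', I') f)"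
proof -
  interpret R: rquiver Q I using f by unfold_locales (simp add: rquiver_morphism_def)
  interpret R': rquiver Q' I' using f by unfold_locales (simp add: rquiver_morphism_def)
  have qm: "quiver_morphism Q Q' f" using f by (simp add: rquiver_morphism_def)
  have vf: "fst f x \<in> verts Q'" if "x \<in> verts Q" for x
    using qm that by (simp add: quiver_morphism_def)
  note F = FHom_rquiver_functor[OF f]
  note pf = lc_map_paths_lc[OF R.wf qm]
  have FO: "FOb (rquiver_functor (Q', I') f) = fst f" by (simp add: rquiver_functor_def)
  show ?thesis
    unfolding kfunctor_def FO R.Ob_M R'.Ob_M
  proof (intro conjI ballI allI)
    fix x y u assume v: "x \<in> verts Q" "y \<in> verts Q" and "u \<in> carrier (Hom R.M x y)"
    from this(3) obtain \<rho> where \<rho>: "\<rho> \<in> paths_lc Q x y" "u = \<rho> +o I x y" by (rule R.HomE)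
    let ?F = "FHom (rquiver_functor (Q', I') f)"
    show "?F x y u \<in> carrier (Hom R'.M (fst f x) (fst f y))"
      unfolding \<rho>(2) F[OF v] by (intro R'.coset_in_Hom pf \<rho>(1))
    show "?F x y (c \<odot>\<^bsub>Hom R.M x y\<^esub> u) = c \<odot>\<^bsub>Hom R'.M (fst f x) (fst f y)\<^esub> ?F x y u" for c
      using v vf by (simp add: \<rho>(2) F R.smult_Hom R'.smult_Hom lc_map_scale)
    show "?F x y (u \<oplus>\<^bsub>Hom R.M x y\<^esub> u') =
        ?F x y u \<oplus>\<^bsub>Hom R'.M (fst f x) (fst f y)\<^esub> ?F x y u'"
      if u': "u' \<in> carrier (Hom R.M x y)" for u'
    proof -
      obtain \<rho>' where "u' = \<rho>' +o I x y" using u' by (rule R.HomE)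
      then show ?thesis using v vf by (simp add: \<rho>(2) F R.add_Hom R'.add_Hom lc_map_add)
    qed
    show "?F x z (Cmp R.M x y z w u) =
        Cmp R'.M (fst f x) (fst f y) (fst f z) (?F y z w) (?F x y u)"
      if z: "z \<in> verts Q" and w: "w \<in> carrier (Hom R.M y z)" for z w
    proof -
      obtain \<sigma> where "\<sigma> \<in> paths_lc Q y z" "w = \<sigma> +o I y z" using w by (rule R.HomE)
      then show ?thesis
        using v z \<rho> vf by (simp add: F R.Cmp_M R'.Cmp_M pf lc_map_lc_comp)
    qed
  qed (auto simp: R.kcategory R'.kcategory R.Idn_M R'.Idn_M F vf)
qed

subsection \<open>The covering functor\<close>

text \<open>Abstract summands \<open>H b\<close> and an abstract target \<open>H'\<close> let one
  proof serve both halves of the definition of a covering functor. Injectivity rests on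
  \<open>sum_lc_map_in_I'\<close>, surjectivity on \<open>lift_lc\<close>.\<close>

lemma (in graded_lift) bij_betw_dsum:
  assumes H: "\<And>b. b \<in> B \<Longrightarrow> \<zero>\<^bsub>H b\<^esub> = I b"
      "\<And>b. b \<in> B \<Longrightarrow> carrier (H b) = (\<lambda>\<rho>. \<rho> +o I b) ` {\<rho>. supp \<rho> \<subseteq> P b}"
    and H': "abelian_group H'"
      "carrier H' = (\<lambda>\<rho>. \<rho> +o I') ` {\<rho>. supp \<rho> \<subseteq> map (snd f) ` (\<Union>b\<in>B. P b)}"
    and sum: "\<And>(Z :: 'c set) m. finite Z \<Longrightarrow>
      (\<And>z. z \<in> Z \<Longrightarrow> supp (m z) \<subseteq> map (snd f) ` (\<Union>b\<in>B. P b)) \<Longrightarrow>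
      finsum H' (\<lambda>z. m z +o I') Z = sum m Z +o I'"
    and F: "\<And>b \<rho>. b \<in> B \<Longrightarrow> F b (\<rho> +o I b) = lc_map f \<rho> +o I'"
  shows "bij_betw (\<lambda>m. finsum H' (\<lambda>b. F b (m b)) {b \<in> B. m b \<noteq> \<zero>\<^bsub>H b\<^esub>}) (dsum B H) (carrier H')"
proof -
  interpret H': abelian_group H' by fact
  let ?\<Phi> = "\<lambda>m. finsum H' (\<lambda>b. F b (m b)) {b \<in> B. m b \<noteq> \<zero>\<^bsub>H b\<^esub>}"
  let ?supp = "\<lambda>m. {b \<in> B. m b \<noteq> I b}"
  have supp_eq: "{b \<in> B. m b \<noteq> \<zero>\<^bsub>H b\<^esub>} = ?supp m" for m using H(1) by auto
  have supp_map: "supp (lc_map f \<rho>) \<subseteq> map (snd f) ` (\<Union>b\<in>B. P b)" if "b \<in> B" "supp \<rho> \<subseteq> P b" for b \<rho>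
    using supp_lc_map[of f \<rho>] that by blast
  \<comment> \<open>Evaluated over any finite \<open>Z\<close> containing the support, so that two
    families can be compared over a common index set.\<close>
  have \<Phi>: "?\<Phi> m = (\<Sum>b\<in>Z. lc_map f (r b)) +o I'"
    if Z: "finite Z" "?supp m \<subseteq> Z" "Z \<subseteq> B"
      and r: "\<And>b. b \<in> Z \<Longrightarrow> supp (r b) \<subseteq> P b" "\<And>b. b \<in> Z \<Longrightarrow> m b = r b +o I b" for m r Z
  proof -
    have fin: "finite (?supp m)" using Z finite_subset by blast
    have "?\<Phi> m = finsum H' (\<lambda>b. lc_map f (r b) +o I') (?supp m)"
      unfolding supp_eq
    proof (rule H'.finsum_cong')
      show "(\<lambda>b. lc_map f (r b) +o I') \<in> ?supp m \<rightarrow> carrier H'"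
      proof (rule Pi_I)
        fix b assume "b \<in> ?supp m"
        then have "supp (lc_map f (r b)) \<subseteq> map (snd f) ` (\<Union>b\<in>B. P b)"
          using Z r(1) by (intro supp_map) auto
        then show "lc_map f (r b) +o I' \<in> carrier H'"
          unfolding H'(2) by (intro image_eqI[OF refl]) simp
      qed
      show "F b (m b) = lc_map f (r b) +o I'" if "b \<in> ?supp m" for b
        using that Z r(2)[of b] F by auto
    qed simp
    also have "\<dots> = (\<Sum>b\<in>?supp m. lc_map f (r b)) +o I'"
    proof (rule sum[OF fin])
      show "supp (lc_map f (r b)) \<subseteq> map (snd f) ` (\<Union>b\<in>B. P b)" if "b \<in> ?supp m" for b
        using that Z r(1) by (intro supp_map) auto
    qed
    also have "\<dots> = (\<Sum>b\<in>Z. lc_map f (r b)) +o I'"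
    proof -
      \<comment> \<open>Outside the support the coset is the zero one, so its representative lies in
        \<open>I b\<close> and contributes only an element of \<open>I'\<close>.\<close>
      have "(\<Sum>b\<in>Z - ?supp m. lc_map f (r b)) \<in> I'"
      proof (rule lc.subspace_sum[OF I'_subspace])
        fix b assume b: "b \<in> Z - ?supp m"
        then have "r b \<in> I b" using r(2)[of b] Z(3) coset_eq_self_iff[OF I_subspace, of b "r b"] by auto
        then show "lc_map f (r b) \<in> I'" using I_map b Z(3) by blast
      qed
      moreover have "(\<Sum>b\<in>Z. lc_map f (r b)) =
          (\<Sum>b\<in>Z - ?supp m. lc_map f (r b)) + (\<Sum>b\<in>?supp m. lc_map f (r b))"
        by (rule sum.subset_diff[OF Z(2,1)])
      ultimately show ?thesis
        using lc.subspace_neg[OF I'_subspace] by (subst coset_eq_iff[OF I'_subspace]) auto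
    qed
    finally show ?thesis .
  qed
  have reps: "\<exists>r. \<forall>b\<in>B. supp (r b) \<subseteq> P b \<and> m b = r b +o I b" if "m \<in> dsum B H" for m
  proof -
    have "\<forall>b\<in>B. \<exists>\<rho>. supp \<rho> \<subseteq> P b \<and> m b = \<rho> +o I b"
    proof
      fix b assume b: "b \<in> B"
      then have "m b \<in> carrier (H b)" using that by (auto simp: dsum_def)
      then show "\<exists>\<rho>. supp \<rho> \<subseteq> P b \<and> m b = \<rho> +o I b" unfolding H(2)[OF b] by auto
    qed
    then show ?thesis by (rule bchoice)
  qed
  have fin: "finite (?supp m)" if "m \<in> dsum B H" for m
    using that H(1) by (auto simp: dsum_def cong: conj_cong)
  show ?thesis
  proof (rule bij_betwI')
    fix m n assume mn: "m \<in> dsum B H" "n \<in> dsum B H"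
    obtain r where r: "\<forall>b\<in>B. supp (r b) \<subseteq> P b \<and> m b = r b +o I b"
      by (rule exE[OF reps[OF mn(1)]])
    obtain s where s: "\<forall>b\<in>B. supp (s b) \<subseteq> P b \<and> n b = s b +o I b"
      by (rule exE[OF reps[OF mn(2)]])
    \<comment> \<open>Outside \<open>?Z\<close> both families have the zero value
      \<open>I b\<close>, so only indices in \<open>?Z\<close> need an argument.\<close>
    let ?Z = "?supp m \<union> ?supp n"
    have Z: "finite ?Z" "?Z \<subseteq> B" using fin mn by auto
    have inj: "m = n" if eq: "?\<Phi> m = ?\<Phi> n"
    proof (rule PiE_ext)
      show "m \<in> (\<Pi>\<^sub>E b\<in>B. carrier (H b))" "n \<in> (\<Pi>\<^sub>E b\<in>B. carrier (H b))"
        using mn unfolding dsum_def by simp_all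
      fix b assume b: "b \<in> B"
      show "m b = n b"
      proof (cases "b \<in> ?Z")
        case True
        have "?\<Phi> m = (\<Sum>b\<in>?Z. lc_map f (r b)) +o I'"
          by (rule \<Phi>[OF Z(1) _ Z(2)]) (use Z(2) r in auto)
        moreover have "?\<Phi> n = (\<Sum>b\<in>?Z. lc_map f (s b)) +o I'"
          by (rule \<Phi>[OF Z(1) _ Z(2)]) (use Z(2) s in auto)
        ultimately have "(\<Sum>b\<in>?Z. lc_map f (r b)) +o I' = (\<Sum>b\<in>?Z. lc_map f (s b)) +o I'"
          using eq by (simp only:)
        then have "(\<Sum>b\<in>?Z. lc_map f (r b - s b)) \<in> I'"
          by (simp add: coset_eq_iff[OF I'_subspace] lc_map_diff sum_subtractf)
        moreover have "supp (r b - s b) \<subseteq> P b" if "b \<in> ?Z" for b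
          using r s that Z(2) lc.subspace_diff[OF subspace_supp_subset[of "P b"], of "r b" "s b"] by auto
        ultimately have "r b - s b \<in> I b"
          using sum_lc_map_in_I'[of ?Z "\<lambda>b. r b - s b" b, OF Z _ _ True] by simp
        then show ?thesis using r s b by (simp add: coset_eq_iff[OF I_subspace])
      qed (use b in auto)
    qed
    show "(?\<Phi> m = ?\<Phi> n) = (m = n)"
      by (rule iffI[OF inj]) (assumption, simp only:)
  next
    fix m assume m: "m \<in> dsum B H"
    obtain r where r: "\<forall>b\<in>B. supp (r b) \<subseteq> P b \<and> m b = r b +o I b"
      by (rule exE[OF reps[OF m]])
    have "?\<Phi> m = (\<Sum>b\<in>?supp m. lc_map f (r b)) +o I'"
      by (rule \<Phi>) (use fin[OF m] r in auto)
    moreover have "(\<Sum>b\<in>?supp m. lc_map f (r b)) \<in>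
        {\<rho>. supp \<rho> \<subseteq> map (snd f) ` (\<Union>b\<in>B. P b)}"
      by (rule lc.subspace_sum[OF subspace_supp_subset]) (use supp_map r in auto)
    ultimately show "?\<Phi> m \<in> carrier H'" unfolding H'(2) by (simp only: image_eqI)
  next
    fix A assume "A \<in> carrier H'"
    then obtain \<rho>' where \<rho>': "supp \<rho>' \<subseteq> map (snd f) ` (\<Union>b\<in>B. P b)" "A = \<rho>' +o I'"
      by (auto simp: H'(2))
    obtain Z r where Z: "finite Z" "Z \<subseteq> B" and r: "\<forall>b\<in>Z. supp (r b) \<subseteq> P b"
      and sum_eq: "\<rho>' = (\<Sum>b\<in>Z. lc_map f (r b))"
      using lift_lc[OF \<rho>'(1)] by blast
    \<comment> \<open>The default \<open>I b\<close> is the zero of the summand, which makes the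
      support finite.\<close>
    let ?m = "\<lambda>b\<in>B. if b \<in> Z then r b +o I b else I b"
    have "I b \<in> carrier (H b)" if "b \<in> B" for b
      unfolding H(2)[OF that] by (intro image_eqI[where x = 0]) auto
    moreover have "r b +o I b \<in> carrier (H b)" if "b \<in> Z" for b
      using that Z(2) r H(2)[of b] by auto
    ultimately have "?m \<in> (\<Pi>\<^sub>E b\<in>B. carrier (H b))" by simp
    moreover have supp_m: "?supp ?m \<subseteq> Z" by auto
    moreover have "{b \<in> B. ?m b \<noteq> \<zero>\<^bsub>H b\<^esub>} = ?supp ?m" by (rule supp_eq)
    ultimately have "?m \<in> dsum B H"
      unfolding dsum_def using finite_subset[OF supp_m Z(1)] by simp
    moreover have "?\<Phi> ?m = A"
      unfolding \<rho>'(2) sum_eq by (rule \<Phi>[OF Z(1) supp_m Z(2)]) (use r Z in auto)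
    ultimately show "\<exists>m\<in>dsum B H. A = ?\<Phi> m" by blast
  qed
qed

context rquiver_cover
begin

sublocale R: rquiver Q I by unfold_locales (rule rquiver)
sublocale R': rquiver Q' I' by unfold_locales (rule rquiver')

text \<open>Path lifting read as an equality of sets: it identifies the hom space of the target
  category with the one described by the graded family.\<close>

lemma paths_from: "{p'. Q'.awalk (fst f x) p' y'} =
    map (snd f) ` (\<Union>y\<in>{y \<in> verts Q. fst f y = y'}. {p. Q.awalk x p y})"
  if x: "x \<in> verts Q"
proof (intro Set.set_eqI iffI)
  fix p' assume "p' \<in> {p'. Q'.awalk (fst f x) p' y'}"
  then have "Q'.awalk (fst f x) p' y'" by simp
  from awalk_lift_from[OF x this] obtain p b
    where "Q.awalk x p b" "map (snd f) p = p'" "fst f b = y'" by auto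
  then show "p' \<in> map (snd f) ` (\<Union>y\<in>{y \<in> verts Q. fst f y = y'}. {p. Q.awalk x p y})"
    by (intro image_eqI[of _ _ p]) auto
qed (auto dest: awalk_map)

lemma paths_to: "{p'. Q'.awalk x' p' (fst f y)} =
    map (snd f) ` (\<Union>x\<in>{x \<in> verts Q. fst f x = x'}. {p. Q.awalk x p y})"
  if y: "y \<in> verts Q"
proof (intro Set.set_eqI iffI)
  fix p' assume "p' \<in> {p'. Q'.awalk x' p' (fst f y)}"
  then have "Q'.awalk x' p' (fst f y)" by simp
  from awalk_lift_to[OF y this] obtain p a
    where "Q.awalk a p y" "map (snd f) p = p'" "fst f a = x'" by auto
  then show "p' \<in> map (snd f) ` (\<Union>x\<in>{x \<in> verts Q. fst f x = x'}. {p. Q.awalk x p y})"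
    by (intro image_eqI[of _ _ p]) auto
qed (auto dest: awalk_map)

lemma covering_functor:
  "covering_functor (rquiver_cat (Q, I)) (rquiver_cat (Q', I')) (rquiver_functor (Q', I') f)"
proof -
  note F = FHom_rquiver_functor[OF rquiver_morphism]
  have FO: "FOb (rquiver_functor (Q', I') f) = fst f" by (simp add: rquiver_functor_def)
  show ?thesis
    unfolding covering_functor_def Let_def FO R.Ob_M R'.Ob_M
  proof (intro conjI ballI)
    show "kfunctor R.M R'.M (rquiver_functor (Q', I') f)"
      by (rule kfunctor_rquiver_functor[OF rquiver_morphism])
  next
    fix a y assume a: "a \<in> verts Q'" and y: "y \<in> verts Q"
    note v' = a vert_map[OF y]
    show "bij_betw (\<lambda>m. finsum (Hom R'.M a (fst f y))
        (\<lambda>z. FHom (rquiver_functor (Q', I') f) z y (m z))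
        {z \<in> {z \<in> verts Q. fst f z = a}. m z \<noteq> \<zero>\<^bsub>Hom R.M z y\<^esub>})
      (dsum {z \<in> verts Q. fst f z = a} (\<lambda>z. Hom R.M z y)) (carrier (Hom R'.M a (fst f y)))"
    proof (rule graded_lift.bij_betw_dsum[OF graded_lift_to[OF y a]])
      show "abelian_group (Hom R'.M a (fst f y))" by (rule R'.abelian_group_Hom[OF v'])
    qed (use F y in \<open>auto simp: R.carrier_Hom R'.carrier_Hom paths_lc_def
        R'.finsum_Hom[OF v'] paths_to[OF y, symmetric] subset_iff\<close>)
  next
    fix b x assume b: "b \<in> verts Q'" and x: "x \<in> verts Q"
    note v' = vert_map[OF x] b
    show "bij_betw (\<lambda>m. finsum (Hom R'.M (fst f x) b)
        (\<lambda>z. FHom (rquiver_functor (Q', I') f) x z (m z))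
        {z \<in> {z \<in> verts Q. fst f z = b}. m z \<noteq> \<zero>\<^bsub>Hom R.M x z\<^esub>})
      (dsum {z \<in> verts Q. fst f z = b} (\<lambda>z. Hom R.M x z)) (carrier (Hom R'.M (fst f x) b))"
    proof (rule graded_lift.bij_betw_dsum[OF graded_lift_from[OF x b]])
      show "abelian_group (Hom R'.M (fst f x) b)" by (rule R'.abelian_group_Hom[OF v'])
    qed (use F x in \<open>auto simp: R.carrier_Hom R'.carrier_Hom paths_lc_def
        R'.finsum_Hom[OF v'] paths_from[OF x, symmetric] subset_iff\<close>)
  qed
qed

end

section \<open>Local boundedness\<close>

lemma lc_comp_sum_left: "lc_comp (sum g A) \<rho> = (\<Sum>x\<in>A. lc_comp (g x) \<rho>)"
  by (induction A rule: infinite_finite_induct) (simp_all add: lc_comp_add_left)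

lemma lc_comp_sum_right: "lc_comp \<sigma> (sum g A) = (\<Sum>x\<in>A. lc_comp \<sigma> (g x))"
  by (induction A rule: infinite_finite_induct) (simp_all add: lc_comp_add_right)

context rquiver
begin

lemma in_I_if_supp:
  assumes "x \<in> verts Q" "y \<in> verts Q" "\<And>p. p \<in> supp \<rho> \<Longrightarrow> pmon p \<in> I x y"
  shows "\<rho> \<in> I x y"
  by (rule lc_in_subspace[OF I_subspace[OF assms(1,2)] assms(3)])

text \<open>Relations involve no trivial path, so the coefficient at \<open>[]\<close> is well
  defined on cosets and multiplicative. Between distinct objects it vanishes, which will exclude
  isomorphisms.\<close>

lemma kinverse_coef:
  assumes "x \<in> verts Q" "y \<in> verts Q" "\<rho> \<in> paths_lc Q x y" "\<sigma> \<in> paths_lc Q y x"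
    and "kinverse M x y (\<rho> +o I x y) (\<sigma> +o I y x)"
  shows "coef \<sigma> [] * coef \<rho> [] = 1"
proof -
  have "lc_comp \<sigma> \<rho> +o I x x = pmon [] +o I x x"
    using assms by (simp add: kinverse_def Cmp_M Idn_M)
  then have "lc_comp \<sigma> \<rho> - pmon [] \<in> I x x"
    by (simp add: coset_eq_iff[OF I_subspace[OF assms(1,1)]])
  then have "coef (lc_comp \<sigma> \<rho> - pmon []) [] = 0" by (rule coef_Nil[OF assms(1,1)])
  then show ?thesis by (simp add: lookup_minus coef_lc_comp_Nil)
qed

lemma kinverse_coef':
  assumes "x \<in> verts Q" "y \<in> verts Q" "\<rho> \<in> paths_lc Q x y" "kinverse M x y (\<rho> +o I x y) v"
  shows "coef \<rho> [] \<noteq> 0"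
proof -
  have "v \<in> carrier (Hom M y x)" using assms(4) by (simp add: kinverse_def)
  then obtain \<sigma> where "\<sigma> \<in> paths_lc Q y x" "v = \<sigma> +o I y x" by (rule HomE)
  then show ?thesis using kinverse_coef[OF assms(1,2,3)] assms(4) by auto
qed

text \<open>The inverse is the geometric series, which is finite because long paths lie in \<open>I\<close>.\<close>

lemma kinverse_exists:
  assumes x: "x \<in> verts Q" and fin: "finite {p. \<exists>y. awalk x p y \<and> pmon p \<notin> I x y}"
    and \<rho>: "\<rho> \<in> paths_lc Q x x" and c: "coef \<rho> [] \<noteq> 0"
  shows "\<exists>v. kinverse M x x (\<rho> +o I x x) v"
proof -
  let ?c = "coef \<rho> []"
  let ?F = "{p. \<exists>y. awalk x p y \<and> pmon p \<notin> I x y}"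
  \<comment> \<open>Normalised so that \<rho> is a scalar multiple of \<open>pmon [] - s\<close> and
    \<open>s\<close> involves no trivial path.\<close>
  define s where "s = pmon [] - lc_scale (1 / ?c) \<rho>"
  have s: "s \<in> paths_lc Q x x"
    unfolding s_def using x by (intro paths_lc_diff paths_lc_scale \<rho>) (simp add: awalk_Nil_iff)
  have s0: "coef s [] = 0" using c by (simp add: s_def lookup_minus)
  have \<rho>_eq: "\<rho> = lc_scale ?c (pmon [] - s)" using c by (simp add: s_def)
  define pw where "pw i = (lc_comp s ^^ i) (pmon [])" for i
  have pw_0: "pw 0 = pmon []" and pw_Suc: "pw (Suc i) = lc_comp s (pw i)" for i
    by (simp_all add: pw_def)
  \<comment> \<open>Both recursions are used, one for each side of the inverse.\<close>
  have pw_Suc': "pw (Suc i) = lc_comp (pw i) s" for i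
    by (induction i) (simp_all add: pw_0 pw_Suc lc_comp_assoc)
  have pw: "pw i \<in> paths_lc Q x x" for i
  proof (induction i)
    case 0
    then show ?case using x by (simp add: pw_0 awalk_Nil_iff)
  next
    case (Suc i)
    then show ?case unfolding pw_Suc by (rule lc_comp_paths_lc[OF wf _ s])
  qed
  \<comment> \<open>Each factor \<open>s\<close> adds at least one arrow.\<close>
  have long: "i \<le> length p" if "p \<in> supp (pw i)" for i p
    using that
  proof (induction i arbitrary: p)
    case (Suc i)
    have "p \<in> {p @ q | p q. p \<in> supp (pw i) \<and> q \<in> supp s}"
      using Suc.prems unfolding pw_Suc by (rule subsetD[OF supp_lc_comp])
    then obtain q r where qr: "p = q @ r" "q \<in> supp (pw i)" "r \<in> supp s" by auto
    have "r \<noteq> []" using qr(3) s0 by (auto simp: in_keys_iff)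
    then show ?case using Suc.IH[OF qr(2)] qr(1) by (cases r) auto
  qed simp
  obtain N where N: "\<And>p. p \<in> ?F \<Longrightarrow> length p < N"
    using finite_nat_set_iff_bounded[of "length ` ?F"] fin by auto
  \<comment> \<open>By the choice of \<open>N\<close> the paths of this power are too long to lie
    outside the ideal, so the series stops modulo \<open>I\<close>.\<close>
  have "pw N \<in> I x x"
  proof (rule in_I_if_supp[OF x x])
    fix p assume p: "p \<in> supp (pw N)"
    have "awalk x p x" using pw p by (rule paths_lcD)
    moreover have "p \<notin> ?F" using long[OF p] N[of p] by fastforce
    ultimately show "pmon p \<in> I x x" by simp
  qed
  define S where "S = (\<Sum>i<N. pw i)"
  have S: "S \<in> paths_lc Q x x" unfolding S_def by (intro paths_lc_sum pw)
  have tele: "(\<Sum>i<N. pw i) - (\<Sum>i<N. pw (Suc i)) = pmon [] - pw N"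
    using sum_lessThan_telescope'[of pw N] by (simp add: pw_0 sum_subtractf)
  have "lc_comp (pmon [] - s) S = S - lc_comp s S" "lc_comp S (pmon [] - s) = S - lc_comp S s"
    by (simp_all only: lc_comp_diff_left lc_comp_diff_right lc_comp_Nil_left lc_comp_Nil_right)
  moreover have "lc_comp s S = (\<Sum>i<N. pw (Suc i))"
    by (simp only: S_def lc_comp_sum_right pw_Suc)
  moreover have "lc_comp S s = (\<Sum>i<N. pw (Suc i))"
    by (simp only: S_def lc_comp_sum_left pw_Suc')
  ultimately have inv: "lc_comp (pmon [] - s) S = pmon [] - pw N"
    "lc_comp S (pmon [] - s) = pmon [] - pw N"
    using tele by (simp_all only: S_def)
  have "lc_comp \<rho> (lc_scale (1 / ?c) S) = lc_scale (?c * (1 / ?c)) (lc_comp (pmon [] - s) S)"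
    "lc_comp (lc_scale (1 / ?c) S) \<rho> = lc_scale ((1 / ?c) * ?c) (lc_comp S (pmon [] - s))"
    by (subst \<rho>_eq, simp only: lc_comp_scale_left lc_comp_scale_right lc.scale_scale mult.commute)+
  then have "lc_comp \<rho> (lc_scale (1 / ?c) S) = pmon [] - pw N"
    "lc_comp (lc_scale (1 / ?c) S) \<rho> = pmon [] - pw N"
    using c by (simp_all add: inv)
  moreover have "(pmon [] - pw N) +o I x x = pmon [] +o I x x"
    using \<open>pw N \<in> I x x\<close> lc.subspace_neg[OF I_subspace[OF x x]]
    by (simp add: coset_eq_iff[OF I_subspace[OF x x]])
  ultimately have "kinverse M x x (\<rho> +o I x x) (lc_scale (1 / ?c) S +o I x x)"
    using x \<rho> S by (simp add: kinverse_def coset_in_Hom paths_lc_scale Cmp_M Idn_M)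
  then show ?thesis ..
qed

text \<open>The cosets of the finitely many paths outside the ideal span. Different paths may share
  a coset, so representatives are attached to the cosets in \<open>B\<close> and not to the
  paths.\<close>

lemma Hom_fin_dim:
  assumes v: "x \<in> verts Q" "y \<in> verts Q" and fin: "finite {p. awalk x p y \<and> pmon p \<notin> I x y}"
  shows "\<exists>B \<subseteq> carrier (Hom M x y). finite B \<and> (\<forall>u \<in> carrier (Hom M x y).
    \<exists>c. u = finsum (Hom M x y) (\<lambda>b. c b \<odot>\<^bsub>Hom M x y\<^esub> b) B)"
proof -
  interpret abelian_group "Hom M x y" by (rule abelian_group_Hom[OF v])
  note S = I_subspace[OF v]
  let ?F = "{p. awalk x p y \<and> pmon p \<notin> I x y}"
  define B where "B = (\<lambda>p. pmon p +o I x y) ` ?F"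
  have B: "B \<subseteq> carrier (Hom M x y)" "finite B"
    using fin by (auto simp: B_def intro!: coset_in_Hom)
  have "\<forall>b\<in>B. \<exists>\<rho>. \<rho> \<in> paths_lc Q x y \<and> b = \<rho> +o I x y"
    using B(1) by (auto simp: carrier_Hom)
  then obtain r where r: "\<forall>b\<in>B. r b \<in> paths_lc Q x y \<and> b = r b +o I x y" by (rule bchoice[THEN exE])
  have sum: "finsum (Hom M x y) (\<lambda>b. c b \<odot>\<^bsub>Hom M x y\<^esub> b) B
      = (\<Sum>b\<in>B. lc_scale (c b) (r b)) +o I x y" for c
  proof -
    have "finsum (Hom M x y) (\<lambda>b. c b \<odot>\<^bsub>Hom M x y\<^esub> b) B
        = finsum (Hom M x y) (\<lambda>b. lc_scale (c b) (r b) +o I x y) B"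
    proof (rule finsum_cong')
      show "(\<lambda>b. lc_scale (c b) (r b) +o I x y) \<in> B \<rightarrow> carrier (Hom M x y)"
        using r by (auto intro!: coset_in_Hom paths_lc_scale)
      show "c b \<odot>\<^bsub>Hom M x y\<^esub> b = lc_scale (c b) (r b) +o I x y" if "b \<in> B" for b
        using smult_Hom[OF v, of "c b" "r b"] r that by simp
    qed simp
    also have "\<dots> = (\<Sum>b\<in>B. lc_scale (c b) (r b)) +o I x y"
      by (rule finsum_Hom[OF v B(2)]) (use r in \<open>auto intro: paths_lc_scale\<close>)
    finally show ?thesis .
  qed
  \<comment> \<open>The combinations congruent to a combination of the chosen representatives; this
    subspace will contain every path from \<open>x\<close> to \<open>y\<close>.\<close>
  define W where "W = {\<rho>. \<exists>c. \<rho> - (\<Sum>b\<in>B. lc_scale (c b) (r b)) \<in> I x y}"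
  have W: "lc.subspace W"
  proof (rule lc.subspaceI)
    have "0 - (\<Sum>b\<in>B. lc_scale 0 (r b)) \<in> I x y" by (simp add: lc.subspace_0[OF S])
    then show "0 \<in> W" unfolding W_def by (intro CollectI exI[of _ "\<lambda>b. 0"])
  next
    fix \<rho> \<sigma> assume "\<rho> \<in> W" "\<sigma> \<in> W"
    then obtain c d where "\<rho> - (\<Sum>b\<in>B. lc_scale (c b) (r b)) \<in> I x y"
      "\<sigma> - (\<Sum>b\<in>B. lc_scale (d b) (r b)) \<in> I x y" unfolding W_def by auto
    from lc.subspace_add[OF S this]
    have "\<rho> + \<sigma> - (\<Sum>b\<in>B. lc_scale (c b + d b) (r b)) \<in> I x y"
      by (simp add: lc.scale_left_distrib sum.distrib algebra_simps)
    then show "\<rho> + \<sigma> \<in> W" unfolding W_def by (intro CollectI exI[of _ "\<lambda>b. c b + d b"])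
  next
    fix a \<rho> assume "\<rho> \<in> W"
    then obtain c where "\<rho> - (\<Sum>b\<in>B. lc_scale (c b) (r b)) \<in> I x y" unfolding W_def by auto
    from lc.subspace_scale[OF S this, of a]
    have "lc_scale a \<rho> - (\<Sum>b\<in>B. lc_scale (a * c b) (r b)) \<in> I x y"
      by (simp add: lc.scale_right_diff_distrib lc.scale_sum_right)
    then show "lc_scale a \<rho> \<in> W" unfolding W_def by (intro CollectI exI[of _ "\<lambda>b. a * c b"])
  qed
  have pmon_W: "pmon p \<in> W" if p: "awalk x p y" for p
  proof (cases "pmon p \<in> I x y")
    case True
    then have "pmon p - (\<Sum>b\<in>B. lc_scale 0 (r b)) \<in> I x y" by simp
    then show ?thesis unfolding W_def by (intro CollectI exI[of _ "\<lambda>b. 0"])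
  next
    case False
    let ?b = "pmon p +o I x y"
    have b: "?b \<in> B" unfolding B_def using False p by (intro imageI) simp
    have "(\<Sum>b\<in>B. lc_scale (if b = ?b then 1 else 0) (r b)) = (\<Sum>b\<in>B. if b = ?b then r b else 0)"
      by (intro sum.cong) auto
    also have "\<dots> = r ?b" using b B(2) by simp
    finally have "pmon p - (\<Sum>b\<in>B. lc_scale (if b = ?b then 1 else 0) (r b)) = pmon p - r ?b"
      by simp
    moreover have "pmon p - r ?b \<in> I x y" using r b coset_eq_iff[OF S, of "pmon p" "r ?b"] by simp
    ultimately show ?thesis
      unfolding W_def by (intro CollectI exI[of _ "\<lambda>b. if b = ?b then 1 else 0"]) simp
  qed
  have "\<exists>c. u = finsum (Hom M x y) (\<lambda>b. c b \<odot>\<^bsub>Hom M x y\<^esub> b) B" if u: "u \<in> carrier (Hom M x y)" for u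
  proof -
    obtain \<rho> where \<rho>: "\<rho> \<in> paths_lc Q x y" "u = \<rho> +o I x y" using u by (rule HomE)
    have "\<rho> \<in> W" by (rule lc_in_subspace[OF W]) (rule pmon_W[OF paths_lcD[OF \<rho>(1)]])
    then obtain c where "\<rho> - (\<Sum>b\<in>B. lc_scale (c b) (r b)) \<in> I x y" unfolding W_def by auto
    then have "u = (\<Sum>b\<in>B. lc_scale (c b) (r b)) +o I x y"
      unfolding \<rho>(2) by (simp add: coset_eq_iff[OF S])
    then show ?thesis by (intro exI[of _ c]) (simp only: sum)
  qed
  then show ?thesis using B by (intro exI[of _ B] conjI ballI) simp_all
qed

lemma carrier_Hom_nonzero:
  assumes "x \<in> verts Q" "y \<in> verts Q" "carrier (Hom M x y) \<noteq> {\<zero>\<^bsub>Hom M x y\<^esub>}"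
  obtains p where "awalk x p y" "pmon p \<notin> I x y"
proof -
  have "\<exists>\<rho> \<in> paths_lc Q x y. \<rho> \<notin> I x y"
  proof (rule ccontr)
    assume "\<not> ?thesis"
    then have "\<rho> +o I x y = I x y" if "\<rho> \<in> paths_lc Q x y" for \<rho>
      using that by (simp add: coset_eq_self_iff[OF I_subspace[OF assms(1,2)]])
    then have "carrier (Hom M x y) \<subseteq> {I x y}" by (auto simp: carrier_Hom)
    moreover have "I x y \<in> carrier (Hom M x y)" using coset_in_Hom[OF paths_lc_zero, of x y] by simp
    ultimately show False using assms(3) by auto
  qed
  then obtain \<rho> where "\<rho> \<in> paths_lc Q x y" "\<rho> \<notin> I x y" by auto
  then obtain p where "p \<in> supp \<rho>" "pmon p \<notin> I x y"
    using in_I_if_supp[OF assms(1,2)] by auto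
  then show ?thesis using that[of p] paths_lcD[OF \<open>\<rho> \<in> paths_lc Q x y\<close>] by simp
qed

text \<open>An endomorphism is invertible exactly if its coefficient at \<open>[]\<close> is
  nonzero, which makes non-invertibility additive; the finiteness conditions count the paths at a
  vertex that survive modulo \<open>I\<close>.\<close>

lemma locally_bounded_rquiver_cat:
  assumes fin_from: "\<And>x. x \<in> verts Q \<Longrightarrow> finite {p. \<exists>y. awalk x p y \<and> pmon p \<notin> I x y}"
    and fin_to: "\<And>x. x \<in> verts Q \<Longrightarrow> finite {p. \<exists>y. awalk y p x \<and> pmon p \<notin> I y x}"
  shows "locally_bounded M"
proof (rule locally_bounded.intro[OF kcategory locally_bounded_axioms.intro])
  fix x assume "x \<in> Ob M"
  then have x: "x \<in> verts Q" by simp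
  have "pmon [] \<notin> I x x" using coef_Nil[OF x x, of "pmon []"] by auto
  then show "Idn M x \<noteq> \<zero>\<^bsub>Hom M x x\<^esub>"
    by (simp add: Idn_M coset_eq_self_iff[OF I_subspace[OF x x]])
  fix u v assume "u \<in> carrier (Hom M x x)" "v \<in> carrier (Hom M x x)"
    and u_inv: "\<nexists>u'. kinverse M x x u u'" and v_inv: "\<nexists>v'. kinverse M x x v v'"
  from this(1,2) obtain \<rho> \<sigma> where \<rho>: "\<rho> \<in> paths_lc Q x x" "u = \<rho> +o I x x"
    and \<sigma>: "\<sigma> \<in> paths_lc Q x x" "v = \<sigma> +o I x x" by (auto simp: carrier_Hom)
  have "coef \<rho> [] = 0" "coef \<sigma> [] = 0"
    using kinverse_exists[OF x fin_from[OF x] \<rho>(1)] kinverse_exists[OF x fin_from[OF x] \<sigma>(1)]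
      u_inv v_inv \<rho>(2) \<sigma>(2) by auto
  then have "coef (\<rho> + \<sigma>) [] = 0" by (simp add: lookup_add)
  then show "\<nexists>w. kinverse M x x (u \<oplus>\<^bsub>Hom M x x\<^esub> v) w"
    using kinverse_coef'[OF x x paths_lc_add[OF \<rho>(1) \<sigma>(1)]] by (auto simp: \<rho>(2) \<sigma>(2) add_Hom[OF x x])
next
  fix x y u v assume "x \<in> Ob M" "y \<in> Ob M" and inv: "kinverse M x y u v"
  then have v: "x \<in> verts Q" "y \<in> verts Q" by simp_all
  have "u \<in> carrier (Hom M x y)" using inv by (simp add: kinverse_def)
  then obtain \<rho> where \<rho>: "\<rho> \<in> paths_lc Q x y" "u = \<rho> +o I x y" by (rule HomE)
  then have "[] \<in> supp \<rho>" using kinverse_coef'[OF v \<rho>(1)] inv by (auto simp: in_keys_iff)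
  then have "awalk x [] y" by (rule paths_lcD[OF \<rho>(1)])
  then show "x = y" by (simp add: awalk_Nil_iff)
next
  fix x y assume "x \<in> Ob M" "y \<in> Ob M"
  then have v: "x \<in> verts Q" "y \<in> verts Q" by simp_all
  have "finite {p. awalk x p y \<and> pmon p \<notin> I x y}"
    by (rule finite_subset[OF _ fin_from[OF v(1)]]) auto
  then show "\<exists>B \<subseteq> carrier (Hom M x y). finite B \<and> (\<forall>u \<in> carrier (Hom M x y).
    \<exists>c. u = finsum (Hom M x y) (\<lambda>b. c b \<odot>\<^bsub>Hom M x y\<^esub> b) B)"
    by (rule Hom_fin_dim[OF v])
next
  fix x assume "x \<in> Ob M"
  then have x: "x \<in> verts Q" by simp
  let ?A = "awlast x ` {p. \<exists>y. awalk x p y \<and> pmon p \<notin> I x y}"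
  \<comment> \<open>The start of a path is read off its first arrow; the trivial path has none, and
    its start is \<open>x\<close>.\<close>
  let ?B = "(\<lambda>p. if p = [] then x else tail Q (hd p)) ` {p. \<exists>y. awalk y p x \<and> pmon p \<notin> I y x}"
  have nonzero: "y \<in> ?A \<union> ?B"
    if y: "y \<in> verts Q" and nz: "carrier (Hom M x y) \<noteq> {\<zero>\<^bsub>Hom M x y\<^esub>} \<or> carrier (Hom M y x) \<noteq> {\<zero>\<^bsub>Hom M y x\<^esub>}"
    for y
    using nz
  proof
    assume "carrier (Hom M x y) \<noteq> {\<zero>\<^bsub>Hom M x y\<^esub>}"
    then obtain p where p: "awalk x p y" "pmon p \<notin> I x y" by (rule carrier_Hom_nonzero[OF x y])
    moreover have "y = awlast x p" using p(1) by auto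
    ultimately have "y \<in> ?A" by (intro image_eqI[of _ _ p]) auto
    then show ?thesis ..
  next
    assume "carrier (Hom M y x) \<noteq> {\<zero>\<^bsub>Hom M y x\<^esub>}"
    then obtain p where p: "awalk y p x" "pmon p \<notin> I y x" by (rule carrier_Hom_nonzero[OF y x])
    moreover have "y = (if p = [] then x else tail Q (hd p))"
      using p(1) by (cases p) (auto simp: awalk_Nil_iff awalk_Cons_iff)
    ultimately have "y \<in> ?B" by (intro image_eqI[of _ _ p]) auto
    then show ?thesis ..
  qed
  have "{y \<in> Ob M. carrier (Hom M x y) \<noteq> {\<zero>\<^bsub>Hom M x y\<^esub>} \<or> carrier (Hom M y x) \<noteq> {\<zero>\<^bsub>Hom M y x\<^esub>}} \<subseteq> ?A \<union> ?B"
    by (rule subsetI) (elim CollectE conjE, unfold Ob_M, rule nonzero)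
  moreover have "finite (?A \<union> ?B)" using fin_from[OF x] fin_to[OF x] by simp
  ultimately show "finite {y \<in> Ob M. carrier (Hom M x y) \<noteq> {\<zero>\<^bsub>Hom M x y\<^esub>} \<or>
        carrier (Hom M y x) \<noteq> {\<zero>\<^bsub>Hom M y x\<^esub>}}" by (rule finite_subset)
qed

end

section \<open>Galois coverings\<close>

text \<open>\<open>Bij\<close> consists of extensional bijections, so an automorphism has a single
  representative and freeness can be tested by equality with the unit.\<close>

definition deck_group :: "('v, 'a) pre_digraph \<Rightarrow> ('v, 'a, 'w, 'b) quiver_map \<Rightarrow>
    ('v, 'a, 'v, 'a) quiver_map set" where
  "deck_group Q f = {h \<in> Bij (verts Q) \<times> Bij (arcs Q). quiver_morphism Q Q h \<and>
     (\<forall>x \<in> verts Q. fst f (fst h x) = fst f x) \<and> (\<forall>a \<in> arcs Q. snd f (snd h a) = snd f a)}"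

text \<open>The values of the relations away from the vertices are arbitrary, and the orbit ideal is
  compared with its model on vertices only.\<close>

lemma is_rquiver_cong:
  assumes "\<And>x y. x \<in> verts Q \<Longrightarrow> y \<in> verts Q \<Longrightarrow> I x y = J x y"
  shows "is_rquiver (Q, I) \<longleftrightarrow> is_rquiver (Q, J)"
  using assms by (simp add: is_rquiver_def is_ideal_def cong: ball_cong)

section \<open>Automorphisms of a linear category\<close>

lemma kfun_restrict_eqI:
  assumes "\<And>x. x \<in> Ob M \<Longrightarrow> FOb F x = FOb G x"
    and "\<And>x y u. x \<in> Ob M \<Longrightarrow> y \<in> Ob M \<Longrightarrow> u \<in> carrier (Hom M x y) \<Longrightarrow>
      FHom F x y u = FHom G x y u"
  shows "kfun_restrict M F = kfun_restrict M G"
  using assms by (auto simp: kfun_restrict_def fun_eq_iff restrict_def)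

lemma FOb_restrict [simp]: "x \<in> Ob M \<Longrightarrow> FOb (kfun_restrict M F) x = FOb F x"
  and FHom_restrict [simp]: "x \<in> Ob M \<Longrightarrow> y \<in> Ob M \<Longrightarrow> u \<in> carrier (Hom M x y) \<Longrightarrow>
    FHom (kfun_restrict M F) x y u = FHom F x y u"
  by (simp_all add: kfun_restrict_def)

lemma kfun_comp_simps [simp]:
  "FOb (kfun_comp F H) x = FOb F (FOb H x)"
  "FHom (kfun_comp F H) x y u = FHom F (FOb H x) (FOb H y) (FHom H x y u)"
  by (simp_all add: kfun_comp_def)

text \<open>Sums, multiples, composites and identities stay in the hom spaces, on which the
  restricted functor keeps its values.\<close>

lemma kfunctor_restrict:
  assumes "kfunctor M N F"
  shows "kfunctor M N (kfun_restrict M F)"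
proof -
  have "kcategory M" using assms by (simp add: kfunctor_def)
  then interpret kcategory M .
  have mod: "Module.module ring_of_type_algebra (Hom M x y)" if "x \<in> Ob M" "y \<in> Ob M" for x y
    using Hom_module[OF that] .
  have add: "u \<oplus>\<^bsub>Hom M x y\<^esub> v \<in> carrier (Hom M x y)"
    if "x \<in> Ob M" "y \<in> Ob M" "u \<in> carrier (Hom M x y)" "v \<in> carrier (Hom M x y)" for x y u v
    using abelian_monoid.a_closed[OF abelian_group.axioms(1)[OF module.axioms(2)[OF mod]]] that by auto
  have smult: "c \<odot>\<^bsub>Hom M x y\<^esub> u \<in> carrier (Hom M x y)"
    if "x \<in> Ob M" "y \<in> Ob M" "u \<in> carrier (Hom M x y)" for x y u c
    using module.smult_closed[OF mod] that by (simp add: ring_of_type_algebra_def)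
  show ?thesis
    using assms unfolding kfunctor_def
    by (simp add: add smult Cmp_closed Idn_closed)
qed

lemma kaut_group_D:
  assumes "h \<in> carrier (kaut_group M)"
  shows "kfunctor M M h" "kfun_restrict M h = h"
    "x \<in> Ob M \<Longrightarrow> FOb h x \<in> Ob M"
    "x \<in> Ob M \<Longrightarrow> y \<in> Ob M \<Longrightarrow> u \<in> carrier (Hom M x y) \<Longrightarrow>
      FHom h x y u \<in> carrier (Hom M (FOb h x) (FOb h y))"
  using assms by (auto simp: kaut_group_def kfunctor_def)

lemma kaut_group_mult: "h \<otimes>\<^bsub>kaut_group M\<^esub> h' = kfun_restrict M (kfun_comp h h')"
  and kaut_group_one: "\<one>\<^bsub>kaut_group M\<^esub> = kfun_restrict M \<lparr>FOb = (\<lambda>x. x), FHom = (\<lambda>x y u. u)\<rparr>"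
  by (simp_all add: kaut_group_def)

lemma kaut_group_r_one:
  assumes "h \<in> carrier (kaut_group M)"
  shows "h \<otimes>\<^bsub>kaut_group M\<^esub> \<one>\<^bsub>kaut_group M\<^esub> = h"
proof -
  have "kfun_restrict M (kfun_comp h \<one>\<^bsub>kaut_group M\<^esub>) = kfun_restrict M h"
    by (rule kfun_restrict_eqI) (simp_all add: kaut_group_one)
  then show ?thesis using kaut_group_D(2)[OF assms] by (simp add: kaut_group_mult)
qed

lemma kaut_group_l_one:
  assumes h: "h \<in> carrier (kaut_group M)"
  shows "\<one>\<^bsub>kaut_group M\<^esub> \<otimes>\<^bsub>kaut_group M\<^esub> h = h"
proof -
  have "kfun_restrict M (kfun_comp \<one>\<^bsub>kaut_group M\<^esub> h) = kfun_restrict M h"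
    by (rule kfun_restrict_eqI) (simp_all add: kaut_group_one kaut_group_D[OF h])
  then show ?thesis using kaut_group_D(2)[OF h] by (simp add: kaut_group_mult)
qed

lemma kaut_group_assoc:
  assumes h: "h \<in> carrier (kaut_group M)"
  shows "(h1 \<otimes>\<^bsub>kaut_group M\<^esub> h2) \<otimes>\<^bsub>kaut_group M\<^esub> h = h1 \<otimes>\<^bsub>kaut_group M\<^esub> (h2 \<otimes>\<^bsub>kaut_group M\<^esub> h)"
  unfolding kaut_group_mult by (rule kfun_restrict_eqI) (simp_all add: kaut_group_D[OF h])

text \<open>\<open>m_inv\<close> is a definite description, so a candidate for the inverse has to be
  shown unique: k = k h h' = h'.\<close>

lemma kaut_group_inv_equality:
  assumes h: "h \<in> carrier (kaut_group M)" and h': "h' \<in> carrier (kaut_group M)"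
    and inv: "h \<otimes>\<^bsub>kaut_group M\<^esub> h' = \<one>\<^bsub>kaut_group M\<^esub>" "h' \<otimes>\<^bsub>kaut_group M\<^esub> h = \<one>\<^bsub>kaut_group M\<^esub>"
  shows "inv\<^bsub>kaut_group M\<^esub> h = h'"
  unfolding m_inv_def
proof (rule the_equality)
  show "h' \<in> carrier (kaut_group M) \<and> h \<otimes>\<^bsub>kaut_group M\<^esub> h' = \<one>\<^bsub>kaut_group M\<^esub> \<and>
      h' \<otimes>\<^bsub>kaut_group M\<^esub> h = \<one>\<^bsub>kaut_group M\<^esub>"
    using h' inv by simp
next
  fix k assume k: "k \<in> carrier (kaut_group M) \<and> h \<otimes>\<^bsub>kaut_group M\<^esub> k = \<one>\<^bsub>kaut_group M\<^esub> \<and>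
      k \<otimes>\<^bsub>kaut_group M\<^esub> h = \<one>\<^bsub>kaut_group M\<^esub>"
  have "k = k \<otimes>\<^bsub>kaut_group M\<^esub> (h \<otimes>\<^bsub>kaut_group M\<^esub> h')" using k inv kaut_group_r_one by metis
  also have "\<dots> = (k \<otimes>\<^bsub>kaut_group M\<^esub> h) \<otimes>\<^bsub>kaut_group M\<^esub> h'" by (rule kaut_group_assoc[OF h', symmetric])
  also have "\<dots> = h'" using k kaut_group_l_one[OF h'] by simp
  finally show "k = h'" .
qed

section \<open>The deck group of a covering of quivers with relations\<close>

locale rquiver_galois = rquiver_cover Q Q' f I R' I'
  for Q :: "('v, 'a) pre_digraph" and Q' :: "('w, 'b) pre_digraph"
    and f :: "('v, 'a, 'w, 'b) quiver_map" and I :: "('v, 'a, 'k::field) path_rels"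
    and R' I' :: "('w, 'b, 'k) path_rels" +
  assumes verts_surj: "fst f ` verts Q = verts Q'"
    and connected: "\<lbrakk>S \<subseteq> verts Q; S \<noteq> {}; \<And>a. a \<in> arcs Q \<Longrightarrow> tail Q a \<in> S \<longleftrightarrow> head Q a \<in> S\<rbrakk> \<Longrightarrow>
      S = verts Q"
    and transitive: "\<lbrakk>x \<in> verts Q; y \<in> verts Q; fst f x = fst f y\<rbrakk> \<Longrightarrow>
      \<exists>h \<in> deck_group Q f. fst h x = y"
begin

abbreviation "\<Gamma> \<equiv> deck_group Q f"
abbreviation "Aut \<equiv> BijGroup (verts Q) \<times>\<times> BijGroup (arcs Q)"

lemma deckD:
  assumes "h \<in> \<Gamma>"
  shows "fst h \<in> Bij (verts Q)" "snd h \<in> Bij (arcs Q)" "quiver_morphism Q Q h"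
    "x \<in> verts Q \<Longrightarrow> fst h x \<in> verts Q" "a \<in> arcs Q \<Longrightarrow> snd h a \<in> arcs Q"
    "a \<in> arcs Q \<Longrightarrow> tail Q (snd h a) = fst h (tail Q a)"
    "a \<in> arcs Q \<Longrightarrow> head Q (snd h a) = fst h (head Q a)"
    "x \<in> verts Q \<Longrightarrow> fst f (fst h x) = fst f x" "a \<in> arcs Q \<Longrightarrow> snd f (snd h a) = snd f a"
  using assms by (auto simp: deck_group_def quiver_morphism_def mem_Times_iff)

lemma group_Aut: "group Aut"
  by (intro DirProd_group group_BijGroup)

lemma deck_in_Aut: "h \<in> \<Gamma> \<Longrightarrow> h \<in> carrier Aut"
  using deckD(1,2) by (auto simp: BijGroup_def mem_Times_iff)

lemma mult_Aut:
  assumes "h \<in> \<Gamma>" "h' \<in> \<Gamma>"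
  shows "x \<in> verts Q \<Longrightarrow> fst (h \<otimes>\<^bsub>Aut\<^esub> h') x = fst h (fst h' x)"
    and "a \<in> arcs Q \<Longrightarrow> snd (h \<otimes>\<^bsub>Aut\<^esub> h') a = snd h (snd h' a)"
  using deckD(1,2)[OF assms(1)] deckD(1,2)[OF assms(2)]
  by (simp_all add: mult_DirProd' BijGroup_def compose_def)

lemma one_Aut: "x \<in> verts Q \<Longrightarrow> fst \<one>\<^bsub>Aut\<^esub> x = x" "a \<in> arcs Q \<Longrightarrow> snd \<one>\<^bsub>Aut\<^esub> a = a"
  by (simp_all add: BijGroup_def)

lemma deckI:
  assumes "h \<in> carrier Aut"
    and "\<And>a. a \<in> arcs Q \<Longrightarrow> tail Q (snd h a) = fst h (tail Q a)"
    and "\<And>a. a \<in> arcs Q \<Longrightarrow> head Q (snd h a) = fst h (head Q a)"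
    and "\<And>x. x \<in> verts Q \<Longrightarrow> fst f (fst h x) = fst f x"
    and "\<And>a. a \<in> arcs Q \<Longrightarrow> snd f (snd h a) = snd f a"
  shows "h \<in> \<Gamma>"
proof -
  have h: "fst h \<in> Bij (verts Q)" "snd h \<in> Bij (arcs Q)"
    using assms(1) by (auto simp: BijGroup_def mem_Times_iff)
  have "snd h a \<in> arcs Q" if "a \<in> arcs Q" for a using that h(2) Bij_imp_funcset by blast
  moreover have "fst h x \<in> verts Q" if "x \<in> verts Q" for x using that h(1) Bij_imp_funcset by blast
  ultimately have "quiver_morphism Q Q h"
    using assms(2,3) by (auto simp: quiver_morphism_def)
  then show ?thesis using h assms(4,5) by (simp add: deck_group_def mem_Times_iff)
qed

lemma one_deck: "\<one>\<^bsub>Aut\<^esub> \<in> \<Gamma>"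
proof (rule deckI)
  show "\<one>\<^bsub>Aut\<^esub> \<in> carrier Aut" by (rule monoid.one_closed[OF group.is_monoid[OF group_Aut]])
qed (simp_all add: one_Aut del: one_DirProd)

lemma mult_deck:
  assumes "h \<in> \<Gamma>" "h' \<in> \<Gamma>"
  shows "h \<otimes>\<^bsub>Aut\<^esub> h' \<in> \<Gamma>"
proof (rule deckI)
  show "h \<otimes>\<^bsub>Aut\<^esub> h' \<in> carrier Aut"
    using group.is_monoid[OF group_Aut] deck_in_Aut[OF assms(1)] deck_in_Aut[OF assms(2)]
    by (rule monoid.m_closed)
qed (simp_all add: mult_Aut[OF assms] deckD[OF assms(1)] deckD[OF assms(2)])

lemma inv_deck:
  assumes h: "h \<in> \<Gamma>"
  shows "inv\<^bsub>Aut\<^esub> h \<in> \<Gamma>"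
    and "x \<in> verts Q \<Longrightarrow> fst (inv\<^bsub>Aut\<^esub> h) (fst h x) = x" "x \<in> verts Q \<Longrightarrow> fst h (fst (inv\<^bsub>Aut\<^esub> h) x) = x"
    and "a \<in> arcs Q \<Longrightarrow> snd (inv\<^bsub>Aut\<^esub> h) (snd h a) = a" "a \<in> arcs Q \<Longrightarrow> snd h (snd (inv\<^bsub>Aut\<^esub> h) a) = a"
proof -
  have inv_eq: "inv\<^bsub>Aut\<^esub> h = (\<lambda>x\<in>verts Q. inv_into (verts Q) (fst h) x,
      \<lambda>a\<in>arcs Q. inv_into (arcs Q) (snd h) a)"
  proof -
    have "fst h \<in> carrier (BijGroup (verts Q))" "snd h \<in> carrier (BijGroup (arcs Q))"
      using deckD(1,2)[OF h] by (simp_all add: BijGroup_def)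
    from inv_DirProd[OF group_BijGroup group_BijGroup this] show ?thesis
      using deckD(1,2)[OF h] by (simp only: prod.collapse inv_BijGroup)
  qed
  have bij: "bij_betw (fst h) (verts Q) (verts Q)" "bij_betw (snd h) (arcs Q) (arcs Q)"
    using deckD(1,2)[OF h] by (simp_all add: Bij_def)
  have vert: "fst (inv\<^bsub>Aut\<^esub> h) x \<in> verts Q" "fst h (fst (inv\<^bsub>Aut\<^esub> h) x) = x"
    "fst (inv\<^bsub>Aut\<^esub> h) (fst h x) = x" if "x \<in> verts Q" for x
    using that bij(1) deckD(4)[OF h]
    by (auto simp: inv_eq bij_betw_inv_into_right bij_betw_inv_into_left
        intro: bij_betwE[OF bij_betw_inv_into, rule_format])
  have arc: "snd (inv\<^bsub>Aut\<^esub> h) a \<in> arcs Q" "snd h (snd (inv\<^bsub>Aut\<^esub> h) a) = a"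
    "snd (inv\<^bsub>Aut\<^esub> h) (snd h a) = a" if "a \<in> arcs Q" for a
    using that bij(2) deckD(5)[OF h]
    by (auto simp: inv_eq bij_betw_inv_into_right bij_betw_inv_into_left
        intro: bij_betwE[OF bij_betw_inv_into, rule_format])
  show "inv\<^bsub>Aut\<^esub> h \<in> \<Gamma>"
  proof (rule deckI)
    show "inv\<^bsub>Aut\<^esub> h \<in> carrier Aut" by (rule group.inv_closed[OF group_Aut deck_in_Aut[OF h]])
    fix x assume x: "x \<in> verts Q"
    show "fst f (fst (inv\<^bsub>Aut\<^esub> h) x) = fst f x"
      using deckD(8)[OF h vert(1)[OF x]] vert(2)[OF x] by simp
  next
    fix a assume a: "a \<in> arcs Q"
    let ?b = "snd (inv\<^bsub>Aut\<^esub> h) a"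
    show "snd f ?b = snd f a" using deckD(9)[OF h arc(1)[OF a]] arc(2)[OF a] by simp
    have "tail Q a = fst h (tail Q ?b)" "head Q a = fst h (head Q ?b)"
      using deckD(6,7)[OF h arc(1)[OF a]] arc(2)[OF a] by simp_all
    then show "tail Q ?b = fst (inv\<^bsub>Aut\<^esub> h) (tail Q a)" "head Q ?b = fst (inv\<^bsub>Aut\<^esub> h) (head Q a)"
      using vert(3)[of "tail Q ?b"] vert(3)[of "head Q ?b"] arc(1)[OF a] by simp_all
  qed
  show "x \<in> verts Q \<Longrightarrow> fst (inv\<^bsub>Aut\<^esub> h) (fst h x) = x" "x \<in> verts Q \<Longrightarrow> fst h (fst (inv\<^bsub>Aut\<^esub> h) x) = x"
    "a \<in> arcs Q \<Longrightarrow> snd (inv\<^bsub>Aut\<^esub> h) (snd h a) = a" "a \<in> arcs Q \<Longrightarrow> snd h (snd (inv\<^bsub>Aut\<^esub> h) a) = a"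
    using vert arc by simp_all
qed

lemma subgroup_deck: "subgroup \<Gamma> Aut"
  by (rule group.subgroupI[OF group_Aut])
    (use one_deck inv_deck(1) mult_deck deck_in_Aut in auto)

lemma supp_arcs: "\<rho> \<in> paths_lc Q x y \<Longrightarrow> p \<in> supp \<rho> \<Longrightarrow> a \<in> set p \<Longrightarrow> a \<in> arcs Q"
  using paths_lcD[of \<rho> Q x y p] by (auto simp: Q.awalk_def)

text \<open>A deck transformation does not change images under kf, and kf reflects membership in
  \<open>I\<close>.\<close>

lemma rquiver_morphism_deck:
  assumes h: "h \<in> \<Gamma>"
  shows "rquiver_morphism (Q, I) (Q, I) h"
proof -
  have "lc_map h \<rho> \<in> I (fst h x) (fst h y)"
    if v: "x \<in> verts Q" "y \<in> verts Q" and \<rho>: "\<rho> \<in> I x y" for x y \<rho>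
  proof -
    have \<rho>p: "\<rho> \<in> paths_lc Q x y" by (rule R.I_paths[OF v \<rho>])
    have "lc_map f (lc_map h \<rho>) = lc_map f \<rho>"
      by (rule lc_map_compose) (simp add: deckD(9)[OF h supp_arcs[OF \<rho>p]])
    then have "lc_map f (lc_map h \<rho>) \<in> I' (fst f (fst h x)) (fst f (fst h y))"
      using map_I[OF v \<rho>] v by (simp add: deckD(8)[OF h])
    then show ?thesis
      using lc_map_in_I'_iff[OF deckD(4)[OF h v(1)] deckD(4)[OF h v(2)]]
        lc_map_paths_lc[OF wf deckD(3)[OF h] \<rho>p] by simp
  qed
  then show ?thesis using rquiver deckD(3)[OF h] by (auto simp: rquiver_morphism_def)
qed

text \<open>If one end of an arrow is fixed, unique lifting fixes the arrow and hence its other end;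
  so the set of fixed vertices is closed along arrows in both directions, which is the form in which
  \<open>connected\<close> is assumed. Extensionality settles the values elsewhere.\<close>

lemma deck_free:
  assumes h: "h \<in> \<Gamma>" and x: "x \<in> verts Q" "fst h x = x"
  shows "h = \<one>\<^bsub>Aut\<^esub>"
proof -
  have fixed: "snd h a = a \<and> (fst h (tail Q a) = tail Q a \<and> fst h (head Q a) = head Q a)"
    if a: "a \<in> arcs Q" and e: "fst h (tail Q a) = tail Q a \<or> fst h (head Q a) = head Q a" for a
  proof -
    have "snd h a = a" using e
    proof
      assume "fst h (tail Q a) = tail Q a"
      then show ?thesis
        using a by (intro out_arc_unique) (simp_all add: deckD[OF h])
    next
      assume "fst h (head Q a) = head Q a"
      then show ?thesis
        using a by (intro in_arc_unique) (simp_all add: deckD[OF h])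
    qed
    then show ?thesis using deckD(6,7)[OF h a] by simp
  qed
  have S: "{y \<in> verts Q. fst h y = y} = verts Q"
  proof (rule connected)
    fix a assume a: "a \<in> arcs Q"
    have "fst h (tail Q a) = tail Q a \<longleftrightarrow> fst h (head Q a) = head Q a" using fixed[OF a] by blast
    then show "tail Q a \<in> {y \<in> verts Q. fst h y = y} \<longleftrightarrow> head Q a \<in> {y \<in> verts Q. fst h y = y}"
      by (simp add: a)
  qed (use x in auto)
  have fix_all: "fst h y = y" if "y \<in> verts Q" for y
  proof -
    have "y \<in> {y \<in> verts Q. fst h y = y}" unfolding S by (rule that)
    then show ?thesis by simp
  qed
  have "fst h y = fst \<one>\<^bsub>Aut\<^esub> y" for y
  proof (cases "y \<in> verts Q")
    case True
    then show ?thesis using fix_all by (simp add: one_Aut(1) del: one_DirProd)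
  next
    case False
    then show ?thesis using Bij_imp_extensional[OF deckD(1)[OF h]]
      by (simp add: BijGroup_def extensional_def)
  qed
  moreover have "snd h a = snd \<one>\<^bsub>Aut\<^esub> a" for a
  proof (cases "a \<in> arcs Q")
    case True
    have "fst h (tail Q a) = tail Q a" by (rule fix_all[OF Q.tail_in_verts[OF True]])
    then have "snd h a = a" using fixed[OF True] by blast
    then show ?thesis using True by (simp add: one_Aut(2) del: one_DirProd)
  next
    case False
    then show ?thesis using Bij_imp_extensional[OF deckD(2)[OF h]]
      by (simp add: BijGroup_def extensional_def)
  qed
  ultimately show ?thesis by (intro prod_eqI ext)
qed

section \<open>The orbit quiver\<close>

abbreviation "\<pi> \<equiv> orbit_proj \<Gamma>"

text \<open>Transitivity turns orbits into fibres, so that group elements disappear from the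
  description of the orbit quiver.\<close>

lemma orbit_vert: "fst \<pi> x = {y \<in> verts Q. fst f y = fst f x}" if x: "x \<in> verts Q"
  unfolding orbit_proj_def fst_conv
proof (intro Set.set_eqI iffI)
  fix y assume "y \<in> {y \<in> verts Q. fst f y = fst f x}"
  then obtain h where "h \<in> \<Gamma>" "fst h x = y" using transitive[OF x, of y] by auto
  then show "y \<in> {fst h x | h. h \<in> \<Gamma>}" by (intro CollectI exI[of _ h]) simp
qed (use x deckD(4,8) in auto)

text \<open>An arrow is determined by its tail and its image, so transitivity on vertices carries
  over to arrows.\<close>

lemma orbit_arc: "snd \<pi> a = {b \<in> arcs Q. snd f b = snd f a}" if a: "a \<in> arcs Q"
  unfolding orbit_proj_def snd_conv
proof (intro Set.set_eqI iffI)
  fix b assume b: "b \<in> {b \<in> arcs Q. snd f b = snd f a}"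
  then have "fst f (tail Q a) = fst f (tail Q b)"
    using a arc_map(2)[of a] arc_map(2)[of b] by auto
  then obtain h where h: "h \<in> \<Gamma>" "fst h (tail Q a) = tail Q b"
    using transitive[of "tail Q a" "tail Q b"] a b by auto
  have "snd h a = b"
    using a b h(2) by (intro out_arc_unique) (simp_all add: deckD[OF h(1)])
  then show "b \<in> {snd h a | h. h \<in> \<Gamma>}" using h(1) by (intro CollectI exI[of _ h]) simp
qed (use a deckD(5,9) in auto)

abbreviation "Qb \<equiv> fst (orbit_rquiver (Q, I) \<Gamma>)"
abbreviation "Ib \<equiv> snd (orbit_rquiver (Q, I) \<Gamma>)"

lemma verts_Qb: "verts Qb = fst \<pi> ` verts Q" and arcs_Qb: "arcs Qb = snd \<pi> ` arcs Q"
  by (simp_all add: orbit_rquiver_def)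

text \<open>The tails of the arrows in one orbit lie in one fibre, so \<open>the_elem\<close> is
  applied to a singleton.\<close>

lemma tail_Qb: "tail Qb (snd \<pi> a) = fst \<pi> (tail Q a)" if a: "a \<in> arcs Q"
proof -
  have e: "fst \<pi> (tail Q b) = fst \<pi> (tail Q a)" if "b \<in> snd \<pi> a" for b
  proof -
    have b: "b \<in> arcs Q" "snd f b = snd f a" using that a by (simp_all add: orbit_arc)
    have "fst f (tail Q b) = fst f (tail Q a)" using arc_map(2)[OF a] arc_map(2)[OF b(1)] b(2) by simp
    then show ?thesis using a b(1) by (simp add: orbit_vert)
  qed
  have "a \<in> snd \<pi> a" using a by (simp add: orbit_arc)
  then have "(\<lambda>b. fst \<pi> (tail Q a)) ` snd \<pi> a = {fst \<pi> (tail Q a)}" by (rule image_constant)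
  moreover have "(\<lambda>b. fst \<pi> (tail Q b)) ` snd \<pi> a = (\<lambda>b. fst \<pi> (tail Q a)) ` snd \<pi> a"
    by (intro image_cong refl e)
  ultimately show ?thesis by (simp add: orbit_rquiver_def)
qed

lemma head_Qb: "head Qb (snd \<pi> a) = fst \<pi> (head Q a)" if a: "a \<in> arcs Q"
proof -
  have e: "fst \<pi> (head Q b) = fst \<pi> (head Q a)" if "b \<in> snd \<pi> a" for b
  proof -
    have b: "b \<in> arcs Q" "snd f b = snd f a" using that a by (simp_all add: orbit_arc)
    have "fst f (head Q b) = fst f (head Q a)" using arc_map(3)[OF a] arc_map(3)[OF b(1)] b(2) by simp
    then show ?thesis using a b(1) by (simp add: orbit_vert)
  qed
  have "a \<in> snd \<pi> a" using a by (simp add: orbit_arc)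
  then have "(\<lambda>b. fst \<pi> (head Q a)) ` snd \<pi> a = {fst \<pi> (head Q a)}" by (rule image_constant)
  moreover have "(\<lambda>b. fst \<pi> (head Q b)) ` snd \<pi> a = (\<lambda>b. fst \<pi> (head Q a)) ` snd \<pi> a"
    by (intro image_cong refl e)
  ultimately show ?thesis by (simp add: orbit_rquiver_def)
qed

lemma wf_Qb: "wf_digraph Qb"
  by unfold_locales (auto simp: verts_Qb arcs_Qb tail_Qb head_Qb)

lemma morphism_\<pi>: "quiver_morphism Q Qb \<pi>"
  by (auto simp: quiver_morphism_def verts_Qb arcs_Qb tail_Qb head_Qb)

definition \<nu> :: "('v set, 'a set, 'w, 'b) quiver_map" where
  "\<nu> = (\<lambda>S. the_elem (fst f ` S), \<lambda>A. the_elem (snd f ` A))"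

lemma \<nu>_\<pi>_vert: "fst \<nu> (fst \<pi> x) = fst f x" if "x \<in> verts Q"
proof -
  have "fst f ` fst \<pi> x = {fst f x}" using that by (auto simp: orbit_vert)
  then show ?thesis by (simp add: \<nu>_def)
qed

lemma \<nu>_\<pi>_arc: "snd \<nu> (snd \<pi> a) = snd f a" if "a \<in> arcs Q"
proof -
  have "snd f ` snd \<pi> a = {snd f a}" using that by (auto simp: orbit_arc)
  then show ?thesis by (simp add: \<nu>_def)
qed

lemma morphism_\<nu>: "quiver_morphism Qb Q' \<nu>"
  by (auto simp: quiver_morphism_def verts_Qb arcs_Qb tail_Qb head_Qb \<nu>_\<pi>_vert \<nu>_\<pi>_arc vert_map arc_map)

lemma bij_\<nu>_vert: "bij_betw (fst \<nu>) (verts Qb) (verts Q')"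
proof (rule bij_betw_imageI)
  show "inj_on (fst \<nu>) (verts Qb)"
  proof (rule inj_onI, unfold verts_Qb, elim imageE)
    fix S T x y assume "fst \<nu> S = fst \<nu> T" "S = fst \<pi> x" "T = fst \<pi> y" "x \<in> verts Q" "y \<in> verts Q"
    then have "fst f x = fst f y" by (simp add: \<nu>_\<pi>_vert)
    then show "S = T" using \<open>x \<in> verts Q\<close> \<open>y \<in> verts Q\<close> \<open>S = _\<close> \<open>T = _\<close> by (simp add: orbit_vert)
  qed
  show "fst \<nu> ` verts Qb = verts Q'"
    unfolding verts_Qb image_image verts_surj[symmetric] by (intro image_cong refl \<nu>_\<pi>_vert)
qed

lemma bij_\<nu>_arc: "bij_betw (snd \<nu>) (arcs Qb) (arcs Q')"
proof (rule bij_betw_imageI)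
  show "inj_on (snd \<nu>) (arcs Qb)"
  proof (rule inj_onI, unfold arcs_Qb, elim imageE)
    fix S T a b assume "snd \<nu> S = snd \<nu> T" "S = snd \<pi> a" "T = snd \<pi> b" "a \<in> arcs Q" "b \<in> arcs Q"
    then have "snd f a = snd f b" by (simp add: \<nu>_\<pi>_arc)
    then show "S = T" using \<open>a \<in> arcs Q\<close> \<open>b \<in> arcs Q\<close> \<open>S = _\<close> \<open>T = _\<close> by (simp add: orbit_arc)
  qed
  have "snd f ` arcs Q = arcs Q'"
  proof (rule equalityI)
    show "arcs Q' \<subseteq> snd f ` arcs Q"
    proof
      fix a' assume a': "a' \<in> arcs Q'"
      then have "tail Q' a' \<in> fst f ` verts Q" by (simp add: verts_surj)
      then obtain x where x: "x \<in> verts Q" "tail Q' a' = fst f x" by auto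
      obtain a where "a \<in> arcs Q" "tail Q a = x" "snd f a = a'" by (rule out_arc_lift[OF x(1) a' x(2)])
      then show "a' \<in> snd f ` arcs Q" by auto
    qed
  qed (use arc_map(1) in auto)
  moreover have "snd \<nu> ` arcs Qb = snd f ` arcs Q"
    unfolding arcs_Qb image_image by (intro image_cong refl \<nu>_\<pi>_arc)
  ultimately show "snd \<nu> ` arcs Qb = arcs Q'" by simp
qed

lemma lc_map_\<nu>_\<pi>: "lc_map \<nu> (lc_map \<pi> \<sigma>) = lc_map f \<sigma>"
  if "\<And>p a. p \<in> supp \<sigma> \<Longrightarrow> a \<in> set p \<Longrightarrow> a \<in> arcs Q"
  by (rule lc_map_compose) (simp add: \<nu>_\<pi>_arc that)

lemma Ib_eq: "Ib S T = lc.span (\<Union>a\<in>S. \<Union>b\<in>T. lc_map \<pi> ` I a b)"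
  by (simp add: orbit_rquiver_def)

lemma Ib_subset:
  assumes v: "x \<in> verts Q" "y \<in> verts Q"
  shows "Ib (fst \<pi> x) (fst \<pi> y) \<subseteq> pullback_rels Qb \<nu> I' (fst \<pi> x) (fst \<pi> y)"
  unfolding Ib_eq
proof (rule lc.span_minimal)
  have "is_rquiver (Qb, pullback_rels Qb \<nu> I')"
    by (rule is_rquiver_pullback[OF wf_Qb morphism_\<nu> rquiver'])
  then show "lc.subspace (pullback_rels Qb \<nu> I' (fst \<pi> x) (fst \<pi> y))"
    by (rule rquiver.I_subspace[OF rquiver.intro]) (use v in \<open>auto simp: verts_Qb\<close>)
  show "(\<Union>a\<in>fst \<pi> x. \<Union>b\<in>fst \<pi> y. lc_map \<pi> ` I a b) \<subseteq> pullback_rels Qb \<nu> I' (fst \<pi> x) (fst \<pi> y)"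
  proof (intro UN_least image_subsetI)
    fix a b \<rho> assume *: "a \<in> fst \<pi> x" "b \<in> fst \<pi> y" "\<rho> \<in> I a b"
    then have ab: "a \<in> verts Q" "b \<in> verts Q" "fst f a = fst f x" "fst f b = fst f y"
      using v by (simp_all add: orbit_vert)
    have e: "fst \<pi> a = fst \<pi> x" "fst \<pi> b = fst \<pi> y" using ab v by (simp_all add: orbit_vert)
    have \<rho>: "\<rho> \<in> paths_lc Q a b" by (rule R.I_paths[OF ab(1,2) *(3)])
    have "lc_map \<nu> (lc_map \<pi> \<rho>) = lc_map f \<rho>" by (rule lc_map_\<nu>_\<pi>[OF supp_arcs[OF \<rho>]])
    then have "lc_map \<nu> (lc_map \<pi> \<rho>) \<in> I' (fst \<nu> (fst \<pi> x)) (fst \<nu> (fst \<pi> y))"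
      using map_I[OF ab(1,2) *(3)] ab(3,4) v by (simp add: \<nu>_\<pi>_vert)
    then show "lc_map \<pi> \<rho> \<in> pullback_rels Qb \<nu> I' (fst \<pi> x) (fst \<pi> y)"
      using lc_map_paths_lc[OF wf morphism_\<pi> \<rho>] by (simp add: pullback_rels_def e)
  qed
qed

text \<open>A lift along f from the fixed start \<open>x\<close> ends anywhere in the fibre of
  \<open>y\<close>, and this fibre is the orbit over which \<open>Ib\<close> collects its
  relations.\<close>

lemma Ib_lift:
  assumes v: "x \<in> verts Q" "y \<in> verts Q" and \<rho>': "\<rho>' \<in> I' (fst f x) (fst f y)"
  shows "\<exists>\<sigma> \<in> Ib (fst \<pi> x) (fst \<pi> y). lc_map \<nu> \<sigma> = \<rho>'"
proof -
  let ?B = "{b \<in> verts Q. fst f b = fst f y}"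
  obtain \<sigma> where \<sigma>: "\<sigma> \<in> lc.span (\<Union>b\<in>?B. I x b)" "lc_map f \<sigma> = \<rho>'"
    using I'_lift_from[OF v(1) vert_map[OF v(2)] \<rho>'] by auto
  have "supp \<sigma> \<subseteq> (\<Union>b\<in>?B. {p. Q.awalk x p b})"
    by (rule graded_lift.supp_span[OF graded_lift_from[OF v(1) vert_map[OF v(2)]] \<sigma>(1)])
  then have "a \<in> arcs Q" if "p \<in> supp \<sigma>" "a \<in> set p" for p a
    using that by (auto simp: Q.awalk_def)
  then have "lc_map \<nu> (lc_map \<pi> \<sigma>) = \<rho>'" unfolding \<sigma>(2)[symmetric] by (rule lc_map_\<nu>_\<pi>)
  moreover have "lc_map \<pi> \<sigma> \<in> Ib (fst \<pi> x) (fst \<pi> y)"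
    using \<sigma>(1)
  proof (induction rule: lc.span_induct_alt)
    case base
    then show ?case by (simp add: Ib_eq lc.span_zero)
  next
    case (step c \<rho> \<tau>)
    then obtain b where "b \<in> fst \<pi> y" "\<rho> \<in> I x b" using v(2) by (auto simp: orbit_vert)
    moreover have "x \<in> fst \<pi> x" using v(1) by (simp add: orbit_vert)
    ultimately have "lc_map \<pi> \<rho> \<in> Ib (fst \<pi> x) (fst \<pi> y)"
      unfolding Ib_eq by (intro lc.span_base) auto
    then show ?case
      using step(2) unfolding Ib_eq lc_map_linear by (intro lc.span_add lc.span_scale)
  qed
  ultimately show ?thesis by auto
qed

text \<open>A member of the preimage has the same image under k\<nu> as some element of
  \<open>Ib\<close>, and k\<nu> is injective since \<nu> is injective on arrows. From here
  \<open>Ib\<close> inherits the ideal property.\<close>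

lemma Ib_eq_pullback:
  assumes v: "x \<in> verts Q" "y \<in> verts Q"
  shows "Ib (fst \<pi> x) (fst \<pi> y) = pullback_rels Qb \<nu> I' (fst \<pi> x) (fst \<pi> y)"
proof (rule equalityI[OF Ib_subset[OF v] subsetI])
  fix \<rho> assume \<rho>: "\<rho> \<in> pullback_rels Qb \<nu> I' (fst \<pi> x) (fst \<pi> y)"
  then have "lc_map \<nu> \<rho> \<in> I' (fst f x) (fst f y)" using v by (simp add: pullback_rels_def \<nu>_\<pi>_vert)
  then obtain \<sigma> where \<sigma>: "\<sigma> \<in> Ib (fst \<pi> x) (fst \<pi> y)" "lc_map \<nu> \<sigma> = lc_map \<nu> \<rho>"
    using Ib_lift[OF v] by auto
  have "\<sigma> \<in> pullback_rels Qb \<nu> I' (fst \<pi> x) (fst \<pi> y)" by (rule subsetD[OF Ib_subset[OF v] \<sigma>(1)])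
  then have p: "supp \<sigma> \<subseteq> {p. set p \<subseteq> arcs Qb}" "supp \<rho> \<subseteq> {p. set p \<subseteq> arcs Qb}"
    using \<rho> by (auto simp: pullback_rels_def paths_lc_def pre_digraph.awalk_def)
  have "inj_on (map (snd \<nu>)) {p. set p \<subseteq> arcs Qb}"
  proof (rule inj_onI)
    fix p q assume pq: "p \<in> {p. set p \<subseteq> arcs Qb}" "q \<in> {p. set p \<subseteq> arcs Qb}"
      and eq: "map (snd \<nu>) p = map (snd \<nu>) q"
    have "inj_on (snd \<nu>) (set p \<union> set q)"
      by (rule inj_on_subset[OF bij_betw_imp_inj_on[OF bij_\<nu>_arc]]) (use pq in simp)
    from inj_on_map_eq_map[OF this] eq show "p = q" by simp
  qed
  from inj_onD[OF lc_map_inj_on[OF this] \<sigma>(2)] p have "\<sigma> = \<rho>" by simp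
  then show "\<rho> \<in> Ib (fst \<pi> x) (fst \<pi> y)" using \<sigma>(1) by simp
qed

lemma rquiver_iso_\<nu>: "rquiver_iso (orbit_rquiver (Q, I) \<Gamma>) (Q', I') \<nu>"
proof -
  have "is_rquiver (Qb, Ib) \<longleftrightarrow> is_rquiver (Qb, pullback_rels Qb \<nu> I')"
    by (rule is_rquiver_cong) (auto simp: verts_Qb Ib_eq_pullback)
  then have rq: "is_rquiver (orbit_rquiver (Q, I) \<Gamma>)"
    using is_rquiver_pullback[OF wf_Qb morphism_\<nu> rquiver'] by simp
  have im: "lc_map \<nu> ` Ib S T = I' (fst \<nu> S) (fst \<nu> T)" if S: "S \<in> verts Qb" and T: "T \<in> verts Qb" for S T
  proof -
    obtain x y where v: "x \<in> verts Q" "y \<in> verts Q" and ST: "S = fst \<pi> x" "T = fst \<pi> y"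
      using S T unfolding verts_Qb by auto
    show ?thesis
    proof (intro equalityI subsetI)
      fix \<rho>' assume "\<rho>' \<in> lc_map \<nu> ` Ib S T"
      then show "\<rho>' \<in> I' (fst \<nu> S) (fst \<nu> T)"
        unfolding ST Ib_eq_pullback[OF v] by (auto simp: pullback_rels_def)
    next
      fix \<rho>' assume "\<rho>' \<in> I' (fst \<nu> S) (fst \<nu> T)"
      then have "\<rho>' \<in> I' (fst f x) (fst f y)" using v by (simp add: ST \<nu>_\<pi>_vert)
      then show "\<rho>' \<in> lc_map \<nu> ` Ib S T" using Ib_lift[OF v] unfolding ST by auto
    qed
  qed
  then show ?thesis
    using rq rquiver' morphism_\<nu> bij_\<nu>_vert bij_\<nu>_arc
    by (simp add: rquiver_iso_def rquiver_morphism_def)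
qed

lemma galois_covering: "rquiver_galois_covering (Q, I) (Q', I') f"
proof -
  have "rquiver_aut_group (Q, I) \<Gamma>"
    using subgroup_deck rquiver_morphism_deck by (simp add: rquiver_aut_group_def)
  moreover have "quiver_acts_freely Q \<Gamma>"
    unfolding quiver_acts_freely_def by (intro ballI impI deck_free)
  ultimately show ?thesis
    unfolding rquiver_galois_covering_def fst_conv
    using rquiver_morphism rquiver_iso_\<nu> \<nu>_\<pi>_vert \<nu>_\<pi>_arc
    by (intro conjI exI[of _ \<Gamma>] exI[of _ \<nu>]) simp_all
qed

end

section \<open>Deck transformations as automorphisms of the category\<close>

context rquiver_galois
begin

abbreviation "F \<equiv> rquiver_functor (Q', I') f"

text \<open>Made extensional, because elements of \<open>kaut_group\<close> are compared by
  equality.\<close>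

definition deck_functor where
  "deck_functor h = kfun_restrict R.M (rquiver_functor (Q, I) h)"

lemma FOb_deck: "x \<in> verts Q \<Longrightarrow> FOb (deck_functor h) x = fst h x"
  by (simp add: deck_functor_def) (simp add: rquiver_functor_def)

lemma FHom_deck:
  assumes "h \<in> \<Gamma>" "x \<in> verts Q" "y \<in> verts Q" "\<rho> \<in> paths_lc Q x y"
  shows "FHom (deck_functor h) x y (\<rho> +o I x y) = lc_map h \<rho> +o I (fst h x) (fst h y)"
  using assms
  by (simp add: deck_functor_def R.coset_in_Hom FHom_rquiver_functor[OF rquiver_morphism_deck])

lemma deck_paths:
  assumes "h \<in> \<Gamma>" "\<rho> \<in> paths_lc Q x y"
  shows "lc_map h \<rho> \<in> paths_lc Q (fst h x) (fst h y)"
  by (rule lc_map_paths_lc[OF wf deckD(3)[OF assms(1)] assms(2)])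

lemma lc_map_mult:
  assumes h: "h \<in> \<Gamma>" "h' \<in> \<Gamma>" and \<rho>: "\<rho> \<in> paths_lc Q x y"
  shows "lc_map h (lc_map h' \<rho>) = lc_map (h \<otimes>\<^bsub>Aut\<^esub> h') \<rho>"
  by (rule lc_map_compose) (simp only: mult_Aut(2)[OF h supp_arcs[OF \<rho>]])

lemma lc_map_one:
  assumes \<rho>: "\<rho> \<in> paths_lc Q x y"
  shows "lc_map \<one>\<^bsub>Aut\<^esub> \<rho> = \<rho>"
  by (rule lc_map_ident) (simp only: one_Aut(2)[OF supp_arcs[OF \<rho>]])

lemma deck_functor_mult:
  assumes h: "h \<in> \<Gamma>" "h' \<in> \<Gamma>"
  shows "deck_functor h \<otimes>\<^bsub>kaut_group R.M\<^esub> deck_functor h' = deck_functor (h \<otimes>\<^bsub>Aut\<^esub> h')"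
proof -
  have "kfun_restrict R.M (kfun_comp (deck_functor h) (deck_functor h'))
      = kfun_restrict R.M (deck_functor (h \<otimes>\<^bsub>Aut\<^esub> h'))"
  proof (rule kfun_restrict_eqI)
    fix x assume "x \<in> Ob R.M"
    then have x: "x \<in> verts Q" by simp
    show "FOb (kfun_comp (deck_functor h) (deck_functor h')) x = FOb (deck_functor (h \<otimes>\<^bsub>Aut\<^esub> h')) x"
      by (simp only: kfun_comp_simps FOb_deck x deckD(4)[OF h(2)] mult_Aut(1)[OF h])
    fix y u assume "y \<in> Ob R.M" and u: "u \<in> carrier (Hom R.M x y)"
    then have y: "y \<in> verts Q" by simp
    obtain \<rho> where \<rho>: "\<rho> \<in> paths_lc Q x y" "u = \<rho> +o I x y" using u by (rule R.HomE)
    show "FHom (kfun_comp (deck_functor h) (deck_functor h')) x y u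
        = FHom (deck_functor (h \<otimes>\<^bsub>Aut\<^esub> h')) x y u"
      unfolding \<rho>(2)
      by (simp only: kfun_comp_simps FOb_deck x y FHom_deck[OF h(2) x y \<rho>(1)]
          FHom_deck[OF h(1) deckD(4)[OF h(2) x] deckD(4)[OF h(2) y] deck_paths[OF h(2) \<rho>(1)]]
          FHom_deck[OF mult_deck[OF h] x y \<rho>(1)] lc_map_mult[OF h \<rho>(1)] mult_Aut(1)[OF h x]
          mult_Aut(1)[OF h y])
  qed
  also have "\<dots> = deck_functor (h \<otimes>\<^bsub>Aut\<^esub> h')"
    unfolding deck_functor_def by (rule kfun_restrict_eqI) simp_all
  finally show ?thesis by (simp only: kaut_group_mult)
qed

lemma deck_functor_one: "deck_functor \<one>\<^bsub>Aut\<^esub> = \<one>\<^bsub>kaut_group R.M\<^esub>"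
proof -
  have "kfun_restrict R.M (deck_functor \<one>\<^bsub>Aut\<^esub>) =
      kfun_restrict R.M \<lparr>FOb = (\<lambda>x. x), FHom = (\<lambda>x y u. u)\<rparr>"
  proof (rule kfun_restrict_eqI)
    fix x assume "x \<in> Ob R.M"
    then have x: "x \<in> verts Q" by simp
    show "FOb (deck_functor \<one>\<^bsub>Aut\<^esub>) x = FOb \<lparr>FOb = (\<lambda>x. x), FHom = (\<lambda>x y u. u)\<rparr> x"
      by (simp only: FOb_deck[OF x] one_Aut(1)[OF x] kfun.simps)
    fix y u assume "y \<in> Ob R.M" and u: "u \<in> carrier (Hom R.M x y)"
    then have y: "y \<in> verts Q" by simp
    obtain \<rho> where \<rho>: "\<rho> \<in> paths_lc Q x y" "u = \<rho> +o I x y" using u by (rule R.HomE)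
    show "FHom (deck_functor \<one>\<^bsub>Aut\<^esub>) x y u = FHom \<lparr>FOb = (\<lambda>x. x), FHom = (\<lambda>x y u. u)\<rparr> x y u"
      unfolding \<rho>(2)
      by (simp only: FHom_deck[OF one_deck x y \<rho>(1)] lc_map_one[OF \<rho>(1)] one_Aut(1)[OF x]
          one_Aut(1)[OF y] kfun.simps)
  qed
  moreover have "kfun_restrict R.M (deck_functor \<one>\<^bsub>Aut\<^esub>) = deck_functor \<one>\<^bsub>Aut\<^esub>"
    unfolding deck_functor_def by (rule kfun_restrict_eqI) simp_all
  ultimately show ?thesis by (simp only: kaut_group_one)
qed

lemma inv_mult:
  assumes "h \<in> \<Gamma>"
  shows "inv\<^bsub>Aut\<^esub> h \<otimes>\<^bsub>Aut\<^esub> h = \<one>\<^bsub>Aut\<^esub>" "h \<otimes>\<^bsub>Aut\<^esub> inv\<^bsub>Aut\<^esub> h = \<one>\<^bsub>Aut\<^esub>"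
  using group.l_inv[OF group_Aut deck_in_Aut[OF assms]] group.r_inv[OF group_Aut deck_in_Aut[OF assms]]
  by blast+

text \<open>The inverse map is the functor of the inverse deck transformation; both composites are
  computed on representatives.\<close>

lemma bij_FHom_deck:
  assumes h: "h \<in> \<Gamma>" and v: "x \<in> verts Q" "y \<in> verts Q"
  shows "bij_betw (FHom (deck_functor h) x y) (carrier (Hom R.M x y))
    (carrier (Hom R.M (fst h x) (fst h y)))"
proof (rule bij_betwI)
  let ?h = "inv\<^bsub>Aut\<^esub> h"
  note h' = inv_deck(1)[OF h]
  note v' = deckD(4)[OF h v(1)] deckD(4)[OF h v(2)]
  show "FHom (deck_functor h) x y \<in> carrier (Hom R.M x y) \<rightarrow> carrier (Hom R.M (fst h x) (fst h y))"
  proof (rule Pi_I)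
    fix u assume "u \<in> carrier (Hom R.M x y)"
    then obtain \<rho> where \<rho>: "\<rho> \<in> paths_lc Q x y" "u = \<rho> +o I x y" by (rule R.HomE)
    show "FHom (deck_functor h) x y u \<in> carrier (Hom R.M (fst h x) (fst h y))"
      unfolding \<rho>(2) FHom_deck[OF h v \<rho>(1)] by (intro R.coset_in_Hom deck_paths h \<rho>(1))
  qed
  show "FHom (deck_functor ?h) (fst h x) (fst h y) \<in>
      carrier (Hom R.M (fst h x) (fst h y)) \<rightarrow> carrier (Hom R.M x y)"
  proof (rule Pi_I)
    fix u assume "u \<in> carrier (Hom R.M (fst h x) (fst h y))"
    then obtain \<rho> where \<rho>: "\<rho> \<in> paths_lc Q (fst h x) (fst h y)" "u = \<rho> +o I (fst h x) (fst h y)"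
      by (rule R.HomE)
    have "lc_map ?h \<rho> \<in> paths_lc Q x y"
      using deck_paths[OF h' \<rho>(1)] by (simp only: inv_deck(2)[OF h] v)
    then show "FHom (deck_functor ?h) (fst h x) (fst h y) u \<in> carrier (Hom R.M x y)"
      unfolding \<rho>(2) FHom_deck[OF h' v' \<rho>(1)] inv_deck(2)[OF h v(1)] inv_deck(2)[OF h v(2)]
      by (rule R.coset_in_Hom)
  qed
next
  let ?h = "inv\<^bsub>Aut\<^esub> h"
  note h' = inv_deck(1)[OF h]
  note v' = deckD(4)[OF h v(1)] deckD(4)[OF h v(2)]
  fix u assume "u \<in> carrier (Hom R.M x y)"
  then obtain \<rho> where \<rho>: "\<rho> \<in> paths_lc Q x y" "u = \<rho> +o I x y" by (rule R.HomE)
  show "FHom (deck_functor ?h) (fst h x) (fst h y) (FHom (deck_functor h) x y u) = u"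
    unfolding \<rho>(2)
    by (simp only: FHom_deck[OF h v \<rho>(1)] FHom_deck[OF h' v' deck_paths[OF h \<rho>(1)]]
        lc_map_mult[OF h' h \<rho>(1)] inv_mult(1)[OF h] lc_map_one[OF \<rho>(1)] inv_deck(2)[OF h v(1)]
        inv_deck(2)[OF h v(2)])
next
  let ?h = "inv\<^bsub>Aut\<^esub> h"
  note h' = inv_deck(1)[OF h]
  note v' = deckD(4)[OF h v(1)] deckD(4)[OF h v(2)]
  fix u assume "u \<in> carrier (Hom R.M (fst h x) (fst h y))"
  then obtain \<rho> where \<rho>: "\<rho> \<in> paths_lc Q (fst h x) (fst h y)" "u = \<rho> +o I (fst h x) (fst h y)"
    by (rule R.HomE)
  have p: "lc_map ?h \<rho> \<in> paths_lc Q x y"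
    using deck_paths[OF h' \<rho>(1)] by (simp only: inv_deck(2)[OF h] v)
  show "FHom (deck_functor h) x y (FHom (deck_functor ?h) (fst h x) (fst h y) u) = u"
    unfolding \<rho>(2)
    by (simp only: FHom_deck[OF h' v' \<rho>(1)] inv_deck(2)[OF h v(1)] inv_deck(2)[OF h v(2)]
        FHom_deck[OF h v p] lc_map_mult[OF h h' \<rho>(1)] inv_mult(2)[OF h] lc_map_one[OF \<rho>(1)])
qed

lemma deck_functor_in_kaut:
  assumes h: "h \<in> \<Gamma>"
  shows "deck_functor h \<in> carrier (kaut_group R.M)"
proof -
  have "kfunctor R.M R.M (deck_functor h)"
    unfolding deck_functor_def
    by (rule kfunctor_restrict[OF kfunctor_rquiver_functor[OF rquiver_morphism_deck[OF h]]])
  moreover have "kfun_restrict R.M (deck_functor h) = deck_functor h"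
    unfolding deck_functor_def by (rule kfun_restrict_eqI) simp_all
  moreover have "bij_betw (FOb (deck_functor h)) (Ob R.M) (Ob R.M)"
  proof -
    have "bij_betw (fst h) (verts Q) (verts Q)" using deckD(1)[OF h] by (simp add: Bij_def)
    moreover have "bij_betw (FOb (deck_functor h)) (verts Q) (verts Q) = bij_betw (fst h) (verts Q) (verts Q)"
      by (rule bij_betw_cong) (rule FOb_deck)
    ultimately show ?thesis by simp
  qed
  moreover have "\<forall>x\<in>Ob R.M. \<forall>y\<in>Ob R.M. bij_betw (FHom (deck_functor h) x y) (carrier (Hom R.M x y))
      (carrier (Hom R.M (FOb (deck_functor h) x) (FOb (deck_functor h) y)))"
  proof (intro ballI)
    fix x y assume "x \<in> Ob R.M" "y \<in> Ob R.M"
    then have v: "x \<in> verts Q" "y \<in> verts Q" by simp_all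
    show "bij_betw (FHom (deck_functor h) x y) (carrier (Hom R.M x y))
        (carrier (Hom R.M (FOb (deck_functor h) x) (FOb (deck_functor h) y)))"
      unfolding FOb_deck[OF v(1)] FOb_deck[OF v(2)] by (rule bij_FHom_deck[OF h v])
  qed
  ultimately show ?thesis by (simp only: kaut_group_def partial_object.simps mem_Collect_eq)
qed

lemma subgroup_deck_functor: "subgroup (deck_functor ` \<Gamma>) (kaut_group R.M)"
proof (rule subgroup.intro)
  show "deck_functor ` \<Gamma> \<subseteq> carrier (kaut_group R.M)"
    by (intro image_subsetI deck_functor_in_kaut)
  show "\<one>\<^bsub>kaut_group R.M\<^esub> \<in> deck_functor ` \<Gamma>"
    unfolding deck_functor_one[symmetric] by (rule imageI[OF one_deck])
next
  fix k k' assume "k \<in> deck_functor ` \<Gamma>" "k' \<in> deck_functor ` \<Gamma>"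
  then obtain h h' where h: "h \<in> \<Gamma>" "h' \<in> \<Gamma>" and k: "k = deck_functor h" "k' = deck_functor h'"
    by (elim imageE)
  show "k \<otimes>\<^bsub>kaut_group R.M\<^esub> k' \<in> deck_functor ` \<Gamma>"
    unfolding k deck_functor_mult[OF h] by (rule imageI[OF mult_deck[OF h]])
next
  fix k assume "k \<in> deck_functor ` \<Gamma>"
  then obtain h where h: "h \<in> \<Gamma>" and k: "k = deck_functor h" by (elim imageE)
  note h' = inv_deck(1)[OF h]
  have "inv\<^bsub>kaut_group R.M\<^esub> k = deck_functor (inv\<^bsub>Aut\<^esub> h)"
    unfolding k
    by (rule kaut_group_inv_equality[OF deck_functor_in_kaut[OF h] deck_functor_in_kaut[OF h']])
      (simp_all only: deck_functor_mult[OF h h'] deck_functor_mult[OF h' h] inv_mult[OF h] deck_functor_one)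
  then show "inv\<^bsub>kaut_group R.M\<^esub> k \<in> deck_functor ` \<Gamma>" using imageI[OF h'] by simp
qed

text \<open>On objects \<open>deck_functor h\<close> acts as \<open>fst h\<close>, so freeness and
  transitivity come from the deck group; on morphisms F absorbs h because kf does.\<close>

lemma galois_covering_functor:
  assumes "locally_bounded R.M" "locally_bounded R'.M"
  shows "galois_covering_functor R.M R'.M F"
  unfolding galois_covering_functor_def
proof (intro conjI exI[of _ "deck_functor ` \<Gamma>"] ballI impI)
  show "FOb F ` Ob R.M = Ob R'.M"
    using verts_surj by (simp add: rquiver_functor_def)
next
  fix k x assume "k \<in> deck_functor ` \<Gamma>" and "x \<in> Ob R.M" and stab: "FOb k x = x"
  then obtain h where h: "h \<in> \<Gamma>" and k: "k = deck_functor h" and x: "x \<in> verts Q" by auto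
  have "fst h x = x" using stab unfolding k FOb_deck[OF x] .
  then have "h = \<one>\<^bsub>Aut\<^esub>" by (rule deck_free[OF h x])
  then show "k = \<one>\<^bsub>kaut_group R.M\<^esub>" by (simp only: k deck_functor_one)
next
  fix k assume "k \<in> deck_functor ` \<Gamma>"
  then obtain h where h: "h \<in> \<Gamma>" and k: "k = deck_functor h" by (elim imageE)
  have FOF: "FOb F = fst f" by (simp add: rquiver_functor_def)
  show "kfun_restrict R.M (kfun_comp F k) = kfun_restrict R.M F"
  proof (rule kfun_restrict_eqI)
    fix x assume "x \<in> Ob R.M"
    then have x: "x \<in> verts Q" by simp
    show "FOb (kfun_comp F k) x = FOb F x"
      by (simp only: k kfun_comp_simps FOF FOb_deck[OF x] deckD(8)[OF h x])
    fix y u assume "y \<in> Ob R.M" and u: "u \<in> carrier (Hom R.M x y)"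
    then have y: "y \<in> verts Q" by simp
    obtain \<rho> where \<rho>: "\<rho> \<in> paths_lc Q x y" "u = \<rho> +o I x y" using u by (rule R.HomE)
    have "lc_map f (lc_map h \<rho>) = lc_map f \<rho>"
      by (rule lc_map_compose) (simp only: deckD(9)[OF h supp_arcs[OF \<rho>(1)]])
    then show "FHom (kfun_comp F k) x y u = FHom F x y u"
      unfolding k \<rho>(2)
      by (simp only: kfun_comp_simps FOb_deck[OF x] FOb_deck[OF y] FHom_deck[OF h x y \<rho>(1)]
          FHom_rquiver_functor[OF rquiver_morphism deckD(4)[OF h x] deckD(4)[OF h y]]
          FHom_rquiver_functor[OF rquiver_morphism x y] deckD(8)[OF h x] deckD(8)[OF h y])
  qed
next
  fix x y assume "x \<in> Ob R.M" "y \<in> Ob R.M" "FOb F x = FOb F y"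
  then have v: "x \<in> verts Q" "y \<in> verts Q" "fst f x = fst f y"
    by (simp_all add: rquiver_functor_def)
  then obtain h where h: "h \<in> \<Gamma>" "fst h x = y" using transitive[OF v] by auto
  show "\<exists>k\<in>deck_functor ` \<Gamma>. FOb k x = y"
    by (rule bexI[OF _ imageI[OF h(1)]]) (simp only: FOb_deck[OF v(1)] h(2))
qed (use assms covering_functor subgroup_deck_functor in simp_all)

end

section \<open>Fractional Brauer configurations\<close>

lemma partition_class:
  assumes P: "partition_on A P" and x: "x \<in> A"
  shows "(THE S. S \<in> P \<and> x \<in> S) \<in> P" "x \<in> (THE S. S \<in> P \<and> x \<in> S)"
    and "S \<in> P \<Longrightarrow> x \<in> S \<Longrightarrow> (THE S. S \<in> P \<and> x \<in> S) = S"
proof -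
  have "x \<in> \<Union>P" using partition_onD1[OF P] x by simp
  moreover have "S = T" if "S \<in> P" "T \<in> P" "x \<in> S" "x \<in> T" for S T
    using disjointD[OF partition_onD2[OF P] that(1,2)] that(3,4) by blast
  ultimately have un: "\<exists>!S. S \<in> P \<and> x \<in> S" by auto
  from theI'[OF un] show "(THE S. S \<in> P \<and> x \<in> S) \<in> P" "x \<in> (THE S. S \<in> P \<and> x \<in> S)" by auto
  show "S \<in> P \<Longrightarrow> x \<in> S \<Longrightarrow> (THE S. S \<in> P \<and> x \<in> S) = S"
    by (rule the1_equality[OF un]) simp
qed

lemma gen_ideal_base:
  assumes "r \<in> R x y" "r \<in> paths_lc Q x y" "x \<in> verts Q" "y \<in> verts Q"
  shows "r \<in> gen_ideal Q R x y"
  using assms unfolding gen_ideal_def by blast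

lemma awalk_ends_unique:
  assumes "pre_digraph.awalk Q x p y" "pre_digraph.awalk Q x' p y'" "p \<noteq> []"
  shows "x = x'" "y = y'"
proof -
  show "x = x'"
    using assms by (cases p) (auto simp: pre_digraph.awalk_def pre_digraph.cas.simps)
  then show "y = y'" using assms awalk_end_unique[of Q x p y y'] by simp
qed

lemma length_Lseq [simp]: "length (Lseq E e n) = n"
  by (simp add: Lseq_def)

lemma Lseq_0 [simp]: "Lseq E e 0 = []"
  by (simp add: Lseq_def)

lemma nth_Lseq: "i < n \<Longrightarrow> Lseq E e n ! i = Lcls E (act E (int i) e)"
  by (simp add: Lseq_def)

lemma Lseq_Suc: "Lseq E e (Suc n) = Lseq E e n @ [Lcls E (act E (int n) e)]"
  by (simp add: Lseq_def)

lemma Lseq_eq_Nil_iff [simp]: "Lseq E e n = [] \<longleftrightarrow> n = 0"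
  by (metis length_0_conv length_Lseq)

abbreviation fR :: "'e fbc \<Rightarrow> ('e set, 'e set, 'k::field) path_rels" where
  "fR E x y \<equiv> fR1 E x y \<union> fR2 E x y \<union> fR3 E x y"

context fBC
begin

interpretation G: group_action integer_group "elems E" "act E" by (rule G_set)

lemma act_closed [simp]: "e \<in> elems E \<Longrightarrow> act E n e \<in> elems E"
  using G.element_image[of n e] by simp

lemma act_0 [simp]: "e \<in> elems E \<Longrightarrow> act E 0 e = e"
  using fun_cong[OF G.id_eq_one, of e] by simp

lemma act_act [simp]: "e \<in> elems E \<Longrightarrow> act E m (act E n e) = act E (m + n) e"
  using G.composition_rule[of e m n] by simp

lemma Pcls_self: "e \<in> elems E \<Longrightarrow> e \<in> Pcls E e"
  unfolding Pcls_def by (rule partition_class(2)[OF P_partition])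

lemma Lcls_self: "e \<in> elems E \<Longrightarrow> e \<in> Lcls E e"
  unfolding Lcls_def by (rule partition_class(2)[OF L_partition])

lemma Pcls_subset: "e \<in> elems E \<Longrightarrow> Pcls E e \<subseteq> elems E"
  unfolding Pcls_def partition_onD1[OF P_partition]
  by (rule Union_upper[OF partition_class(1)[OF P_partition, unfolded partition_onD1[OF P_partition]]])

lemma Lcls_subset: "e \<in> elems E \<Longrightarrow> Lcls E e \<subseteq> elems E"
  unfolding Lcls_def partition_onD1[OF L_partition]
  by (rule Union_upper[OF partition_class(1)[OF L_partition, unfolded partition_onD1[OF L_partition]]])

lemma Pcls_eq:
  assumes e: "e \<in> elems E" and x: "x \<in> Pcls E e"
  shows "Pcls E x = Pcls E e"
proof -
  have "x \<in> elems E" using Pcls_subset[OF e] x by auto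
  moreover have "Pcls E e \<in> Pparts E" unfolding Pcls_def by (rule partition_class(1)[OF P_partition e])
  ultimately show ?thesis
    unfolding Pcls_def[of E x] using x by (intro partition_class(3)[OF P_partition])
qed

lemma Lcls_eq:
  assumes e: "e \<in> elems E" and x: "x \<in> Lcls E e"
  shows "Lcls E x = Lcls E e"
proof -
  have "x \<in> elems E" using Lcls_subset[OF e] x by auto
  moreover have "Lcls E e \<in> Lparts E" unfolding Lcls_def by (rule partition_class(1)[OF L_partition e])
  ultimately show ?thesis
    unfolding Lcls_def[of E x] using x by (intro partition_class(3)[OF L_partition])
qed

lemma Lcls_eq_imp_Pcls_eq:
  assumes "e \<in> elems E" "h \<in> elems E" "Lcls E e = Lcls E h"
  shows "Pcls E e = Pcls E h"
proof -
  have "e \<in> Lcls E h" using Lcls_self[OF assms(1)] assms(3) by simp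
  then have "e \<in> Pcls E h" using f1[OF assms(2)] by auto
  then show ?thesis by (rule Pcls_eq[OF assms(2)])
qed

section \<open>The quiver of a configuration and its generating relations\<close>

abbreviation "Q \<equiv> fBC_quiver E"

lemma verts_Q [simp]: "verts Q = Pcls E ` elems E" and arcs_Q [simp]: "arcs Q = Lcls E ` elems E"
  by (simp_all add: fBC_quiver_def)

lemma tail_Q: "tail Q (Lcls E e) = Pcls E e" if e: "e \<in> elems E"
proof -
  have "Pcls E x = Pcls E e" if "x \<in> Lcls E e" for x
    using f1[OF e] that by (intro Pcls_eq[OF e]) auto
  then have "Pcls E ` Lcls E e = (\<lambda>x. Pcls E e) ` Lcls E e" by (intro image_cong refl)
  also have "\<dots> = {Pcls E e}" by (rule image_constant[OF Lcls_self[OF e]])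
  finally show ?thesis by (simp add: fBC_quiver_def)
qed

lemma head_Q: "head Q (Lcls E e) = Pcls E (act E 1 e)" if e: "e \<in> elems E"
proof -
  have "Pcls E (act E 1 x) = Pcls E (act E 1 e)" if x: "x \<in> Lcls E e" for x
    using Lcls_subset[OF e] x Lcls_eq[OF e x] by (intro f2 e) auto
  then have "(\<lambda>x. Pcls E (act E 1 x)) ` Lcls E e = (\<lambda>x. Pcls E (act E 1 e)) ` Lcls E e"
    by (intro image_cong refl)
  also have "\<dots> = {Pcls E (act E 1 e)}" by (rule image_constant[OF Lcls_self[OF e]])
  finally show ?thesis by (simp add: fBC_quiver_def)
qed

lemma wf_Q: "wf_digraph Q"
  by unfold_locales (auto simp: tail_Q head_Q)

sublocale Q: wf_digraph Q by (rule wf_Q)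

lemma awalk_Lseq:
  assumes e: "e \<in> elems E"
  shows "Q.awalk (Pcls E e) (Lseq E e n) (Pcls E (act E (int n) e))"
proof (induction n)
  case 0
  then show ?case using e by (simp add: Q.awalk_Nil_iff)
next
  case (Suc n)
  have "Q.awalk (Pcls E (act E (int n) e)) [Lcls E (act E (int n) e)] (Pcls E (act E (int (Suc n)) e))"
    using e by (auto simp: Q.awalk_Cons_iff Q.awalk_Nil_iff tail_Q head_Q)
  with Suc show ?case unfolding Lseq_Suc by (rule Q.awalk_appendI)
qed

text \<open>A common element \<open>h\<close> of the translated classes is the last member of a
  sequence of successive translates whose arrows are exactly \<open>p\<close>. This replaces the
  intersection in (fR2) by the absence of such a sequence.\<close>

lemma Inter_nonempty_iff:
  assumes p: "set p \<subseteq> arcs Q" and ne: "p \<noteq> []"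
  shows "(\<Inter>i\<in>{..<length p}. act E (int (length p) - int (i + 1)) ` (p ! i)) \<noteq> {} \<longleftrightarrow>
    (\<exists>e \<in> elems E. p = Lseq E e (length p))"
proof
  let ?n = "length p"
  assume "(\<Inter>i\<in>{..<?n}. act E (int ?n - int (i + 1)) ` (p ! i)) \<noteq> {}"
  then obtain h where h: "\<And>i. i < ?n \<Longrightarrow> h \<in> act E (int ?n - int (i + 1)) ` (p ! i)" by auto
  have sub: "p ! i \<subseteq> elems E" if "i < ?n" for i
  proof -
    have "p ! i \<in> Lcls E ` elems E" using p that by auto
    then show ?thesis using Lcls_subset by auto
  qed
  have he: "h \<in> elems E" using h[of 0] sub[of 0] ne by auto
  \<comment> \<open>The first arrow is translated by \<open>?n - 1\<close>, so moving back from
    \<open>h\<close> by this exponent gives the starting element.\<close>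
  define e where "e = act E (1 - int ?n) h"
  have e: "e \<in> elems E" using he by (simp add: e_def)
  have "p ! i = Lseq E e ?n ! i" if i: "i < ?n" for i
  proof -
    obtain x where x: "x \<in> p ! i" "h = act E (int ?n - int (i + 1)) x" using h[OF i] by auto
    have xe: "x \<in> elems E" using sub[OF i] x(1) by auto
    have "act E (int i) e = x" using xe he by (simp add: e_def x(2))
    moreover obtain y where "y \<in> elems E" "p ! i = Lcls E y" using p i by (auto dest: nth_mem)
    then have "p ! i = Lcls E x" using Lcls_eq x(1) by auto
    ultimately show ?thesis using i by (simp add: nth_Lseq)
  qed
  then have "p = Lseq E e ?n" by (intro nth_equalityI) simp_all
  then show "\<exists>e \<in> elems E. p = Lseq E e ?n" using e by auto
next
  let ?n = "length p"
  assume "\<exists>e \<in> elems E. p = Lseq E e ?n"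
  then obtain e where e: "e \<in> elems E" "p = Lseq E e ?n" by auto
  have "act E (int ?n - 1) e \<in> act E (int ?n - int (i + 1)) ` (p ! i)" if i: "i < ?n" for i
  proof (rule image_eqI)
    show "act E (int ?n - 1) e = act E (int ?n - int (i + 1)) (act E (int i) e)" using e(1) by simp
    have "p ! i = Lcls E (act E (int i) e)" using nth_Lseq[OF i, of E e] e(2) by simp
    then show "act E (int i) e \<in> p ! i" using Lcls_self e(1) by simp
  qed
  then show "(\<Inter>i\<in>{..<?n}. act E (int ?n - int (i + 1)) ` (p ! i)) \<noteq> {}" by blast
qed

lemma fR2_iff: "r \<in> fR2 E x y \<longleftrightarrow> (\<exists>p. r = pmon p \<and> Q.awalk x p y \<and> length p > 1 \<and>
    \<not> (\<exists>e \<in> elems E. p = Lseq E e (length p)))"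
proof -
  have "(Q.awalk x p y \<and> length p > 1 \<and>
        (\<Inter>i\<in>{..<length p}. act E (int (length p) - int (i + 1)) ` (p ! i)) = {}) \<longleftrightarrow>
      (Q.awalk x p y \<and> length p > 1 \<and> \<not> (\<exists>e \<in> elems E. p = Lseq E e (length p)))" for p
  proof (intro conj_cong refl)
    assume p: "Q.awalk x p y" "length p > 1"
    have "set p \<subseteq> arcs Q" "p \<noteq> []" using p by (auto simp: Q.awalk_def simp del: arcs_Q)
    from Inter_nonempty_iff[OF this]
    show "(\<Inter>i\<in>{..<length p}. act E (int (length p) - int (i + 1)) ` (p ! i)) = {} \<longleftrightarrow>
        \<not> (\<exists>e \<in> elems E. p = Lseq E e (length p))" by argo
  qed
  then show ?thesis unfolding fR2_def mem_Collect_eq by (simp only:)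
qed

text \<open>For \<open>j = 0\<close> the ends agree by (f4); for positive \<open>j\<close> they are
  the sources of the equal arrows at \<open>i = j\<close>.\<close>

lemma fR1_head:
  assumes e: "e \<in> elems E" and h: "h \<in> elems E" and j: "j \<le> deg E e" "j \<le> deg E h"
    and P: "Pcls E e = Pcls E h"
    and L: "\<forall>i\<in>{1..j}. Lcls E (act E (int (deg E e) - int i) e) = Lcls E (act E (int (deg E h) - int i) h)"
  shows "Pcls E (act E (int (deg E e - j)) e) = Pcls E (act E (int (deg E h - j)) h)"
proof (cases "j = 0")
  case True
  then show ?thesis using f4[OF e h] P by simp
next
  case False
  then have "Lcls E (act E (int (deg E e) - int j) e) = Lcls E (act E (int (deg E h) - int j) h)"
    using L by auto
  then show ?thesis using e h j by (intro Lcls_eq_imp_Pcls_eq) (simp_all add: of_nat_diff)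
qed

text \<open>The full sequence of \<open>e\<close> is a final segment of that of \<open>h\<close>,
  and (f6) forbids a proper one.\<close>

lemma fR1_deg:
  assumes e: "e \<in> elems E" and h: "h \<in> elems E" and j: "j = deg E e" "j \<le> deg E h"
    and L: "\<forall>i\<in>{1..j}. Lcls E (act E (int (deg E e) - int i) e) = Lcls E (act E (int (deg E h) - int i) h)"
  shows "deg E h = j"
proof -
  let ?s = "Lseq E e (deg E e)" and ?t = "Lseq E h (deg E h)"
  have "?s = drop (deg E h - j) ?t"
  proof (rule nth_equalityI)
    show "length ?s = length (drop (deg E h - j) ?t)" using j by simp
    fix i assume i: "i < length ?s"
    then have "j - i \<in> {1..j}" using j by simp
    with L have "Lcls E (act E (int (deg E e) - int (j - i)) e) = Lcls E (act E (int (deg E h) - int (j - i)) h)"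
      by blast
    moreover have "int (deg E e) - int (j - i) = int i" "int (deg E h) - int (j - i) = int (deg E h - j + i)"
      using i j by auto
    ultimately have eq: "Lcls E (act E (int i) e) = Lcls E (act E (int (deg E h - j + i)) h)"
      by (simp only:)
    have "?s ! i = Lcls E (act E (int i) e)" by (rule nth_Lseq) (use i in simp)
    moreover have "drop (deg E h - j) ?t ! i = ?t ! (deg E h - j + i)" by (rule nth_drop) simp
    moreover have "?t ! (deg E h - j + i) = Lcls E (act E (int (deg E h - j + i)) h)"
      by (rule nth_Lseq) (use i j in simp)
    ultimately show "?s ! i = drop (deg E h - j) ?t ! i" by (simp only: eq)
  qed
  then have "sublist ?s ?t" by (metis sublist_drop)
  then have "?s = ?t" using f6[OF e h] by (auto simp: strict_sublist_def)
  then show ?thesis using j(1) by (metis length_Lseq)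
qed

lemma fR_paths: "fR E x y \<subseteq> paths_lc Q x y"
proof
  fix r :: "('e set, 'k::field) path_lc" assume "r \<in> fR E x y"
  then consider "r \<in> fR1 E x y" | "r \<in> fR2 E x y" | "r \<in> fR3 E x y" by auto
  then show "r \<in> paths_lc Q x y"
  proof cases
    case 1
    then obtain e h j where *: "e \<in> elems E" "h \<in> elems E" "j \<le> deg E e" "j \<le> deg E h"
      "Pcls E e = Pcls E h"
      "\<forall>i\<in>{1..j}. Lcls E (act E (int (deg E e) - int i) e) = Lcls E (act E (int (deg E h) - int i) h)"
      and r: "r = pmon (Lseq E e (deg E e - j)) - pmon (Lseq E h (deg E h - j))"
        "x = Pcls E e" "y = Pcls E (act E (int (deg E e - j)) e)"
      unfolding fR1_def by auto
    show ?thesis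
      unfolding r(1)
    proof (rule lc.subspace_diff[OF subspace_paths_lc])
      show "pmon (Lseq E e (deg E e - j)) \<in> paths_lc Q x y"
        unfolding r(2,3) pmon_in_paths_lc by (rule awalk_Lseq[OF *(1)])
      show "pmon (Lseq E h (deg E h - j)) \<in> paths_lc Q x y"
        unfolding r(2,3) pmon_in_paths_lc *(5) fR1_head[OF *] by (rule awalk_Lseq[OF *(2)])
    qed
  next
    case 2
    then show ?thesis unfolding fR2_iff by auto
  next
    case 3
    then show ?thesis unfolding fR3_def by (auto simp: awalk_Lseq)
  qed
qed

text \<open>A trivial path occurs in an (fR1) generator only if \<open>j\<close> is one of the two
  degrees; by \<open>fR1_deg\<close> it is then both, and the trivial paths cancel.\<close>

lemma fR_coef_Nil:
  assumes "r \<in> fR E x y"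
  shows "coef r [] = 0"
proof -
  consider "r \<in> fR1 E x y" | "r \<in> fR2 E x y" | "r \<in> fR3 E x y" using assms by auto
  then show ?thesis
  proof cases
    case 1
    then obtain e h j where *: "e \<in> elems E" "h \<in> elems E" "j \<le> deg E e" "j \<le> deg E h"
      "Pcls E e = Pcls E h"
      "\<forall>i\<in>{1..j}. Lcls E (act E (int (deg E e) - int i) e) = Lcls E (act E (int (deg E h) - int i) h)"
      and r: "r = pmon (Lseq E e (deg E e - j)) - pmon (Lseq E h (deg E h - j))"
      unfolding fR1_def by auto
    have "j = deg E e \<longleftrightarrow> j = deg E h"
    proof
      assume "j = deg E e"
      then show "j = deg E h" using fR1_deg[OF *(1,2) _ *(4,6)] by simp
    next
      assume "j = deg E h"
      moreover have "\<forall>i\<in>{1..j}. Lcls E (act E (int (deg E h) - int i) h) = Lcls E (act E (int (deg E e) - int i) e)"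
        using *(6) by simp
      ultimately show "j = deg E e" using fR1_deg[OF *(2,1) _ *(3)] by simp
    qed
    then have "deg E e - j = 0 \<longleftrightarrow> deg E h - j = 0" using *(3,4) by auto
    then show ?thesis unfolding r by (auto simp: lookup_minus lookup_single "when_def")
  next
    case 2
    then show ?thesis unfolding fR2_iff by (auto simp: lookup_single "when_def")
  next
    case 3
    then show ?thesis unfolding fR3_def by (auto simp: lookup_single "when_def")
  qed
qed

lemma rquiver_Q: "is_rquiver (Q, gen_ideal Q (fR E) :: ('e set, 'e set, 'k::field) path_rels)"
proof -
  have "gen_ideal Q (fR E) x y \<subseteq> {\<rho> \<in> paths_lc Q x y. coef \<rho> [] = (0 :: 'k)}" for x y
  proof (rule gen_ideal_subset[OF is_ideal_no_trivial_paths[OF wf_Q]])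
    show "fR E a b \<subseteq> {\<rho> \<in> paths_lc Q a b. coef \<rho> [] = (0 :: 'k)}" for a b
    proof (rule subsetI, rule CollectI, rule conjI)
      fix r :: "('e set, 'k) path_lc" assume r: "r \<in> fR E a b"
      show "r \<in> paths_lc Q a b" by (rule subsetD[OF fR_paths r])
      show "coef r [] = 0" by (rule fR_coef_Nil[OF r])
    qed
  qed
  then have "coef \<rho> [] = 0" if "\<rho> \<in> gen_ideal Q (fR E) x y" for x y and \<rho> :: "('e set, 'k) path_lc"
    using that by auto
  then show ?thesis
    unfolding is_rquiver_iff using is_ideal_gen_ideal[OF wf_Q fR_paths] wf_Q by simp
qed

lemma gens_in_ideal: "r \<in> fR E x y \<Longrightarrow> x \<in> verts Q \<Longrightarrow> y \<in> verts Q \<Longrightarrow> r \<in> gen_ideal Q (fR E) x y"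
  by (rule gen_ideal_base[OF _ subsetD[OF fR_paths]])

text \<open>Beyond the (fR2) and (fR3) generators only sequences of translates of length at most the
  degree remain. Length at most 1 is treated apart: (fR2) says nothing there, and positivity of
  \<open>deg\<close> gives the bound.\<close>

lemma nonzero_path:
  assumes p: "Q.awalk x p y" and nz: "(pmon p :: ('e set, 'k::field) path_lc) \<notin> gen_ideal Q (fR E) x y"
  obtains e where "e \<in> elems E" "x = Pcls E e" "p = Lseq E e (length p)" "length p \<le> deg E e"
proof -
  have v: "x \<in> verts Q" "y \<in> verts Q" using p by auto
  have notin: "(pmon p :: ('e set, 'k) path_lc) \<notin> fR E x y" using gens_in_ideal v nz by auto
  show ?thesis
  proof (cases "length p \<le> 1")
    case True
    show ?thesis
    proof (cases p)
      case Nil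
      obtain e where "e \<in> elems E" "x = Pcls E e" using v(1) by auto
      then show ?thesis using that[of e] Nil by simp
    next
      case (Cons a q)
      then have pa: "p = [a]" using True by simp
      then obtain e where e: "e \<in> elems E" "a = Lcls E e" using p by (auto simp: Q.awalk_Cons_iff)
      have "x = Pcls E e" using p e by (auto simp: pa Q.awalk_Cons_iff tail_Q)
      moreover have "p = Lseq E e (length p)" using e by (simp add: pa Lseq_def)
      moreover have "length p \<le> deg E e" using deg_pos[OF e(1)] pa by simp
      ultimately show ?thesis using that e(1) by blast
    qed
  next
    case False
    have "\<exists>e\<in>elems E. p = Lseq E e (length p)"
    proof (rule ccontr)
      assume "\<not> ?thesis"
      then have "(pmon p :: ('e set, 'k) path_lc) \<in> fR2 E x y"
        unfolding fR2_iff using p False by (intro exI[of _ p]) simp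
      then show False using notin by simp
    qed
    then obtain e where e: "e \<in> elems E" "p = Lseq E e (length p)" by auto
    have "Q.awalk (Pcls E e) p (Pcls E (act E (int (length p)) e))"
      using awalk_Lseq[OF e(1), of "length p"] e(2) by simp
    moreover have "p \<noteq> []" using False by auto
    ultimately have x: "x = Pcls E e" and y: "y = Pcls E (act E (int (length p)) e)"
      using awalk_ends_unique[OF p] by auto
    have "length p \<le> deg E e"
    proof (rule ccontr)
      assume "\<not> length p \<le> deg E e"
      then have "(pmon p :: ('e set, 'k) path_lc) \<in> fR3 E x y"
        unfolding fR3_def using e x y by (intro CollectI exI[of _ e] exI[of _ "length p"]) simp
      then show False using notin by simp
    qed
    then show ?thesis using that e x by blast
  qed
qed

lemma locally_bounded_fBC: "locally_bounded (fBC_cat (k :: 'k::field itself) E)"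
proof -
  let ?I = "gen_ideal Q (fR E) :: ('e set, 'e set, 'k) path_rels"
  interpret R: rquiver Q ?I by unfold_locales (rule rquiver_Q)
  have "locally_bounded (rquiver_cat (Q, ?I))"
  proof (rule R.locally_bounded_rquiver_cat)
    fix x assume "x \<in> verts Q"
    then obtain e0 where e0: "e0 \<in> elems E" "x = Pcls E e0" by auto
    \<comment> \<open>The vertex \<open>x\<close> is itself the finite class of possible starting
      elements, so these pairs parametrise the surviving paths out of it.\<close>
    have fin: "finite (SIGMA e:x. {..deg E e})" using f1[OF e0(1)] e0(2) by (intro finite_SigmaI) auto
    show "finite {p. \<exists>y. Q.awalk x p y \<and> pmon p \<notin> ?I x y}"
    proof (rule finite_subset[OF _ finite_imageI[OF fin, of "\<lambda>(e, n). Lseq E e n"]], rule subsetI)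
      fix p assume "p \<in> {p. \<exists>y. Q.awalk x p y \<and> pmon p \<notin> ?I x y}"
      then obtain y where y: "Q.awalk x p y" "pmon p \<notin> ?I x y" by auto
      obtain e where e: "e \<in> elems E" "x = Pcls E e" "p = Lseq E e (length p)" "length p \<le> deg E e"
        by (rule nonzero_path[OF y])
      have "e \<in> x" using Pcls_self e(1,2) by simp
      then show "p \<in> (\<lambda>(e, n). Lseq E e n) ` (SIGMA e:x. {..deg E e})"
        using e(3,4) by (intro image_eqI[of _ _ "(e, length p)"]) simp_all
    qed
    \<comment> \<open>A path into \<open>x\<close> is recorded by its final element in
      \<open>x\<close>, from which the start is recovered by moving back; by (f3) both have the same
      degree.\<close>
    show "finite {p. \<exists>y. Q.awalk y p x \<and> pmon p \<notin> ?I y x}"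
    proof (rule finite_subset[OF _ finite_imageI[OF fin, of "\<lambda>(e, n). Lseq E (act E (- int n) e) n"]],
        rule subsetI)
      fix p assume "p \<in> {p. \<exists>y. Q.awalk y p x \<and> pmon p \<notin> ?I y x}"
      then obtain y where y: "Q.awalk y p x" "pmon p \<notin> ?I y x" by auto
      obtain e where e: "e \<in> elems E" "y = Pcls E e" "p = Lseq E e (length p)" "length p \<le> deg E e"
        by (rule nonzero_path[OF y])
      let ?h = "act E (int (length p)) e"
      have "Q.awalk y p (Pcls E ?h)" using awalk_Lseq[OF e(1), of "length p"] e(2,3) by simp
      then have "x = Pcls E ?h" using awalk_end_unique[OF y(1)] by simp
      then have "?h \<in> x" using Pcls_self e(1) by simp
      moreover have "deg E ?h = deg E e" by (rule f3[OF e(1)])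
      moreover have "act E (- int (length p)) ?h = e" using e(1) by simp
      ultimately show "p \<in> (\<lambda>(e, n). Lseq E (act E (- int n) e) n) ` (SIGMA e:x. {..deg E e})"
        using e(3,4) by (intro image_eqI[of _ _ "(?h, length p)"]) (simp_all del: act_act)
    qed
  qed
  then show ?thesis by (simp add: fBC_cat_def fBC_rquiver_def)
qed

end

subsection \<open>Morphisms and coverings\<close>

locale fBC_mor =
  fixes E :: "'e fbc" and E' :: "'f fbc" and \<phi> :: "'e \<Rightarrow> 'f"
  assumes mor: "fBC_morphism E E' \<phi>"
begin

sublocale E: fBC E using mor by (simp add: fBC_morphism_def)
sublocale E': fBC E' using mor by (simp add: fBC_morphism_def)

abbreviation "f \<equiv> fBC_quiver_map E' \<phi>"

lemma \<phi>_closed [simp]: "e \<in> elems E \<Longrightarrow> \<phi> e \<in> elems E'"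
  and \<phi>_act [simp]: "e \<in> elems E \<Longrightarrow> \<phi> (act E n e) = act E' n (\<phi> e)"
  and \<phi>_deg [simp]: "e \<in> elems E \<Longrightarrow> deg E' (\<phi> e) = deg E e"
  and \<phi>_P: "e \<in> elems E \<Longrightarrow> x \<in> Pcls E e \<Longrightarrow> \<phi> x \<in> Pcls E' (\<phi> e)"
  and \<phi>_L: "e \<in> elems E \<Longrightarrow> x \<in> Lcls E e \<Longrightarrow> \<phi> x \<in> Lcls E' (\<phi> e)"
  using mor unfolding fBC_morphism_def by (auto simp: image_subset_iff)

lemma Pcls_image_eq:
  assumes "e \<in> elems E" "h \<in> elems E" "Pcls E e = Pcls E h"
  shows "Pcls E' (\<phi> e) = Pcls E' (\<phi> h)"
  using \<phi>_P[OF assms(2), of e] E.Pcls_self[OF assms(1)] assms(2,3) by (intro E'.Pcls_eq) auto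

lemma Lcls_image_eq:
  assumes "e \<in> elems E" "h \<in> elems E" "Lcls E e = Lcls E h"
  shows "Lcls E' (\<phi> e) = Lcls E' (\<phi> h)"
  using \<phi>_L[OF assms(2), of e] E.Lcls_self[OF assms(1)] assms(2,3) by (intro E'.Lcls_eq) auto

lemma fst_f: "fst f (Pcls E e) = Pcls E' (\<phi> e)" if e: "e \<in> elems E"
proof -
  have "Pcls E' (\<phi> x) = Pcls E' (\<phi> e)" if "x \<in> Pcls E e" for x
    by (rule E'.Pcls_eq[OF \<phi>_closed[OF e] \<phi>_P[OF e that]])
  then have "(\<lambda>x. Pcls E' (\<phi> x)) ` Pcls E e = (\<lambda>x. Pcls E' (\<phi> e)) ` Pcls E e"
    by (intro image_cong refl)
  also have "\<dots> = {Pcls E' (\<phi> e)}" by (rule image_constant[OF E.Pcls_self[OF e]])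
  finally show ?thesis by (simp add: fBC_quiver_map_def)
qed

lemma snd_f: "snd f (Lcls E e) = Lcls E' (\<phi> e)" if e: "e \<in> elems E"
proof -
  have "Lcls E' (\<phi> x) = Lcls E' (\<phi> e)" if "x \<in> Lcls E e" for x
    by (rule E'.Lcls_eq[OF \<phi>_closed[OF e] \<phi>_L[OF e that]])
  then have "(\<lambda>x. Lcls E' (\<phi> x)) ` Lcls E e = (\<lambda>x. Lcls E' (\<phi> e)) ` Lcls E e"
    by (intro image_cong refl)
  also have "\<dots> = {Lcls E' (\<phi> e)}" by (rule image_constant[OF E.Lcls_self[OF e]])
  finally show ?thesis by (simp add: fBC_quiver_map_def)
qed

lemma quiver_morphism: "quiver_morphism E.Q E'.Q f"
  by (auto simp: quiver_morphism_def fst_f snd_f E.tail_Q E.head_Q E'.tail_Q E'.head_Q)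

lemma map_Lseq: "e \<in> elems E \<Longrightarrow> map (snd f) (Lseq E e n) = Lseq E' (\<phi> e) n"
  by (simp add: Lseq_def snd_f)

end

locale fBC_cov = fBC_mor E E' \<phi>
  for E :: "'e fbc" and E' :: "'f fbc" and \<phi> :: "'e \<Rightarrow> 'f" +
  assumes cov: "fBC_covering E E' \<phi>"
begin

lemma \<phi>_inj:
  assumes "e \<in> elems E" "h \<in> elems E" "Pcls E e = Pcls E h" "\<phi> e = \<phi> h"
  shows "e = h"
proof -
  have "inj_on \<phi> (Pcls E h)" using cov assms(2) by (simp add: fBC_covering_def bij_betw_def)
  then show ?thesis using assms E.Pcls_self by (auto dest: inj_onD)
qed

lemma P_lift:
  assumes "e \<in> elems E" "h' \<in> elems E'" "Pcls E' h' = Pcls E' (\<phi> e)"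
  obtains h where "h \<in> elems E" "Pcls E h = Pcls E e" "\<phi> h = h'"
proof -
  have "\<phi> ` Pcls E e = Pcls E' (\<phi> e)"
    using cov assms(1) by (simp add: fBC_covering_def bij_betw_def)
  then obtain h where h: "h \<in> Pcls E e" "h' = \<phi> h" using E'.Pcls_self[OF assms(2)] assms(3) by auto
  show ?thesis
    by (rule that[OF _ E.Pcls_eq[OF assms(1) h(1)] h(2)[symmetric]])
      (use E.Pcls_subset[OF assms(1)] h(1) in auto)
qed

lemma L_lift:
  assumes "e \<in> elems E" "h' \<in> elems E'" "Lcls E' h' = Lcls E' (\<phi> e)"
  obtains h where "h \<in> elems E" "Lcls E h = Lcls E e" "\<phi> h = h'"
proof -
  have "\<phi> ` Lcls E e = Lcls E' (\<phi> e)"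
    using cov assms(1) by (simp add: fBC_covering_def bij_betw_def)
  then obtain h where h: "h \<in> Lcls E e" "h' = \<phi> h" using E'.Lcls_self[OF assms(2)] assms(3) by auto
  show ?thesis
    by (rule that[OF _ E.Lcls_eq[OF assms(1) h(1)] h(2)[symmetric]])
      (use E.Lcls_subset[OF assms(1)] h(1) in auto)
qed

text \<open>The L-class of \<open>e\<close> contains an element over \<open>\<phi> h\<close>; by
  (f1) it lies in the common P-class, where \<phi> is injective, so it is \<open>h\<close>.\<close>

lemma Lcls_reflect_tail:
  assumes "e \<in> elems E" "h \<in> elems E" "Pcls E e = Pcls E h" "Lcls E' (\<phi> e) = Lcls E' (\<phi> h)"
  shows "Lcls E e = Lcls E h"
proof -
  obtain x where x: "x \<in> elems E" "Lcls E x = Lcls E e" "\<phi> x = \<phi> h"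
    by (rule L_lift[OF assms(1) \<phi>_closed[OF assms(2)] assms(4)[symmetric]])
  have "Pcls E x = Pcls E e" by (rule E.Lcls_eq_imp_Pcls_eq[OF x(1) assms(1) x(2)])
  then have "x = h" using assms x by (intro \<phi>_inj) simp_all
  then show ?thesis using x(2) by simp
qed

text \<open>The translate by g of the element over \<open>\<phi> h\<close> in the L-class of
  \<open>e\<close> lies in the common target by (f2); injectivity of \<phi> is applied there, and
  then g is cancelled.\<close>

lemma Lcls_reflect_head:
  assumes "e \<in> elems E" "h \<in> elems E" "Pcls E (act E 1 e) = Pcls E (act E 1 h)"
    "Lcls E' (\<phi> e) = Lcls E' (\<phi> h)"
  shows "Lcls E e = Lcls E h"
proof -
  obtain x where x: "x \<in> elems E" "Lcls E x = Lcls E e" "\<phi> x = \<phi> h"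
    by (rule L_lift[OF assms(1) \<phi>_closed[OF assms(2)] assms(4)[symmetric]])
  have "Pcls E (act E 1 x) = Pcls E (act E 1 e)" by (rule E.f2[OF x(1) assms(1) x(2)])
  then have "act E 1 x = act E 1 h" using assms x by (intro \<phi>_inj) simp_all
  then have "act E (-1) (act E 1 x) = act E (-1) (act E 1 h)" by simp
  then have "x = h" using x(1) assms(2) by simp
  then show ?thesis using x(2) by simp
qed

lemma quiver_covering: "quiver_covering E.Q E'.Q f"
  unfolding quiver_covering_def
proof (intro conjI ballI)
  show "quiver_morphism E.Q E'.Q f" by (rule quiver_morphism)
next
  fix x assume "x \<in> verts E.Q"
  then obtain e where e: "e \<in> elems E" "x = Pcls E e" by auto
  show "bij_betw (snd f) {a \<in> arcs E.Q. tail E.Q a = x} {a \<in> arcs E'.Q. tail E'.Q a = fst f x}"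
  proof (rule bij_betw_imageI)
    show "inj_on (snd f) {a \<in> arcs E.Q. tail E.Q a = x}"
    proof (rule inj_onI)
      fix a b assume *: "a \<in> {a \<in> arcs E.Q. tail E.Q a = x}" "b \<in> {a \<in> arcs E.Q. tail E.Q a = x}"
        "snd f a = snd f b"
      then obtain e h where eh: "e \<in> elems E" "h \<in> elems E" and ab: "a = Lcls E e" "b = Lcls E h"
        by auto
      have "Pcls E e = Pcls E h" "Lcls E' (\<phi> e) = Lcls E' (\<phi> h)"
        using * eh by (simp_all add: ab snd_f E.tail_Q)
      then show "a = b" unfolding ab by (rule Lcls_reflect_tail[OF eh])
    qed
    show "snd f ` {a \<in> arcs E.Q. tail E.Q a = x} = {a \<in> arcs E'.Q. tail E'.Q a = fst f x}"
    proof (intro Set.set_eqI iffI)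
      fix a' assume "a' \<in> {a \<in> arcs E'.Q. tail E'.Q a = fst f x}"
      then obtain h' where h': "h' \<in> elems E'" "a' = Lcls E' h'" "Pcls E' h' = Pcls E' (\<phi> e)"
        using e by (auto simp: E'.tail_Q fst_f)
      obtain h where "h \<in> elems E" "Pcls E h = Pcls E e" "\<phi> h = h'" by (rule P_lift[OF e(1) h'(1,3)])
      then show "a' \<in> snd f ` {a \<in> arcs E.Q. tail E.Q a = x}"
        using h'(2) e(2) by (intro image_eqI[of _ _ "Lcls E h"]) (simp_all add: snd_f E.tail_Q)
    qed (auto simp: snd_f fst_f E'.tail_Q E.tail_Q)
  qed
  show "bij_betw (snd f) {a \<in> arcs E.Q. head E.Q a = x} {a \<in> arcs E'.Q. head E'.Q a = fst f x}"
  proof (rule bij_betw_imageI)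
    show "inj_on (snd f) {a \<in> arcs E.Q. head E.Q a = x}"
    proof (rule inj_onI)
      fix a b assume *: "a \<in> {a \<in> arcs E.Q. head E.Q a = x}" "b \<in> {a \<in> arcs E.Q. head E.Q a = x}"
        "snd f a = snd f b"
      then obtain e h where eh: "e \<in> elems E" "h \<in> elems E" and ab: "a = Lcls E e" "b = Lcls E h"
        by auto
      have "Pcls E (act E 1 e) = Pcls E (act E 1 h)" "Lcls E' (\<phi> e) = Lcls E' (\<phi> h)"
        using * eh by (simp_all add: ab snd_f E.head_Q)
      then show "a = b" unfolding ab by (rule Lcls_reflect_head[OF eh])
    qed
    show "snd f ` {a \<in> arcs E.Q. head E.Q a = x} = {a \<in> arcs E'.Q. head E'.Q a = fst f x}"
    proof (intro Set.set_eqI iffI)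
      fix a' assume "a' \<in> {a \<in> arcs E'.Q. head E'.Q a = fst f x}"
      then obtain h' where h': "h' \<in> elems E'" "a' = Lcls E' h'"
        "Pcls E' (act E' 1 h') = Pcls E' (\<phi> e)"
        using e by (auto simp: E'.head_Q fst_f)
      \<comment> \<open>Only the target of the arrow is prescribed, so the translate of
        \<open>h'\<close> is lifted and then moved back.\<close>
      obtain g where g: "g \<in> elems E" "Pcls E g = Pcls E e" "\<phi> g = act E' 1 h'"
        by (rule P_lift[OF e(1) E'.act_closed[OF h'(1)] h'(3)])
      let ?h = "act E (-1) g"
      have "\<phi> ?h = h'" using g h'(1) by simp
      then show "a' \<in> snd f ` {a \<in> arcs E.Q. head E.Q a = x}"
        using h'(2) e(2) g by (intro image_eqI[of _ _ "Lcls E ?h"]) (simp_all add: snd_f E.head_Q)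
    qed (auto simp: snd_f fst_f E'.head_Q E.head_Q)
  qed
qed

sublocale QC: quiver_cover E.Q E'.Q f
  by unfold_locales (rule E.wf_Q E'.wf_Q quiver_covering)+

section \<open>Lifting the generating relations\<close>

lemma fR1_lift:
  assumes e: "e \<in> elems E" "h \<in> elems E" and j: "j \<le> deg E e" "j \<le> deg E h"
    and P: "Pcls E e = Pcls E h"
    and L: "\<forall>i\<in>{1..j}. Lcls E' (act E' (int (deg E e) - int i) (\<phi> e)) =
      Lcls E' (act E' (int (deg E h) - int i) (\<phi> h))"
  shows "\<forall>i\<in>{1..j}. Lcls E (act E (int (deg E e) - int i) e) = Lcls E (act E (int (deg E h) - int i) h)"
proof -
  \<comment> \<open>Backwards from the common end, which (f4) provides, each arrow is recovered from
    its head; the equality of P-classes is carried along as the head condition for the next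
    arrow.\<close>
  have "i \<le> j \<Longrightarrow> Pcls E (act E (int (deg E e) - int i) e) = Pcls E (act E (int (deg E h) - int i) h) \<and>
      (i > 0 \<longrightarrow> Lcls E (act E (int (deg E e) - int i) e) = Lcls E (act E (int (deg E h) - int i) h))" for i
  proof (induction i)
    case 0
    then show ?case using E.f4[OF e] P by simp
  next
    case (Suc i)
    let ?x = "act E (int (deg E e) - int (Suc i)) e" and ?y = "act E (int (deg E h) - int (Suc i)) h"
    have xy: "?x \<in> elems E" "?y \<in> elems E" using e by simp_all
    have "Suc i \<in> {1..j}" using Suc.prems by simp
    with L have "Lcls E' (\<phi> ?x) = Lcls E' (\<phi> ?y)" using e by (simp only: \<phi>_act)
    moreover have "Pcls E (act E 1 ?x) = Pcls E (act E 1 ?y)" using Suc e by simp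
    ultimately have "Lcls E ?x = Lcls E ?y" using xy by (intro Lcls_reflect_head)
    then show ?case using E.Lcls_eq_imp_Pcls_eq[OF xy] by blast
  qed
  then show ?thesis by simp
qed

text \<open>Starting from the common end point of the two paths, (f4) applies only once the paths have
  been compared on the whole tail of length \<open>j\<close>.\<close>

lemma fR1_lift':
  assumes e: "e \<in> elems E" "h \<in> elems E" and j: "j \<le> deg E e" "j \<le> deg E h"
    and P: "Pcls E (act E (int (deg E e) - int j) e) = Pcls E (act E (int (deg E h) - int j) h)"
    and L: "\<forall>i\<in>{1..j}. Lcls E' (act E' (int (deg E e) - int i) (\<phi> e)) =
      Lcls E' (act E' (int (deg E h) - int i) (\<phi> h))"
  shows "Pcls E e = Pcls E h"
proof -
  \<comment> \<open>The offset \<open>j - m\<close> runs through the tail in the order of traversal;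
    at \<open>m = j\<close> the ends of both full sequences are reached.\<close>
  have "m \<le> j \<Longrightarrow> Pcls E (act E (int (deg E e) - int (j - m)) e) =
      Pcls E (act E (int (deg E h) - int (j - m)) h)" for m
  proof (induction m)
    case 0
    then show ?case using P by simp
  next
    case (Suc m)
    let ?x = "act E (int (deg E e) - int (j - m)) e" and ?y = "act E (int (deg E h) - int (j - m)) h"
    have xy: "?x \<in> elems E" "?y \<in> elems E" using e by simp_all
    have "j - m \<in> {1..j}" using Suc.prems by simp
    with L have "Lcls E' (\<phi> ?x) = Lcls E' (\<phi> ?y)" using e by (simp only: \<phi>_act)
    then have "Lcls E ?x = Lcls E ?y" using xy Suc by (intro Lcls_reflect_tail) simp_all
    then have "Pcls E (act E 1 ?x) = Pcls E (act E 1 ?y)" by (rule E.f2[OF xy])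
    moreover have "1 + (int d - int (j - m)) = int d - int (j - Suc m)" for d
      using Suc.prems by simp
    ultimately show ?case using e by (simp only: E.act_act)
  qed
  from this[of j] show ?thesis using E.f4[OF e] by simp
qed

text \<open>The starting elements of (fR1) and (fR3) generators lift into the class
  \<open>x\<close>. An (fR2) generator lifts as a path, and the lift is no sequence of translates
  because its image would be one.\<close>

lemma fR_from:
  assumes x: "x \<in> verts E.Q" and r': "r' \<in> fR E' (fst f x) y'"
  shows "\<exists>y \<in> verts E.Q. fst f y = y' \<and> (\<exists>r \<in> fR E x y. lc_map f r = (r' :: ('f set, 'k::field) path_lc))"
proof -
  obtain e0 where e0: "e0 \<in> elems E" "x = Pcls E e0" using x by auto
  have fx: "fst f x = Pcls E' (\<phi> e0)" by (simp add: e0 fst_f)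
  consider "r' \<in> fR1 E' (fst f x) y'" | "r' \<in> fR2 E' (fst f x) y'" | "r' \<in> fR3 E' (fst f x) y'"
    using r' by auto
  then show ?thesis
  proof cases
    case 1
    then obtain e' h' j where *: "e' \<in> elems E'" "h' \<in> elems E'" "j \<le> deg E' e'" "j \<le> deg E' h'"
      "Pcls E' e' = Pcls E' h'"
      "\<forall>i\<in>{1..j}. Lcls E' (act E' (int (deg E' e') - int i) e') = Lcls E' (act E' (int (deg E' h') - int i) h')"
      and r: "r' = pmon (Lseq E' e' (deg E' e' - j)) - pmon (Lseq E' h' (deg E' h' - j))"
        "Pcls E' (\<phi> e0) = Pcls E' e'" "y' = Pcls E' (act E' (int (deg E' e' - j)) e')"
      unfolding fR1_def fx by auto
    obtain e where e: "e \<in> elems E" "Pcls E e = Pcls E e0" "\<phi> e = e'"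
      by (rule P_lift[OF e0(1) *(1) r(2)[symmetric]])
    obtain h where h: "h \<in> elems E" "Pcls E h = Pcls E e0" "\<phi> h = h'"
      by (rule P_lift[OF e0(1) *(2)]) (simp add: r(2) *(5))
    have d: "deg E' e' = deg E e" "deg E' h' = deg E h" using \<phi>_deg e(1,3) h(1,3) by auto
    let ?y = "Pcls E (act E (int (deg E e - j)) e)"
    let ?r = "pmon (Lseq E e (deg E e - j)) - pmon (Lseq E h (deg E h - j)) :: ('e set, 'k) path_lc"
    have "\<forall>i\<in>{1..j}. Lcls E (act E (int (deg E e) - int i) e) = Lcls E (act E (int (deg E h) - int i) h)"
      by (rule fR1_lift[OF e(1) h(1)]) (use * d e h in simp_all)
    then have "?r \<in> fR1 E x ?y"
      unfolding fR1_def using * d e h e0(2)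
      by (intro CollectI exI[of _ e] exI[of _ h] exI[of _ j]) simp
    moreover have "lc_map f ?r = r'"
      unfolding r(1) d e(3)[symmetric] h(3)[symmetric]
      by (simp add: lc_map_diff map_Lseq e(1) h(1))
    moreover have "?y \<in> verts E.Q" using e(1) by simp
    moreover have "fst f ?y = y'" using e by (simp add: fst_f r(3) d)
    ultimately show ?thesis by blast
  next
    case 2
    then obtain p' where p': "r' = pmon p'" "E'.Q.awalk (fst f x) p' y'" "length p' > 1"
      "\<not> (\<exists>e\<in>elems E'. p' = Lseq E' e (length p'))"
      unfolding E'.fR2_iff by auto
    obtain p y where p: "E.Q.awalk x p y" "map (snd f) p = p'" "fst f y = y'"
      using QC.awalk_lift_from[OF x p'(2)] by auto
    have "p \<noteq> Lseq E e (length p)" if "e \<in> elems E" for e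
    proof
      assume "p = Lseq E e (length p)"
      then have "p' = Lseq E' (\<phi> e) (length p)" using map_Lseq[OF that, of "length p"] p(2) by simp
      then show False using p'(4) that p(2) by auto
    qed
    then have "pmon p \<in> fR2 E x y"
      unfolding E.fR2_iff using p p'(3) by (intro exI[of _ p]) auto
    moreover have "lc_map f (pmon p) = r'" using p(2) p'(1) by simp
    moreover have "y \<in> verts E.Q" using p(1) by (rule E.Q.awalk_last_in_verts)
    ultimately show ?thesis using p(3) by blast
  next
    case 3
    then obtain e' n where *: "r' = pmon (Lseq E' e' n)" "e' \<in> elems E'" "n > deg E' e'"
      "Pcls E' (\<phi> e0) = Pcls E' e'" "y' = Pcls E' (act E' (int n) e')"
      unfolding fR3_def fx by auto
    obtain e where e: "e \<in> elems E" "Pcls E e = Pcls E e0" "\<phi> e = e'"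
      by (rule P_lift[OF e0(1) *(2) *(4)[symmetric]])
    have "n > deg E e" using *(3) \<phi>_deg[OF e(1)] e(3) by simp
    then have "pmon (Lseq E e n) \<in> fR3 E x (Pcls E (act E (int n) e))"
      unfolding fR3_def using e e0 by (intro CollectI exI[of _ e] exI[of _ n]) simp
    moreover have "lc_map f (pmon (Lseq E e n)) = r'" using *(1) e by (simp add: map_Lseq)
    moreover have "Pcls E (act E (int n) e) \<in> verts E.Q" using e(1) by simp
    moreover have "fst f (Pcls E (act E (int n) e)) = y'" using e *(5) by (simp add: fst_f)
    ultimately show ?thesis by blast
  qed
qed

lemma fR_to:
  assumes y: "y \<in> verts E.Q" and r': "r' \<in> fR E' x' (fst f y)"
  shows "\<exists>x \<in> verts E.Q. fst f x = x' \<and> (\<exists>r \<in> fR E x y. lc_map f r = (r' :: ('f set, 'k::field) path_lc))"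
proof -
  obtain e0 where e0: "e0 \<in> elems E" "y = Pcls E e0" using y by auto
  have fy: "fst f y = Pcls E' (\<phi> e0)" by (simp add: e0 fst_f)
  consider "r' \<in> fR1 E' x' (fst f y)" | "r' \<in> fR2 E' x' (fst f y)" | "r' \<in> fR3 E' x' (fst f y)"
    using r' by auto
  then show ?thesis
  proof cases
    case 1
    then obtain e' h' j where *: "e' \<in> elems E'" "h' \<in> elems E'" "j \<le> deg E' e'" "j \<le> deg E' h'"
      "Pcls E' e' = Pcls E' h'"
      "\<forall>i\<in>{1..j}. Lcls E' (act E' (int (deg E' e') - int i) e') = Lcls E' (act E' (int (deg E' h') - int i) h')"
      and r: "r' = pmon (Lseq E' e' (deg E' e' - j)) - pmon (Lseq E' h' (deg E' h' - j))"
        "x' = Pcls E' e'" "Pcls E' (\<phi> e0) = Pcls E' (act E' (int (deg E' e' - j)) e')"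
      unfolding fR1_def fy by auto
    \<comment> \<open>Only the end is prescribed: the final elements of both paths are lifted into
      the class \<open>y\<close> and moved back. That the starting classes agree is then
      \<open>fR1_lift'\<close>.\<close>
    obtain u where u: "u \<in> elems E" "Pcls E u = Pcls E e0" "\<phi> u = act E' (int (deg E' e' - j)) e'"
      by (rule P_lift[OF e0(1) E'.act_closed[OF *(1)] r(3)[symmetric]])
    have "Pcls E' (act E' (int (deg E' h' - j)) h') = Pcls E' (\<phi> e0)"
      unfolding r(3) by (rule E'.fR1_head[OF *, symmetric])
    then obtain v where v: "v \<in> elems E" "Pcls E v = Pcls E e0" "\<phi> v = act E' (int (deg E' h' - j)) h'"
      by (rule P_lift[OF e0(1) E'.act_closed[OF *(2)]])
    define e where "e = act E (- int (deg E' e' - j)) u"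
    define h where "h = act E (- int (deg E' h' - j)) v"
    have e: "e \<in> elems E" "\<phi> e = e'" using u *(1) by (simp_all add: e_def)
    have h: "h \<in> elems E" "\<phi> h = h'" using v *(2) by (simp_all add: h_def)
    have d: "deg E' e' = deg E e" "deg E' h' = deg E h" using \<phi>_deg e h by auto
    have "act E (int (deg E' e' - j)) e = u" "act E (int (deg E' h' - j)) h = v"
      using u(1) v(1) by (simp_all add: e_def h_def)
    then have ue: "act E (int (deg E e - j)) e = u" "act E (int (deg E h - j)) h = v"
      by (simp_all only: d)
    have L: "\<forall>i\<in>{1..j}. Lcls E' (act E' (int (deg E e) - int i) (\<phi> e)) =
        Lcls E' (act E' (int (deg E h) - int i) (\<phi> h))"
      using *(6) by (simp only: e(2) h(2) d)
    have j: "j \<le> deg E e" "j \<le> deg E h" using *(3,4) d by simp_all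
    have P: "Pcls E e = Pcls E h"
    proof (rule fR1_lift'[OF e(1) h(1) j _ L])
      show "Pcls E (act E (int (deg E e) - int j) e) = Pcls E (act E (int (deg E h) - int j) h)"
        using ue u(2) v(2) j by (simp add: of_nat_diff)
    qed
    let ?r = "pmon (Lseq E e (deg E e - j)) - pmon (Lseq E h (deg E h - j)) :: ('e set, 'k) path_lc"
    have "?r \<in> fR1 E (Pcls E e) y"
      unfolding fR1_def using j e h P fR1_lift[OF e(1) h(1) j P L] e0(2) ue u(2)
      by (intro CollectI exI[of _ e] exI[of _ h] exI[of _ j]) simp
    moreover have "lc_map f ?r = r'"
      unfolding r(1) d e(2)[symmetric] h(2)[symmetric]
      by (simp add: lc_map_diff map_Lseq e(1) h(1))
    moreover have "Pcls E e \<in> verts E.Q" using e(1) by simp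
    moreover have "fst f (Pcls E e) = x'" using e by (simp add: fst_f r(2))
    ultimately show ?thesis by blast
  next
    case 2
    then obtain p' where p': "r' = pmon p'" "E'.Q.awalk x' p' (fst f y)" "length p' > 1"
      "\<not> (\<exists>e\<in>elems E'. p' = Lseq E' e (length p'))"
      unfolding E'.fR2_iff by auto
    obtain p x where p: "E.Q.awalk x p y" "map (snd f) p = p'" "fst f x = x'"
      using QC.awalk_lift_to[OF y p'(2)] by auto
    have "p \<noteq> Lseq E e (length p)" if "e \<in> elems E" for e
    proof
      assume "p = Lseq E e (length p)"
      then have "p' = Lseq E' (\<phi> e) (length p)" using map_Lseq[OF that, of "length p"] p(2) by simp
      then show False using p'(4) that p(2) by auto
    qed
    then have "pmon p \<in> fR2 E x y"
      unfolding E.fR2_iff using p p'(3) by (intro exI[of _ p]) auto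
    moreover have "lc_map f (pmon p) = r'" using p(2) p'(1) by simp
    moreover have "x \<in> verts E.Q" using p(1) by (rule E.Q.awalk_hd_in_verts)
    ultimately show ?thesis using p(3) by blast
  next
    case 3
    then obtain e' n where *: "r' = pmon (Lseq E' e' n)" "e' \<in> elems E'" "n > deg E' e'"
      "x' = Pcls E' e'" "Pcls E' (\<phi> e0) = Pcls E' (act E' (int n) e')"
      unfolding fR3_def fy by auto
    obtain u where u: "u \<in> elems E" "Pcls E u = Pcls E e0" "\<phi> u = act E' (int n) e'"
      by (rule P_lift[OF e0(1) E'.act_closed[OF *(2)] *(5)[symmetric]])
    define e where "e = act E (- int n) u"
    have e: "e \<in> elems E" "\<phi> e = e'" using u *(2) by (simp_all add: e_def)
    have ue: "act E (int n) e = u" using u(1) by (simp add: e_def)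
    have "n > deg E e" using *(3) \<phi>_deg[OF e(1)] e(2) by simp
    then have "pmon (Lseq E e n) \<in> fR3 E (Pcls E e) y"
      unfolding fR3_def using e e0 ue u(2) by (intro CollectI exI[of _ e] exI[of _ n]) simp
    moreover have "lc_map f (pmon (Lseq E e n)) = r'" using *(1) e by (simp add: map_Lseq)
    moreover have "Pcls E e \<in> verts E.Q" using e(1) by simp
    moreover have "fst f (Pcls E e) = x'" using e *(4) by (simp add: fst_f)
    ultimately show ?thesis by blast
  qed
qed

lemma fR_map:
  assumes "r \<in> fR E x y"
  shows "lc_map f r \<in> fR E' (fst f x) (fst f y)"
proof -
  consider "r \<in> fR1 E x y" | "r \<in> fR2 E x y" | "r \<in> fR3 E x y" using assms by auto
  then show ?thesis
  proof cases
    case 1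
    then obtain e h j where *: "e \<in> elems E" "h \<in> elems E" "j \<le> deg E e" "j \<le> deg E h"
      "Pcls E e = Pcls E h"
      "\<forall>i\<in>{1..j}. Lcls E (act E (int (deg E e) - int i) e) = Lcls E (act E (int (deg E h) - int i) h)"
      and r: "r = pmon (Lseq E e (deg E e - j)) - pmon (Lseq E h (deg E h - j))"
        "x = Pcls E e" "y = Pcls E (act E (int (deg E e - j)) e)"
      unfolding fR1_def by auto
    have "Lcls E' (act E' (int (deg E e) - int i) (\<phi> e)) = Lcls E' (act E' (int (deg E h) - int i) (\<phi> h))"
      if "i \<in> {1..j}" for i
      using Lcls_image_eq[of "act E (int (deg E e) - int i) e" "act E (int (deg E h) - int i) h"] *(1,2)
        bspec[OF *(6) that] by simp
    then have "lc_map f r \<in> fR1 E' (fst f x) (fst f y)"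
      unfolding fR1_def using * Pcls_image_eq[OF *(1,2,5)]
      by (intro CollectI exI[of _ "\<phi> e"] exI[of _ "\<phi> h"] exI[of _ j])
        (simp add: r lc_map_diff map_Lseq fst_f)
    then show ?thesis by simp
  next
    case 2
    then obtain p where p: "r = pmon p" "E.Q.awalk x p y" "length p > 1"
      "\<not> (\<exists>e\<in>elems E. p = Lseq E e (length p))"
      unfolding E.fR2_iff by auto
    \<comment> \<open>Otherwise the starting element \<open>e'\<close> lifts into \<open>x\<close>,
      and unique path lifting makes \<open>p\<close> the sequence of that lift.\<close>
    have "map (snd f) p \<noteq> Lseq E' e' (length p)" if e': "e' \<in> elems E'" for e'
    proof
      assume eq: "map (snd f) p = Lseq E' e' (length p)"
      have aw: "E'.Q.awalk (fst f x) (map (snd f) p) (fst f y)" by (rule QC.awalk_map[OF p(2)])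
      have aw': "E'.Q.awalk (Pcls E' e') (map (snd f) p) (Pcls E' (act E' (int (length p)) e'))"
        unfolding eq by (rule E'.awalk_Lseq[OF e'])
      have "fst f x = Pcls E' e'" by (rule awalk_ends_unique(1)[OF aw aw']) (use p(3) in auto)
      moreover obtain e0 where e0: "e0 \<in> elems E" "x = Pcls E e0"
        using E.Q.awalk_hd_in_verts[OF p(2)] by auto
      ultimately have "Pcls E' e' = Pcls E' (\<phi> e0)" by (simp add: fst_f)
      then obtain e where e: "e \<in> elems E" "Pcls E e = Pcls E e0" "\<phi> e = e'"
        by (rule P_lift[OF e0(1) e'])
      have "E.Q.awalk x (Lseq E e (length p)) (Pcls E (act E (int (length p)) e))"
        unfolding e0(2) e(2)[symmetric] by (rule E.awalk_Lseq[OF e(1)])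
      from QC.awalk_unique_from[OF p(2) this] have "p = Lseq E e (length p)"
        using eq e map_Lseq[OF e(1)] by simp
      then show False using p(4) e(1) by auto
    qed
    then have "lc_map f r \<in> fR2 E' (fst f x) (fst f y)"
      unfolding E'.fR2_iff using p QC.awalk_map[OF p(2)] by (intro exI[of _ "map (snd f) p"]) auto
    then show ?thesis by simp
  next
    case 3
    then obtain e n where *: "r = pmon (Lseq E e n)" "e \<in> elems E" "n > deg E e"
      "x = Pcls E e" "y = Pcls E (act E (int n) e)"
      unfolding fR3_def by auto
    then have "lc_map f r \<in> fR3 E' (fst f x) (fst f y)"
      unfolding fR3_def
      by (intro CollectI exI[of _ "\<phi> e"] exI[of _ n]) (simp add: map_Lseq fst_f)
    then show ?thesis by simp
  qed
qed

text \<open>The preimage of the ideal of \<open>E'\<close> is an ideal, so it suffices to treat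
  generators.\<close>

lemma ideal_map:
  assumes v: "x \<in> verts E.Q" "y \<in> verts E.Q" and \<rho>: "\<rho> \<in> gen_ideal E.Q (fR E) x y"
  shows "lc_map f \<rho> \<in> (gen_ideal E'.Q (fR E') (fst f x) (fst f y) :: ('f set, 'k::field) path_lc set)"
proof -
  let ?I' = "gen_ideal E'.Q (fR E') :: ('f set, 'f set, 'k) path_rels"
  have "is_rquiver (E.Q, pullback_rels E.Q f ?I')"
    by (rule is_rquiver_pullback[OF E.wf_Q quiver_morphism E'.rquiver_Q])
  then have ideal: "is_ideal E.Q (pullback_rels E.Q f ?I')" by (simp add: is_rquiver_iff)
  have "gen_ideal E.Q (fR E) x y \<subseteq> pullback_rels E.Q f ?I' x y"
  proof (rule gen_ideal_subset[OF ideal], rule subsetI)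
    fix a b and r :: "('e set, 'k) path_lc"
    assume ab: "a \<in> verts E.Q" "b \<in> verts E.Q" and r: "r \<in> fR E a b"
    have "lc_map f r \<in> ?I' (fst f a) (fst f b)"
      by (rule E'.gens_in_ideal[OF fR_map[OF r] QC.vert_map[OF ab(1)] QC.vert_map[OF ab(2)]])
    moreover have "r \<in> paths_lc E.Q a b" by (rule subsetD[OF E.fR_paths r])
    ultimately show "r \<in> pullback_rels E.Q f ?I' a b" by (simp add: pullback_rels_def)
  qed
  from subsetD[OF this \<rho>] show ?thesis by (simp add: pullback_rels_def)
qed

lemma rquiver_cover_fBC:
  "rquiver_cover E.Q E'.Q f (gen_ideal E.Q (fR E) :: ('e set, 'e set, 'k::field) path_rels)
     (fR E') (gen_ideal E'.Q (fR E'))"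
proof (rule rquiver_cover.intro[OF QC.quiver_cover_axioms rquiver_cover_axioms.intro])
  show "is_rquiver (E.Q, gen_ideal E.Q (fR E) :: ('e set, 'e set, 'k) path_rels)" by (rule E.rquiver_Q)
  show "is_rquiver (E'.Q, gen_ideal E'.Q (fR E') :: ('f set, 'f set, 'k) path_rels)" by (rule E'.rquiver_Q)
  show "fR E' x' y' \<subseteq> (paths_lc E'.Q x' y' :: ('f set, 'k) path_lc set)" for x' y'
    by (rule E'.fR_paths)
  show "lc_map f \<rho> \<in> gen_ideal E'.Q (fR E') (fst f x) (fst f y)"
    if "x \<in> verts E.Q" "y \<in> verts E.Q" "\<rho> \<in> gen_ideal E.Q (fR E) x y"
    for x y and \<rho> :: "('e set, 'k) path_lc"
    by (rule ideal_map[OF that])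
  show "\<exists>y\<in>verts E.Q. fst f y = y' \<and> (\<exists>r\<in>gen_ideal E.Q (fR E) x y. lc_map f r = r')"
    if x: "x \<in> verts E.Q" and r': "r' \<in> fR E' (fst f x) y'" for x y' and r' :: "('f set, 'k) path_lc"
  proof -
    obtain y r where "y \<in> verts E.Q" "fst f y = y'" "r \<in> fR E x y" "lc_map f r = r'"
      using fR_from[OF x r'] by auto
    then show ?thesis using E.gens_in_ideal[OF _ x] by (intro bexI[of _ y] conjI bexI[of _ r]) simp_all
  qed
  show "\<exists>x\<in>verts E.Q. fst f x = x' \<and> (\<exists>r\<in>gen_ideal E.Q (fR E) x y. lc_map f r = r')"
    if y: "y \<in> verts E.Q" and r': "r' \<in> fR E' x' (fst f y)" for y x' and r' :: "('f set, 'k) path_lc"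
  proof -
    obtain x r where "x \<in> verts E.Q" "fst f x = x'" "r \<in> fR E x y" "lc_map f r = r'"
      using fR_to[OF y r'] by auto
    then show ?thesis using E.gens_in_ideal[OF _ _ y] by (intro bexI[of _ x] conjI bexI[of _ r]) simp_all
  qed
qed simp

end

section \<open>Deck transformations\<close>

subsection \<open>Walks\<close>

lemma walk_end_Cons [simp]: "walk_end (x, (\<delta>, y) # s) = walk_end (y, s)"
  by simp

declare walk_end.simps [simp del]

lemma walk_end_Nil [simp]: "walk_end (x, []) = x"
  by (simp add: walk_end.simps)

lemma walk_end_append [simp]: "walk_end (x, s @ t) = walk_end (walk_end (x, s), t)"
proof (induction s arbitrary: x)
  case (Cons a s)
  then show ?case by (cases a) simp
qed simp

lemma is_walk_start: "is_walk E (x, s) \<Longrightarrow> x \<in> elems E"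
proof (cases s)
  case (Cons a t)
  then show "is_walk E (x, s) \<Longrightarrow> x \<in> elems E" by (cases a) simp
qed simp

lemma is_walk_append:
  "is_walk E (x, s @ t) \<longleftrightarrow> is_walk E (x, s) \<and> is_walk E (walk_end (x, s), t)"
proof (induction s arbitrary: x)
  case Nil
  then show ?case using is_walk_start[of E x t] by auto
next
  case (Cons a s)
  then show ?case by (cases a) auto
qed

lemma is_walk_end: "is_walk E (x, s) \<Longrightarrow> walk_end (x, s) \<in> elems E"
  using is_walk_append[of E x s "[]"] by simp

fun rev_dir :: "dir \<Rightarrow> dir" where
  "rev_dir Fwd = Bwd"
| "rev_dir Bwd = Fwd"
| "rev_dir Tau = Tau"

lemma rev_dir_rev_dir [simp]: "rev_dir (rev_dir \<delta>) = \<delta>"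
  by (cases \<delta>) auto

text \<open>Steps store their end points, so a reversed step stores the old starting point, which is
  carried along as \<open>x\<close>.\<close>

fun rev_steps :: "'e \<Rightarrow> (dir \<times> 'e) list \<Rightarrow> (dir \<times> 'e) list" where
  "rev_steps x [] = []"
| "rev_steps x ((\<delta>, y) # s) = rev_steps y s @ [(rev_dir \<delta>, x)]"

lemma walk_end_rev_steps: "walk_end (walk_end (x, s), rev_steps x s) = x"
proof (cases s)
  case (Cons a t)
  then show ?thesis by (cases a) simp
qed simp

lemma fwd_steps_Suc: "fwd_steps E e (Suc n) = fwd_steps E e n @ [(Fwd, act E (int (Suc n)) e)]"
  by (simp add: fwd_steps_def)

context fBC
begin

lemma is_step_rev:
  assumes "x \<in> elems E" "is_step E x \<delta> y"
  shows "is_step E y (rev_dir \<delta>) x"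
  using assms by (cases \<delta>) auto

lemma is_walk_rev_steps: "is_walk E (x, s) \<Longrightarrow> is_walk E (walk_end (x, s), rev_steps x s)"
proof (induction s arbitrary: x)
  case (Cons a s)
  obtain \<delta> y where a: "a = (\<delta>, y)" by (cases a)
  have *: "x \<in> elems E" "is_step E x \<delta> y" "is_walk E (y, s)" using Cons.prems by (simp_all add: a)
  have "is_walk E (y, [(rev_dir \<delta>, x)])"
    using is_step_rev[OF *(1,2)] *(1) is_walk_start[OF *(3)] by simp
  then show ?case using Cons.IH[OF *(3)] by (simp add: a is_walk_append walk_end_rev_steps)
qed simp

lemma fwd_steps_walk:
  assumes "e \<in> elems E"
  shows "is_walk E (e, fwd_steps E e n) \<and> walk_end (e, fwd_steps E e n) = act E (int n) e"
proof (induction n)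
  case 0
  then show ?case using assms by (simp add: fwd_steps_def)
next
  case (Suc n)
  then show ?case using assms by (simp add: fwd_steps_Suc is_walk_append)
qed

lemma is_walk_comp:
  assumes "is_walk E u" "is_walk E w" "fst w = walk_end u"
  shows "is_walk E (walk_comp w u)" "walk_end (walk_comp w u) = walk_end w"
  using assms by (cases u; cases w; simp add: walk_comp_def is_walk_append)+

text \<open>(h3) and (h4) relate genuine walks because (f4), respectively (f1) and (f2), justify
  their tau-steps.\<close>

lemma homotopic_ends:
  assumes "homotopic E u v"
  shows "is_walk E u \<and> is_walk E v \<and> fst u = fst v \<and> walk_end u = walk_end v"
  using assms
proof (induction rule: homotopic.induct)
  case (h3 e h)
  have "Pcls E (act E (int (deg E h)) h) = Pcls E (act E (int (deg E e)) e)"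
    using f4[OF h3(1,2)] h3(3) by simp
  then show ?case using h3 fwd_steps_walk[OF h3(1)] fwd_steps_walk[OF h3(2)]
    by (simp add: is_walk_append)
next
  case (h4 e h)
  have "Pcls E h = Pcls E e" "Pcls E (act E 1 h) = Pcls E (act E 1 e)"
    using Lcls_eq_imp_Pcls_eq[OF h4] f2[OF h4] by simp_all
  then show ?case using h4 by simp
next
  case (h5l u v w)
  then show ?case
    using is_walk_comp[of u w] is_walk_comp[of v w] by (simp add: walk_comp_def)
next
  case (h5r u v w)
  then show ?case
    using is_walk_comp[of w u] is_walk_comp[of w v] by (simp add: walk_comp_def)
qed simp_all

end

subsection \<open>Lifting walks\<close>

abbreviation map_steps :: "('e \<Rightarrow> 'f) \<Rightarrow> (dir \<times> 'e) list \<Rightarrow> (dir \<times> 'f) list" where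
  "map_steps \<phi> \<equiv> map (\<lambda>(\<delta>, y). (\<delta>, \<phi> y))"

lemma (in fBC_mor) is_step_map:
  assumes "x \<in> elems E" "y \<in> elems E" "is_step E x \<delta> y"
  shows "is_step E' (\<phi> x) \<delta> (\<phi> y)"
  using assms Pcls_image_eq[OF assms(2,1)] by (cases \<delta>) auto

lemma (in fBC_mor) is_walk_map:
  "is_walk E (x, s) \<Longrightarrow>
    is_walk E' (\<phi> x, map_steps \<phi> s) \<and> walk_end (\<phi> x, map_steps \<phi> s) = \<phi> (walk_end (x, s))"
proof (induction s arbitrary: x)
  case (Cons a s)
  obtain \<delta> y where a: "a = (\<delta>, y)" by (cases a)
  have *: "x \<in> elems E" "is_step E x \<delta> y" "is_walk E (y, s)" using Cons.prems by (simp_all add: a)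
  show ?case using Cons.IH[OF *(3)] is_step_map[OF *(1) is_walk_start[OF *(3)] *(2)] *(1) by (simp add: a)
qed simp

context fBC_cov
begin

text \<open>Within the class of \<open>e\<close> the map \<phi> is bijective onto the class below,
  so the description is unique whenever the step below is valid.\<close>

definition tau_lift :: "'e \<Rightarrow> 'f \<Rightarrow> 'e" where
  "tau_lift e y' = (THE y. y \<in> elems E \<and> Pcls E y = Pcls E e \<and> \<phi> y = y')"

definition step_lift :: "'e \<Rightarrow> dir \<times> 'f \<Rightarrow> 'e" where
  "step_lift e d = (case fst d of Fwd \<Rightarrow> act E 1 e | Bwd \<Rightarrow> act E (-1) e | Tau \<Rightarrow> tau_lift e (snd d))"

text \<open>The end of the lift is computed without building the lifted walk: it is what homotopic
  walks have in common, and concatenation becomes composition.\<close>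

definition lift_end :: "'e \<Rightarrow> (dir \<times> 'f) list \<Rightarrow> 'e" where
  "lift_end e s = foldl step_lift e s"

lemma lift_end_Nil [simp]: "lift_end e [] = e"
  and lift_end_Cons [simp]: "lift_end e (d # s) = lift_end (step_lift e d) s"
  and lift_end_append [simp]: "lift_end e (s @ t) = lift_end (lift_end e s) t"
  by (simp_all add: lift_end_def)

lemma step_lift_eq:
  assumes "e \<in> elems E" "y \<in> elems E" "is_step E e \<delta> y"
  shows "step_lift e (\<delta>, \<phi> y) = y"
proof (cases \<delta>)
  case Tau
  have "tau_lift e (\<phi> y) = y"
    unfolding tau_lift_def
  proof (rule the_equality)
    show "y \<in> elems E \<and> Pcls E y = Pcls E e \<and> \<phi> y = \<phi> y" using assms Tau by simp
    show "z = y" if "z \<in> elems E \<and> Pcls E z = Pcls E e \<and> \<phi> z = \<phi> y" for z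
      using that assms Tau by (intro \<phi>_inj) auto
  qed
  then show ?thesis by (simp add: step_lift_def Tau)
qed (use assms in \<open>simp_all add: step_lift_def\<close>)

lemma step_lift:
  assumes e: "e \<in> elems E" and y': "y' \<in> elems E'" and s: "is_step E' (\<phi> e) \<delta> y'"
  shows "step_lift e (\<delta>, y') \<in> elems E" "\<phi> (step_lift e (\<delta>, y')) = y'"
    "is_step E e \<delta> (step_lift e (\<delta>, y'))"
proof -
  have "\<exists>y\<in>elems E. \<phi> y = y' \<and> is_step E e \<delta> y"
  proof (cases \<delta>)
    case Fwd
    then show ?thesis using e s by (intro bexI[of _ "act E 1 e"]) auto
  next
    case Bwd
    then show ?thesis using e s by (intro bexI[of _ "act E (-1) e"]) auto
  next
    case Tau
    then obtain y where "y \<in> elems E" "Pcls E y = Pcls E e" "\<phi> y = y'"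
      using P_lift[OF e y'] s by auto
    then show ?thesis using Tau by (intro bexI[of _ y]) auto
  qed
  then obtain y where y: "y \<in> elems E" "\<phi> y = y'" "is_step E e \<delta> y" by auto
  have "step_lift e (\<delta>, y') = y" using step_lift_eq[OF e y(1,3)] y(2) by simp
  then show "step_lift e (\<delta>, y') \<in> elems E" "\<phi> (step_lift e (\<delta>, y')) = y'"
    "is_step E e \<delta> (step_lift e (\<delta>, y'))"
    using y by simp_all
qed

lemma step_lift_cancel:
  assumes e: "e \<in> elems E" and y': "y' \<in> elems E'" and s: "is_step E' (\<phi> e) \<delta> y'"
  shows "step_lift (step_lift e (\<delta>, y')) (rev_dir \<delta>, \<phi> e) = e"
  using step_lift[OF assms] e by (intro step_lift_eq E.is_step_rev) auto

lemma lift_walk: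
  assumes "is_walk E' (\<phi> e, s)" "e \<in> elems E"
  shows "\<exists>t. is_walk E (e, t) \<and> map_steps \<phi> t = s \<and> walk_end (e, t) = lift_end e s"
  using assms
proof (induction s arbitrary: e)
  case Nil
  then show ?case by (intro exI[of _ "[]"]) simp
next
  case (Cons a s)
  obtain \<delta> y' where a: "a = (\<delta>, y')" by (cases a)
  let ?y = "step_lift e (\<delta>, y')"
  have *: "is_step E' (\<phi> e) \<delta> y'" "is_walk E' (y', s)" using Cons.prems by (simp_all add: a)
  have y: "?y \<in> elems E" "\<phi> ?y = y'" "is_step E e \<delta> ?y"
    by (rule step_lift[OF Cons.prems(2) is_walk_start[OF *(2)] *(1)])+
  obtain t where "is_walk E (?y, t)" "map_steps \<phi> t = s" "walk_end (?y, t) = lift_end ?y s"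
    using Cons.IH[of ?y] y(1,2) *(2) by auto
  then show ?case using y Cons.prems(2) by (intro exI[of _ "(\<delta>, ?y) # t"]) (simp add: a)
qed

lemma lift_end_walk:
  assumes "is_walk E' (\<phi> e, s)" "e \<in> elems E"
  shows "lift_end e s \<in> elems E" "\<phi> (lift_end e s) = walk_end (\<phi> e, s)"
proof -
  obtain t where t: "is_walk E (e, t)" "map_steps \<phi> t = s" "walk_end (e, t) = lift_end e s"
    using lift_walk[OF assms] by auto
  show "lift_end e s \<in> elems E" using is_walk_end[OF t(1)] t(3) by simp
  show "\<phi> (lift_end e s) = walk_end (\<phi> e, s)" using is_walk_map[OF t(1)] t(2,3) by simp
qed

lemma lift_end_map: "is_walk E (e, t) \<Longrightarrow> lift_end e (map_steps \<phi> t) = walk_end (e, t)"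
proof (induction t arbitrary: e)
  case (Cons a t)
  obtain \<delta> y where a: "a = (\<delta>, y)" by (cases a)
  have *: "e \<in> elems E" "is_step E e \<delta> y" "is_walk E (y, t)" using Cons.prems by (simp_all add: a)
  show ?case using Cons.IH[OF *(3)] step_lift_eq[OF *(1) is_walk_start[OF *(3)] *(2)] by (simp add: a)
qed simp

lemma lift_end_rev:
  assumes "is_walk E' (\<phi> e, s)" "e \<in> elems E"
  shows "lift_end (lift_end e s) (rev_steps (\<phi> e) s) = e"
  using assms
proof (induction s arbitrary: e)
  case (Cons a s)
  obtain \<delta> y' where a: "a = (\<delta>, y')" by (cases a)
  let ?y = "step_lift e (\<delta>, y')"
  have *: "is_step E' (\<phi> e) \<delta> y'" "is_walk E' (y', s)" using Cons.prems by (simp_all add: a)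
  note y' = is_walk_start[OF *(2)]
  have y: "?y \<in> elems E" "\<phi> ?y = y'" by (rule step_lift[OF Cons.prems(2) y' *(1)])+
  have "lift_end (lift_end ?y s) (rev_steps y' s) = ?y" using Cons.IH[of ?y] y *(2) by simp
  then show ?case using step_lift_cancel[OF Cons.prems(2) y' *(1)] by (simp add: a)
qed simp

text \<open>The companion of \<open>lift_end_rev\<close> in which the reversed walk is lifted first;
  \<open>e\<close> stays over the end of the walk while the start varies in the induction.\<close>

lemma lift_end_rev':
  assumes "is_walk E' (x', s)" "e \<in> elems E" "\<phi> e = walk_end (x', s)"
  shows "lift_end (lift_end e (rev_steps x' s)) s = e"
  using assms
proof (induction s arbitrary: x')
  case (Cons a s)
  obtain \<delta> y' where a: "a = (\<delta>, y')" by (cases a)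
  have *: "x' \<in> elems E'" "is_step E' x' \<delta> y'" "is_walk E' (y', s)" "\<phi> e = walk_end (y', s)"
    using Cons.prems by (simp_all add: a)
  let ?d = "lift_end e (rev_steps y' s)"
  have "is_walk E' (\<phi> e, rev_steps y' s)" using E'.is_walk_rev_steps[OF *(3)] *(4) by simp
  from lift_end_walk[OF this assms(2)] have d: "?d \<in> elems E" "\<phi> ?d = y'"
    using walk_end_rev_steps[of y' s] *(4) by simp_all
  have "is_step E' (\<phi> ?d) (rev_dir \<delta>) x'" using E'.is_step_rev[OF *(1,2)] d(2) by simp
  from step_lift_cancel[OF d(1) *(1) this]
  have "step_lift (step_lift ?d (rev_dir \<delta>, x')) (\<delta>, y') = ?d" using d(2) by simp
  then show ?case using Cons.IH[OF *(3) assms(2) *(4)] by (simp add: a)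
qed simp

lemma lift_end_fwd: "e \<in> elems E \<Longrightarrow> lift_end e (fwd_steps E' (\<phi> e) n) = act E (int n) e"
proof (induction n)
  case 0
  then show ?case by (simp add: fwd_steps_def)
next
  case (Suc n)
  then show ?case by (simp add: fwd_steps_Suc step_lift_def)
qed

text \<open>Every generating homotopy lifts: (h3) because (f4) holds for \<open>e\<close> and the
  lift of \<open>h'\<close> in its P-class, (h4) because \<phi> is bijective on L-classes and (f2)
  holds upstairs. Composition on the right moves the starting point, hence \<open>e\<close> is
  arbitrary.\<close>

lemma homotopic_lift_end:
  assumes "homotopic E' u v" "e \<in> elems E" "\<phi> e = fst u"
  shows "lift_end e (snd u) = lift_end e (snd v)"
  using assms
proof (induction arbitrary: e rule: homotopic.induct)
  case (hsym u v)
  then show ?case using E'.homotopic_ends[of u v] by simp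
next
  case (htrans u v w)
  then show ?case using E'.homotopic_ends[of u v] by simp
next
  case (h1c x)
  then show ?case using step_lift_eq[of e e Tau] by simp
next
  case (h2 x0 x1 x2)
  have s: "x1 \<in> elems E'" "x2 \<in> elems E'" "is_step E' (\<phi> e) Tau x1" "is_step E' x1 Tau x2"
    using h2 by auto
  let ?y = "step_lift e (Tau, x1)"
  have y: "?y \<in> elems E" "\<phi> ?y = x1" "Pcls E ?y = Pcls E e"
    using step_lift[OF h2(2) s(1,3)] by simp_all
  let ?z = "step_lift ?y (Tau, x2)"
  have z: "?z \<in> elems E" "\<phi> ?z = x2" "Pcls E ?z = Pcls E ?y"
    using step_lift[OF y(1) s(2), of Tau] s(4) y(2) by simp_all
  have "step_lift e (Tau, \<phi> ?z) = ?z" using y(3) z(1,3) by (intro step_lift_eq h2(2)) simp_all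
  then show ?case using z(2) by simp
next
  case (h3 x h')
  have e: "e \<in> elems E" "\<phi> e = x" using h3 by simp_all
  obtain h where h: "h \<in> elems E" "Pcls E h = Pcls E e" "\<phi> h = h'"
    by (rule P_lift[OF e(1) h3(2)]) (use h3(3) e(2) in simp)
  let ?x = "act E (int (deg E e)) e" and ?y = "act E (int (deg E h)) h"
  have d: "deg E' x = deg E e" "deg E' h' = deg E h" using \<phi>_deg e h by auto
  have "Pcls E ?y = Pcls E ?x" using E.f4[OF e(1) h(1)] h(2) by simp
  then have "step_lift ?x (Tau, \<phi> ?y) = ?y" using e h by (intro step_lift_eq) simp_all
  moreover have "\<phi> ?y = act E' (int (deg E' h')) h'" using h(1,3) d by simp
  moreover have "step_lift e (Tau, \<phi> h) = h" using e h by (intro step_lift_eq) simp_all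
  ultimately show ?case
    using lift_end_fwd[OF e(1), of "deg E' x"] lift_end_fwd[OF h(1), of "deg E' h'"] e(2) h(3) d by simp
next
  case (h4 x h')
  have e: "e \<in> elems E" "\<phi> e = x" using h4 by simp_all
  obtain h where h: "h \<in> elems E" "Lcls E h = Lcls E e" "\<phi> h = h'"
    by (rule L_lift[OF e(1) h4(2)]) (use h4(3) e(2) in simp)
  have "Pcls E h = Pcls E e" by (rule E.Lcls_eq_imp_Pcls_eq[OF h(1) e(1) h(2)])
  then have 1: "step_lift e (Tau, \<phi> h) = h" using e h by (intro step_lift_eq) simp_all
  have "Pcls E (act E 1 h) = Pcls E (act E 1 e)" by (rule E.f2[OF h(1) e(1) h(2)])
  then have "step_lift (act E 1 e) (Tau, \<phi> (act E 1 h)) = act E 1 h"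
    using e h by (intro step_lift_eq) simp_all
  then show ?case using 1 e h by (simp add: step_lift_def)
next
  case (h5l u v w)
  then show ?case by (simp add: walk_comp_def)
next
  case (h5r u v w)
  have "\<phi> (lift_end e (snd w)) = fst u" "lift_end e (snd w) \<in> elems E"
    using lift_end_walk[of e "snd w"] h5r by (simp_all add: walk_comp_def)
  then show ?case using h5r.IH[of "lift_end e (snd w)"] by (simp add: walk_comp_def)
qed (simp_all add: step_lift_def)

end

subsection \<open>Regular coverings\<close>

lemma hclass_iff: "v \<in> hclass E w \<longleftrightarrow> homotopic E w v"
  by (simp add: hclass_def)

locale fBC_connected_cov = fBC_cov +
  assumes conn: "fBC_connected E" and conn': "fBC_connected E'"
begin

lemma obtain_walk:
  assumes "x \<in> elems E" "y \<in> elems E"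
  obtains t where "is_walk E (x, t)" "walk_end (x, t) = y"
proof -
  obtain w where "is_walk E w" "fst w = x" "walk_end w = y"
    using conn assms unfolding fBC_connected_def by blast
  then show ?thesis using that[of "snd w"] by (cases w) simp
qed

lemma obtain_walk_down:
  assumes "x \<in> elems E" "y \<in> elems E"
  obtains s where "is_walk E' (\<phi> x, s)" "lift_end x s = y"
proof -
  obtain t where t: "is_walk E (x, t)" "walk_end (x, t) = y" by (rule obtain_walk[OF assms])
  show ?thesis using that[of "map_steps \<phi> t"] is_walk_map[OF t(1)] lift_end_map[OF t(1)] t(2) by simp
qed

text \<open>A tau-step stays at one vertex and a step by g or its inverse follows an arrow forwards
  or backwards, so a walk never leaves such a set of vertices.\<close>

lemma cut_connected:
  assumes S: "S \<subseteq> verts E.Q" "S \<noteq> {}"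
    and closed: "\<And>a. a \<in> arcs E.Q \<Longrightarrow> tail E.Q a \<in> S \<longleftrightarrow> head E.Q a \<in> S"
  shows "S = verts E.Q"
proof -
  have fwd: "Pcls E x \<in> S \<longleftrightarrow> Pcls E (act E 1 x) \<in> S" if "x \<in> elems E" for x
    using closed[of "Lcls E x"] that by (simp add: E.tail_Q E.head_Q)
  have step: "Pcls E y \<in> S" if "x \<in> elems E" "is_step E x \<delta> y" "Pcls E x \<in> S" for x \<delta> y
    using that fwd[of x] fwd[of "act E (-1) x"] by (cases \<delta>) simp_all
  have walk: "Pcls E (walk_end (x, t)) \<in> S" if "is_walk E (x, t)" "Pcls E x \<in> S" for x t
    using that
  proof (induction t arbitrary: x)
    case (Cons a t)
    then show ?case by (cases a) (auto dest: step)
  qed simp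
  obtain x where x: "x \<in> elems E" "Pcls E x \<in> S" using S by auto
  have "Pcls E y \<in> S" if y: "y \<in> elems E" for y
  proof -
    obtain t where "is_walk E (x, t)" "walk_end (x, t) = y" by (rule obtain_walk[OF x(1) y])
    then show ?thesis using walk[of x t] x(2) by simp
  qed
  then show ?thesis using S(1) by auto
qed

text \<open>Any element below is reached by a walk from \<open>\<phi> e\<close>, and the lift of
  this walk ends over it.\<close>

lemma \<phi>_surj:
  assumes "e \<in> elems E" "y' \<in> elems E'"
  obtains y where "y \<in> elems E" "\<phi> y = y'"
proof -
  obtain w where "is_walk E' w" "fst w = \<phi> e" "walk_end w = y'"
    using conn' \<phi>_closed[OF assms(1)] assms(2) unfolding fBC_connected_def by blast
  then show ?thesis using that lift_end_walk[of e "snd w"] assms(1) by (cases w) simp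
qed

end

locale fBC_regular_cov = fBC_connected_cov +
  fixes e0 :: 'a
  assumes e0 [simp]: "e0 \<in> elems E"
    and normal: "fund_map E' \<phi> ` carrier (fund_group E e0) \<lhd> fund_group E' (\<phi> e0)"
begin

text \<open>
  If \<open>n\<close> lifts to a closed walk at \<open>e0\<close> and \<open>x\<close> is the image of a walk from \<open>e0\<close> to \<open>e3\<close>, then by
  normality \<open>n x\<close> is homotopic to \<open>x v\<close> where \<open>v\<close> lifts to a closed walk at \<open>e0\<close>; comparing the
  end points of the lifts at \<open>e0\<close> shows that \<open>n\<close> lifts to a closed walk at \<open>e3\<close>.
\<close>

lemma lift_closed_base:
  assumes e3: "e3 \<in> elems E" "\<phi> e3 = \<phi> e0"
    and n: "is_walk E' (\<phi> e0, n)" "lift_end e0 n = e0"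
  shows "lift_end e3 n = e3"
proof -
  let ?G = "fund_group E' (\<phi> e0)" and ?N = "fund_map E' \<phi> ` carrier (fund_group E e0)"
  obtain t where t: "is_walk E (e0, t)" "map_steps \<phi> t = n" "walk_end (e0, t) = lift_end e0 n"
    using lift_walk[OF n(1) e0] by auto
  let ?H = "fund_map E' \<phi> (hclass E (e0, t))"
  have "hclass E (e0, t) \<in> carrier (fund_group E e0)"
    using t n by (simp add: fund_group_def)
  then have H: "?H \<in> ?N" by (rule imageI)
  have "(\<phi> e0, n) \<in> ?H"
    unfolding fund_map_def using t n(1)
    by (intro UN_I[of "(e0, t)"]) (simp_all add: hclass_iff walk_map_def hrefl)
  note nH = this
  obtain g where g: "is_walk E (e0, g)" "walk_end (e0, g) = e3" by (rule obtain_walk[OF e0 e3(1)])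
  let ?x = "(\<phi> e0, map_steps \<phi> g)"
  have x: "is_walk E' ?x" "walk_end ?x = \<phi> e0" "lift_end e0 (snd ?x) = e3"
    using is_walk_map[OF g(1)] lift_end_map[OF g(1)] g(2) e3(2) by simp_all
  let ?X = "hclass E' ?x"
  have X: "?X \<in> carrier ?G" using x by (simp add: fund_group_def)
  have xX: "?x \<in> ?X" using x(1) by (simp add: hclass_iff hrefl)
  \<comment> \<open>Normality in the form of equal cosets of \<open>?X\<close>: it trades
    \<open>?H\<close> on the left for some \<open>K\<close> on the right.\<close>
  have "?N #>\<^bsub>?G\<^esub> ?X = ?X <#\<^bsub>?G\<^esub> ?N" using normal.coset_eq[OF normal] X by blast
  moreover have "?H \<otimes>\<^bsub>?G\<^esub> ?X \<in> ?N #>\<^bsub>?G\<^esub> ?X" unfolding r_coset_def using H by blast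
  ultimately have "?H \<otimes>\<^bsub>?G\<^esub> ?X \<in> ?X <#\<^bsub>?G\<^esub> ?N" by simp
  then obtain K where K: "K \<in> ?N" "?H \<otimes>\<^bsub>?G\<^esub> ?X = ?X \<otimes>\<^bsub>?G\<^esub> K" unfolding l_coset_def by blast
  let ?nx = "walk_comp (\<phi> e0, n) ?x"
  have "is_walk E' ?nx" by (rule E'.is_walk_comp(1)[OF x(1) n(1)]) (simp add: x(2))
  then have "?nx \<in> hclass E' ?nx" by (simp add: hclass_iff hrefl)
  then have "?nx \<in> ?H \<otimes>\<^bsub>?G\<^esub> ?X"
    using nH xX unfolding fund_group_def monoid.simps by blast
  \<comment> \<open>A product is a union of classes over representatives; only representatives can
    be lifted, so \<open>u\<close> and \<open>v\<close> are extracted here.\<close>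
  then obtain u v where uv: "homotopic E' ?x u" "v \<in> K" "homotopic E' (walk_comp u v) ?nx"
    unfolding K(2) unfolding fund_group_def monoid.simps hclass_iff[symmetric] by blast
  obtain w0 where w0: "is_walk E w0" "fst w0 = e0" "walk_end w0 = e0"
    and K': "K = fund_map E' \<phi> (hclass E w0)"
    using K(1) by (auto simp: fund_group_def)
  obtain w where w: "homotopic E w0 w" "homotopic E' (walk_map \<phi> w) v"
    using uv(2) unfolding K' fund_map_def by (auto simp: hclass_iff)
  have w': "is_walk E (e0, snd w)" "walk_end (e0, snd w) = e0" "fst w = e0"
    using E.homotopic_ends[OF w(1)] w0 by (cases w; simp)+
  have "lift_end e0 (snd (walk_map \<phi> w)) = lift_end e0 (snd v)"
    by (rule homotopic_lift_end[OF w(2) e0]) (simp add: walk_map_def w'(3))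
  then have v: "lift_end e0 (snd v) = e0"
    using lift_end_map[OF w'(1)] w'(2) by (simp add: walk_map_def)
  have u: "lift_end e0 (snd u) = e3"
    using homotopic_lift_end[OF uv(1) e0] x(3) by simp
  have fv: "\<phi> e0 = fst v"
    using E'.homotopic_ends[OF w(2)] w'(3) by (simp add: walk_map_def)
  have "lift_end e0 (snd (walk_comp u v)) = lift_end e0 (snd ?nx)"
    by (rule homotopic_lift_end[OF uv(3) e0]) (simp add: walk_comp_def fv)
  then show ?thesis using u v x(3) by (simp add: walk_comp_def)
qed

text \<open>Conjugating by a walk whose lift leads from \<open>e0\<close> to \<open>e1\<close> gives
  a closed walk at the base point; lifting the reversed walk from \<open>e2\<close> leads to the
  element \<open>?e3\<close> over \<open>\<phi> e0\<close> to which \<open>lift_closed_base\<close>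
  applies.\<close>

lemma lift_closed:
  assumes e: "e1 \<in> elems E" "e2 \<in> elems E" "\<phi> e1 = \<phi> e2"
    and s: "is_walk E' (\<phi> e1, s)" "lift_end e1 s = e1"
  shows "lift_end e2 s = e2"
proof -
  obtain c where c: "is_walk E' (\<phi> e0, c)" "lift_end e0 c = e1" by (rule obtain_walk_down[OF e0 e(1)])
  have cend: "walk_end (\<phi> e0, c) = \<phi> e1" using lift_end_walk[OF c(1) e0] c(2) by simp
  have send: "walk_end (\<phi> e1, s) = \<phi> e1" using lift_end_walk[OF s(1) e(1)] s(2) by simp
  let ?r = "rev_steps (\<phi> e0) c"
  have r: "is_walk E' (\<phi> e1, ?r)" using E'.is_walk_rev_steps[OF c(1)] cend by simp
  have rend: "walk_end (\<phi> e1, ?r) = \<phi> e0" using walk_end_rev_steps[of "\<phi> e0" c] cend by simp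
  let ?e3 = "lift_end e2 ?r" and ?n = "c @ s @ ?r"
  have e3: "?e3 \<in> elems E" "\<phi> ?e3 = \<phi> e0" using lift_end_walk[of e2 ?r] r rend e by simp_all
  have c3: "lift_end ?e3 c = e2" by (rule lift_end_rev'[OF c(1) e(2)]) (simp add: cend e(3))
  have "is_walk E' (\<phi> e0, ?n)" using c(1) s(1) r cend send by (simp add: is_walk_append)
  moreover have "lift_end e0 ?n = e0" using c s lift_end_rev[OF c(1) e0] by simp
  ultimately have "lift_end ?e3 ?n = ?e3" by (rule lift_closed_base[OF e3])
  then have "lift_end (lift_end e2 s) ?r = ?e3" using c3 by simp
  then have "lift_end (lift_end (lift_end e2 s) ?r) c = lift_end ?e3 c" by simp
  moreover have "lift_end (lift_end (lift_end e2 s) ?r) c = lift_end e2 s"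
    using lift_end_walk[of e2 s] s(1) send cend e
    by (intro lift_end_rev'[OF c(1)]) simp_all
  ultimately show ?thesis using c3 by simp
qed

text \<open>Apply \<open>lift_closed\<close> to \<open>s\<close> followed by the reverse of
  \<open>t\<close>.\<close>

lemma lift_end_eq:
  assumes e: "e1 \<in> elems E" "e2 \<in> elems E" "\<phi> e1 = \<phi> e2"
    and s: "is_walk E' (\<phi> e1, s)" and t: "is_walk E' (\<phi> e1, t)"
    and eq: "lift_end e1 s = lift_end e1 t"
  shows "lift_end e2 s = lift_end e2 t"
proof -
  let ?r = "rev_steps (\<phi> e1) t"
  have ends: "walk_end (\<phi> e1, s) = walk_end (\<phi> e1, t)"
    using lift_end_walk(2)[OF s e(1)] lift_end_walk(2)[OF t e(1)] eq by simp
  have "is_walk E' (\<phi> e1, s @ ?r)"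
    using s E'.is_walk_rev_steps[OF t] ends by (simp add: is_walk_append)
  moreover have "lift_end e1 (s @ ?r) = e1" using lift_end_rev[OF t e(1)] eq by simp
  ultimately have "lift_end e2 (s @ ?r) = e2" by (rule lift_closed[OF e])
  then have "lift_end (lift_end (lift_end e2 s) ?r) t = lift_end e2 t" by simp
  moreover have "lift_end (lift_end (lift_end e2 s) ?r) t = lift_end e2 s"
    using lift_end_walk[of e2 s] s e ends by (intro lift_end_rev'[OF t]) simp_all
  ultimately show ?thesis by simp
qed

section \<open>Deck transformations of the configuration\<close>

definition deck :: "'a \<Rightarrow> 'a \<Rightarrow> 'a \<Rightarrow> 'a" where
  "deck e1 e2 x = lift_end e2 (SOME s. is_walk E' (\<phi> e1, s) \<and> lift_end e1 s = x)"

context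
  fixes e1 e2
  assumes e1: "e1 \<in> elems E" and e2: "e2 \<in> elems E" and fibre: "\<phi> e1 = \<phi> e2"
begin

text \<open>By \<open>lift_end_eq\<close> the walk chosen in the definition of \<open>deck\<close>
  is immaterial.\<close>

lemma deck_lift_end: "is_walk E' (\<phi> e1, s) \<Longrightarrow> deck e1 e2 (lift_end e1 s) = lift_end e2 s"
proof -
  assume s: "is_walk E' (\<phi> e1, s)"
  let ?t = "SOME t. is_walk E' (\<phi> e1, t) \<and> lift_end e1 t = lift_end e1 s"
  have "is_walk E' (\<phi> e1, ?t) \<and> lift_end e1 ?t = lift_end e1 s"
    by (rule someI_ex) (use s in blast)
  then show ?thesis unfolding deck_def by (intro lift_end_eq[OF e1 e2 fibre _ s]) simp_all
qed

lemma deck_base: "deck e1 e2 e1 = e2"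
  using deck_lift_end[of "[]"] e1 by simp

lemma deck_fibre:
  assumes "x \<in> elems E"
  shows "deck e1 e2 x \<in> elems E" "\<phi> (deck e1 e2 x) = \<phi> x"
proof -
  obtain s where s: "is_walk E' (\<phi> e1, s)" "lift_end e1 s = x" by (rule obtain_walk_down[OF e1 assms])
  have s2: "is_walk E' (\<phi> e2, s)" using s(1) fibre by simp
  show "deck e1 e2 x \<in> elems E" "\<phi> (deck e1 e2 x) = \<phi> x"
    using deck_lift_end[OF s(1)] s(2) lift_end_walk[OF s2 e2] lift_end_walk[OF s(1) e1] fibre
    by simp_all
qed

text \<open>Append the step to a walk reaching \<open>x\<close>; the lift from \<open>e2\<close>
  then ends with the corresponding step.\<close>

lemma deck_step:
  assumes xy: "x \<in> elems E" "y \<in> elems E" "is_step E x \<delta> y"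
  shows "is_step E (deck e1 e2 x) \<delta> (deck e1 e2 y)"
proof -
  obtain s where s: "is_walk E' (\<phi> e1, s)" "lift_end e1 s = x" by (rule obtain_walk_down[OF e1 xy(1)])
  have D: "deck e1 e2 x = lift_end e2 s" using deck_lift_end[OF s(1)] s(2) by simp
  have st: "is_step E' (\<phi> x) \<delta> (\<phi> y)" by (rule is_step_map[OF xy])
  let ?s = "s @ [(\<delta>, \<phi> y)]"
  have "is_walk E' (\<phi> e1, ?s)"
    using s(1) st xy lift_end_walk[OF s(1) e1] s(2) is_walk_end[OF s(1)] by (simp add: is_walk_append)
  from deck_lift_end[OF this] have "deck e1 e2 y = step_lift (deck e1 e2 x) (\<delta>, \<phi> y)"
    using s(2) step_lift_eq[OF xy] D by simp
  moreover have "is_step E (deck e1 e2 x) \<delta> (step_lift (deck e1 e2 x) (\<delta>, \<phi> y))"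
    by (rule step_lift(3)) (use xy st deck_fibre[OF xy(1)] in simp_all)
  ultimately show ?thesis by simp
qed

lemma deck_act: "x \<in> elems E \<Longrightarrow> deck e1 e2 (act E n x) = act E n (deck e1 e2 x)"
proof (induction n rule: int_induct[where k = 0])
  case base
  then show ?case by (simp add: deck_fibre)
next
  case (step1 i)
  then show ?case
    using deck_step[of "act E i x" "act E (i + 1) x" Fwd] by (simp add: deck_fibre add.commute)
next
  case (step2 i)
  then show ?case
    using deck_step[of "act E i x" "act E (i - 1) x" Bwd] by (simp add: deck_fibre)
qed

lemma deck_P: "x \<in> elems E \<Longrightarrow> y \<in> elems E \<Longrightarrow> Pcls E y = Pcls E x \<Longrightarrow>
    Pcls E (deck e1 e2 y) = Pcls E (deck e1 e2 x)"
  using deck_step[of x y Tau] by simp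

text \<open>Walks do not see L-classes. These are recovered from the P-class and the image in
  \<open>E'\<close>, which agree for both elements.\<close>

lemma deck_L:
  assumes "x \<in> elems E" "y \<in> elems E" "Lcls E y = Lcls E x"
  shows "Lcls E (deck e1 e2 y) = Lcls E (deck e1 e2 x)"
proof (rule Lcls_reflect_tail)
  show "Pcls E (deck e1 e2 y) = Pcls E (deck e1 e2 x)"
    by (rule deck_P[OF assms(1,2) E.Lcls_eq_imp_Pcls_eq[OF assms(2,1,3)]])
  show "Lcls E' (\<phi> (deck e1 e2 y)) = Lcls E' (\<phi> (deck e1 e2 x))"
    using Lcls_image_eq[OF assms(2,1,3)] assms by (simp add: deck_fibre)
qed (use assms deck_fibre in auto)

lemma deck_morphism: "fBC_morphism E E (deck e1 e2)"
proof -
  have "deck e1 e2 y \<in> Pcls E (deck e1 e2 x)" if "x \<in> elems E" "y \<in> Pcls E x" for x y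
  proof -
    have y: "y \<in> elems E" using E.Pcls_subset[OF that(1)] that(2) by auto
    show ?thesis
      using deck_P[OF that(1) y E.Pcls_eq[OF that]] E.Pcls_self[OF deck_fibre(1)[OF y]] by simp
  qed
  moreover have "deck e1 e2 y \<in> Lcls E (deck e1 e2 x)" if "x \<in> elems E" "y \<in> Lcls E x" for x y
  proof -
    have y: "y \<in> elems E" using E.Lcls_subset[OF that(1)] that(2) by auto
    show ?thesis
      using deck_L[OF that(1) y E.Lcls_eq[OF that]] E.Lcls_self[OF deck_fibre(1)[OF y]] by simp
  qed
  moreover have "deg E (deck e1 e2 x) = deg E x" if "x \<in> elems E" for x
    using \<phi>_deg[OF that] \<phi>_deg[OF deck_fibre(1)[OF that]] deck_fibre(2)[OF that] by simp
  ultimately show ?thesis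
    unfolding fBC_morphism_def using E.fBC_axioms by (auto simp: deck_fibre deck_act)
qed

end

text \<open>One walk below reaches \<open>x\<close> from \<open>e1\<close> and its image from
  \<open>e2\<close>, so the roles can be exchanged.\<close>

lemma deck_inverse:
  assumes e: "e1 \<in> elems E" "e2 \<in> elems E" "\<phi> e1 = \<phi> e2" and x: "x \<in> elems E"
  shows "deck e2 e1 (deck e1 e2 x) = x"
proof -
  obtain s where s: "is_walk E' (\<phi> e1, s)" "lift_end e1 s = x" by (rule obtain_walk_down[OF e(1) x])
  have "is_walk E' (\<phi> e2, s)" using s(1) e(3) by simp
  from deck_lift_end[OF e(2,1) e(3)[symmetric] this] deck_lift_end[OF e s(1)] s(2)
  show ?thesis by simp
qed

lemma deck_transitive:
  assumes x: "x \<in> verts E.Q" and y: "y \<in> verts E.Q" and xy: "fst f x = fst f y"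
  shows "\<exists>h\<in>deck_group E.Q f. fst h x = y"
proof -
  obtain e1 y1 where e1: "e1 \<in> elems E" "x = Pcls E e1" and y1: "y1 \<in> elems E" "y = Pcls E y1"
    using x y by auto
  have "Pcls E' (\<phi> e1) = Pcls E' (\<phi> y1)" using xy e1 y1 by (simp add: fst_f)
  \<comment> \<open>Equal images of vertices are equalities of classes only; the element of the
    class \<open>y\<close> over \<open>\<phi> e1\<close> is the one to which \<open>e1\<close> has
    to be moved.\<close>
  then obtain e2 where e2: "e2 \<in> elems E" "Pcls E e2 = Pcls E y1" "\<phi> e2 = \<phi> e1"
    using P_lift[OF y1(1) \<phi>_closed[OF e1(1)]] by auto
  note e = e1(1) e2(1) e2(3)[symmetric]
  note e' = e2(1) e1(1) e2(3)
  interpret D: fBC_mor E E "deck e1 e2" by unfold_locales (rule deck_morphism[OF e])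
  interpret D': fBC_mor E E "deck e2 e1" by unfold_locales (rule deck_morphism[OF e'])
  note cl = deck_fibre(1)[OF e] deck_fibre(1)[OF e']
  note inv = deck_inverse[OF e] deck_inverse[OF e']
  \<comment> \<open>Restricted because \<open>Bij\<close> consists of extensional maps.\<close>
  let ?h = "(restrict (fst D.f) (verts E.Q), restrict (snd D.f) (arcs E.Q))"
  have "bij_betw (fst D.f) (verts E.Q) (verts E.Q)"
    by (rule bij_betw_byWitness[where f' = "fst D'.f"]) (auto simp: D.fst_f D'.fst_f cl inv)
  moreover have "bij_betw (snd D.f) (arcs E.Q) (arcs E.Q)"
    by (rule bij_betw_byWitness[where f' = "snd D'.f"]) (auto simp: D.snd_f D'.snd_f cl inv)
  ultimately have "?h \<in> Bij (verts E.Q) \<times> Bij (arcs E.Q)" by (simp add: Bij_def)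
  moreover have "quiver_morphism E.Q E.Q ?h"
    using D.quiver_morphism E.wf_Q by (simp add: quiver_morphism_def wf_digraph_def)
  moreover have "fst f (fst ?h z) = fst f z" if "z \<in> verts E.Q" for z
    using that by (auto simp: D.fst_f fst_f cl deck_fibre(2)[OF e])
  moreover have "snd f (snd ?h a) = snd f a" if "a \<in> arcs E.Q" for a
    using that by (auto simp: D.snd_f snd_f cl deck_fibre(2)[OF e])
  ultimately have "?h \<in> deck_group E.Q f" by (simp add: deck_group_def)
  moreover have "fst ?h x = y" using e1 e2 y1 deck_base[OF e] by (simp add: D.fst_f)
  ultimately show ?thesis by blast
qed

lemma rquiver_galois_fBC:
  "rquiver_galois E.Q E'.Q f (gen_ideal E.Q (fR E) :: ('a set, 'a set, 'k::field) path_rels)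
     (fR E') (gen_ideal E'.Q (fR E'))"
proof (rule rquiver_galois.intro[OF rquiver_cover_fBC rquiver_galois_axioms.intro])
  show "fst f ` verts E.Q = verts E'.Q"
  proof (rule equalityI)
    show "fst f ` verts E.Q \<subseteq> verts E'.Q" by (auto simp: fst_f)
    show "verts E'.Q \<subseteq> fst f ` verts E.Q"
    proof
      fix y assume "y \<in> verts E'.Q"
      then obtain y' where y': "y' \<in> elems E'" "y = Pcls E' y'" by auto
      obtain z where "z \<in> elems E" "\<phi> z = y'" by (rule \<phi>_surj[OF e0 y'(1)])
      then show "y \<in> fst f ` verts E.Q"
        using y'(2) by (intro image_eqI[of _ _ "Pcls E z"]) (simp_all add: fst_f)
    qed
  qed
qed (rule cut_connected deck_transitive; assumption)+

end

theorem proposition1p6: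
  fixes k :: "'k::field itself"
    and E :: "'e fbc" and E' :: "'f fbc" and \<phi> :: "'e \<Rightarrow> 'f"
  assumes "fsBC E" and "fsBC E'"
    and "fBC_connected E" and "fBC_connected E'"
    and "fBC_covering E E' \<phi>"
  shows "rquiver_covering (fBC_rquiver k E) (fBC_rquiver k E') (fBC_quiver_map E' \<phi>) \<and>
      covering_functor (fBC_cat k E) (fBC_cat k E') (fBC_functor k E' \<phi>) \<and>
      (fBC_regular_covering E E' \<phi> \<longrightarrow>
        rquiver_galois_covering (fBC_rquiver k E) (fBC_rquiver k E') (fBC_quiver_map E' \<phi>) \<and>
        galois_covering_functor (fBC_cat k E) (fBC_cat k E') (fBC_functor k E' \<phi>))"
proof (intro conjI impI)
  interpret fBC_connected_cov E E' \<phi>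
    using assms(3-5) by unfold_locales (simp_all add: fBC_covering_def)
  note rq = fBC_rquiver_def[of k E] fBC_rquiver_def[of k E']
  note defs = fBC_cat_def fBC_functor_def rq
  let ?I = "gen_ideal E.Q (fR E) :: ('e set, 'e set, 'k) path_rels"
  let ?I' = "gen_ideal E'.Q (fR E') :: ('f set, 'f set, 'k) path_rels"
  interpret C: rquiver_cover E.Q E'.Q f ?I "fR E'" ?I' by (rule rquiver_cover_fBC)
  show "rquiver_covering (fBC_rquiver k E) (fBC_rquiver k E') f"
    unfolding rq by (rule C.rquiver_covering)
  show "covering_functor (fBC_cat k E) (fBC_cat k E') (fBC_functor k E' \<phi>)"
    unfolding defs by (rule C.covering_functor)
  assume "fBC_regular_covering E E' \<phi>"
  then obtain e0 where "e0 \<in> elems E"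
    "fund_map E' \<phi> ` carrier (fund_group E e0) \<lhd> fund_group E' (\<phi> e0)"
    by (auto simp: fBC_regular_covering_def)
  then interpret R: fBC_regular_cov E E' \<phi> e0
    by (intro fBC_regular_cov.intro[OF fBC_connected_cov_axioms] fBC_regular_cov_axioms.intro)
  interpret G: rquiver_galois E.Q E'.Q f ?I "fR E'" ?I' by (rule R.rquiver_galois_fBC)
  show "rquiver_galois_covering (fBC_rquiver k E) (fBC_rquiver k E') f"
    unfolding rq by (rule G.galois_covering)
  have "locally_bounded (fBC_cat k E)" "locally_bounded (fBC_cat k E')"
    by (rule E.locally_bounded_fBC E'.locally_bounded_fBC)+
  then show "galois_covering_functor (fBC_cat k E) (fBC_cat k E') (fBC_functor k E' \<phi>)"
    unfolding defs by (rule G.galois_covering_functor)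
qed

end
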